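(* Let $\zeta=(\zeta_r)_{r\in\mathbb{Z}}$ (law $\mathbb{P}$) be the inter-distances of the scatterers $\omega=(\omega_r)_{r\in\mathbb{Z}}$, satisfying the standing assumptions (stationarity, ergodicity, weak entanglement, exponential moments) listed in the context. Let $0\le p<3/4$, let $(S^{(p)}_n)_{n\ge0}$ be the step-reinforced random walk with memory parameter $p$, and let $X^{(p)}_n=\omega_{S^{(p)}_n}$ and $(\widetilde X^{(p)}_t)_{t\ge0}$ be the discrete-time and continuous-time step-reinforced gases. Then, with the positive deterministic constant $\ell:=\lim_{n\to\infty}n^{-1}\omega_n$ ($\mathbb{P}$-a.s.), for $\mathbb{P}$-a.e. realization of the environment the following convergences in distribution hold under the quenched law $P^{(p)}_0$: $$\frac{1}{\sqrt n}X^{(p)}_n\xrightarrow[n\to\infty]{\mathcal L}\mathcal N\big(0,\ell^2(3-4p)^{-1}\big),\qquad \frac{1}{\sqrt t}\widetilde X^{(p)}_t\xrightarrow[t\to\infty]{\mathcal L}\mathcal N\big(0,\ell(3-4p)^{-1}\big),$$ where $\mathcal N(0,\sigma^2)$ denotes the centered Gaussian law with variance $\sigma^2>0$.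
   Context: Environment. $\omega=(\omega_r)_{r\in\mathbb{Z}}$ is a random array of points on the line in ascending order ($\omega_{r-1}<\omega_r$) with $\omega_0=0$, and $\zeta_r:=\omega_r-\omega_{r-1}$, $r\in\mathbb{Z}$. The law of $\zeta=(\zeta_r)_{r\in\mathbb{Z}}$ on the configuration space $\Omega$ is $\mathbb{P}$, with expectation $\mathbb{E}$. Standing assumptions: (i) $\zeta$ is shift-invariant and ergodic in distribution on $\mathbb{Z}$; (ii) (weak entanglement) there exist constants $C,g>0$ such that for all $V\subseteq\mathbb{Z}$ and all finite $\Delta,A\subset\mathbb{Z}$ with $\Delta\subseteq V$, $d_1(\Delta,V^c)\ge 1$ ($d_1$ the $\ell^1$ distance) and $A\subseteq V^c$, $\mathbb{P}$-a.s. simultaneously for all pairs of configurations $\eta,\eta'\in\Omega$ agreeing on $V^c\setminus A$, $$\frac{d\mathbb{P}((\zeta_r)_{r\in\Delta}\in\cdot\,|\,\eta)}{d\mathbb{P}((\zeta_r)_{r\in\Delta}\in\cdot\,|\,\eta')}\le\exp\Big(C\sum_{r\in\Delta,\,u\in A}e^{-g|r-u|}\Big),$$ where $\mathbb{P}(\cdot|\eta)$ is the conditional law given that $\zeta$ coincides with $\eta$ on $V^c$; (iii) $\mathbb{E}[\exp(\mathfrak p\,\zeta_1)]<\infty$ for some $\mathfrak p\ge 2$. Step-reinforced walk. Fix $p\in[0,1]$. $S^{(p)}_0=0$; the first step $V^{(p)}_1$ is uniform on $\{-1,+1\}$. For each $n\ge1$, given the past, choose $k$ uniformly in $\{1,\dots,n\}$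 and set $V^{(p)}_{n+1}=V^{(p)}_k$ with probability $p$ and $V^{(p)}_{n+1}=-V^{(p)}_k$ with probability $1-p$ (all choices independent), and $S^{(p)}_{n+1}=S^{(p)}_n+V^{(p)}_{n+1}$. The law of the walk is $P^{(p)}_0$; it is independent of the environment. Gas. $X^{(p)}_n:=\omega_{S^{(p)}_n}$. Collision times: $T^{(p)}_0=0$, $T^{(p)}_n:=\sum_{k=1}^n|X^{(p)}_k-X^{(p)}_{k-1}|$. Continuous-time gas: $\widetilde X^{(p)}_t:=\omega_{S^{(p)}_{n-1}}+V^{(p)}_n(t-T^{(p)}_{n-1})$ when $T^{(p)}_{n-1}\le t<T^{(p)}_n$. "Quenched" means that the environment $\omega$ is fixed and only the walk is random. *)

theory Defs
  imports "HOL-Probability.Probability"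
begin

section \<open>Environment\<close>

definition gap_space :: "real measure" where
  "gap_space = restrict_space borel {0<..}"

definition config_space :: "(int \<Rightarrow> real) measure" where
  "config_space = (\<Pi>\<^sub>M r\<in>UNIV. gap_space)"

text \<open>For \<open>r \<ge> 0\<close> the second sum is empty, for \<open>r \<le> 0\<close> the first one is.\<close>

definition scatterer :: "(int \<Rightarrow> real) \<Rightarrow> int \<Rightarrow> real" where
  "scatterer \<zeta> r = (\<Sum>i\<in>{1..r}. \<zeta> i) - (\<Sum>i\<in>{r+1..0}. \<zeta> i)"

lemma scatterer_0: "scatterer \<zeta> 0 = 0"
  by (simp add: scatterer_def)

lemma scatterer_diff: "scatterer \<zeta> r - scatterer \<zeta> (r - 1) = \<zeta> r"
proof (cases "r \<ge> 1")
  case True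
  then have "{1..r} = insert r {1..r-1}" by auto
  with True show ?thesis by (simp add: scatterer_def)
next
  case False
  then have "{r..0} = insert r {r+1..0}" by auto
  with False show ?thesis by (simp add: scatterer_def)
qed

definition shift :: "(int \<Rightarrow> real) \<Rightarrow> (int \<Rightarrow> real)" where
  "shift \<zeta> = (\<lambda>r. \<zeta> (r + 1))"

definition shift_invariant :: "(int \<Rightarrow> real) measure \<Rightarrow> bool" where
  "shift_invariant P \<longleftrightarrow> distr P P shift = P"

definition shift_ergodic :: "(int \<Rightarrow> real) measure \<Rightarrow> bool" where
  "shift_ergodic P \<longleftrightarrow>
     (\<forall>B\<in>sets P. shift -` B \<inter> space P = B \<longrightarrow> measure P B = 0 \<or> measure P B = 1)"

definition coord_algebra :: "int set \<Rightarrow> (int \<Rightarrow> real) measure" where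
  "coord_algebra W =
     vimage_algebra (space config_space) (\<lambda>\<zeta>. restrict \<zeta> W) (\<Pi>\<^sub>M r\<in>W. gap_space)"

text \<open>\<open>\<kappa>\<close> is a regular version of the conditional law of the whole configuration given
  its coordinates in \<open>W\<close>.\<close>

definition is_cond_law ::
  "(int \<Rightarrow> real) measure \<Rightarrow> int set \<Rightarrow> ((int \<Rightarrow> real) \<Rightarrow> (int \<Rightarrow> real) measure) \<Rightarrow> bool" where
  "is_cond_law P W \<kappa> \<longleftrightarrow>
     \<kappa> \<in> coord_algebra W \<rightarrow>\<^sub>M prob_algebra config_space \<and>
     (\<forall>B\<in>sets config_space. \<forall>E\<in>sets (coord_algebra W).
        emeasure P (B \<inter> E) = (\<integral>\<^sup>+\<eta>\<in>E. emeasure (\<kappa> \<eta>) B \<partial>P))"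

definition marginal :: "int set \<Rightarrow> (int \<Rightarrow> real) measure \<Rightarrow> (int \<Rightarrow> real) measure" where
  "marginal \<Delta> Q = distr Q (\<Pi>\<^sub>M r\<in>\<Delta>. gap_space) (\<lambda>\<zeta>. restrict \<zeta> \<Delta>)"

text \<open>\<open>RN_deriv\<close> is only meaningful under absolute continuity, which is therefore part of the
  bound on \<open>d\<mu>/d\<nu>\<close>.\<close>

definition density_ratio_le :: "'a measure \<Rightarrow> 'a measure \<Rightarrow> real \<Rightarrow> bool" where
  "density_ratio_le \<mu> \<nu> c \<longleftrightarrow>
     absolutely_continuous \<nu> \<mu> \<and> (AE x in \<nu>. RN_deriv \<nu> \<mu> x \<le> ennreal c)"

text \<open>Conditional laws are determined only up to null sets, so ``almost surely, simultaneously for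
  all pairs'' means: for all pairs taken outside one common null set \<open>N\<close>. Neither the choice of
  the version \<open>\<kappa>\<close> nor the dependence of \<open>N\<close> on \<open>\<Delta>\<close> and \<open>A\<close> (countably many)
  matters.\<close>

definition weak_entanglement :: "(int \<Rightarrow> real) measure \<Rightarrow> bool" where
  "weak_entanglement P \<longleftrightarrow>
     (\<exists>C>0. \<exists>g>0. \<forall>V. \<exists>\<kappa>. is_cond_law P (- V) \<kappa> \<and>
        (\<forall>\<Delta> A. finite \<Delta> \<and> finite A \<and> \<Delta> \<subseteq> V \<and> (\<forall>r\<in>\<Delta>. \<forall>u\<in>- V. 1 \<le> \<bar>r - u\<bar>) \<and> A \<subseteq> - V \<longrightarrow>
           (\<exists>N\<in>null_sets P. \<forall>\<eta>\<in>space P - N. \<forall>\<eta>'\<in>space P - N.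
              (\<forall>r\<in>- V - A. \<eta> r = \<eta>' r) \<longrightarrow>
              density_ratio_le (marginal \<Delta> (\<kappa> \<eta>)) (marginal \<Delta> (\<kappa> \<eta>'))
                (exp (C * (\<Sum>r\<in>\<Delta>. \<Sum>u\<in>A. exp (- g * real_of_int \<bar>r - u\<bar>)))))))"

section \<open>Step-reinforced walk\<close>

text \<open>A walk outcome \<open>(v, c)\<close> consists of the first step \<open>v\<close> and, for every \<open>n \<ge> 1\<close>, the pair
  \<open>c n = (k, b)\<close>: the time \<open>k\<close> that is recalled when making step \<open>n + 1\<close>, and whether that
  step is repeated (\<open>b\<close>) or reversed (\<open>\<not> b\<close>).\<close>

type_synonym walk_outcome = "int \<times> (nat \<Rightarrow> nat \<times> bool)"

definition walk_law :: "real \<Rightarrow> walk_outcome measure" where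
  "walk_law p = measure_pmf (pmf_of_set {- 1, 1}) \<Otimes>\<^sub>M
     (\<Pi>\<^sub>M n\<in>{1..}. measure_pmf (pair_pmf (pmf_of_set {1..n}) (bernoulli_pmf p)))"

text \<open>The value at \<open>n = 0\<close> and the last branch (\<open>k \<notin> {1..n}\<close>, a null event under
  \<open>walk_law p\<close>) only make the function total.\<close>

fun reinforced_step :: "walk_outcome \<Rightarrow> nat \<Rightarrow> int" where
  "reinforced_step w 0 = 0"
| "reinforced_step w (Suc 0) = fst w"
| "reinforced_step w (Suc (Suc m)) =
     (let n = Suc m; k = fst (snd w n); b = snd (snd w n) in
      if 1 \<le> k \<and> k \<le> n
      then (if b then reinforced_step w k else - reinforced_step w k)
      else fst w)"

definition walk :: "walk_outcome \<Rightarrow> nat \<Rightarrow> int" where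
  "walk w n = (\<Sum>k\<in>{1..n}. reinforced_step w k)"

section \<open>Step-reinforced gas\<close>

definition gas :: "(int \<Rightarrow> real) \<Rightarrow> walk_outcome \<Rightarrow> nat \<Rightarrow> real" where
  "gas \<zeta> w n = scatterer \<zeta> (walk w n)"

definition collision_time :: "(int \<Rightarrow> real) \<Rightarrow> walk_outcome \<Rightarrow> nat \<Rightarrow> real" where
  "collision_time \<zeta> w n = (\<Sum>k\<in>{1..n}. \<bar>gas \<zeta> w k - gas \<zeta> w (k - 1)\<bar>)"

definition cont_gas :: "(int \<Rightarrow> real) \<Rightarrow> walk_outcome \<Rightarrow> real \<Rightarrow> real" where
  "cont_gas \<zeta> w t =
     (let n = (THE n. 1 \<le> n \<and> collision_time \<zeta> w (n - 1) \<le> t \<and> t < collision_time \<zeta> w n) in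
      scatterer \<zeta> (walk w (n - 1))
        + of_int (reinforced_step w n) * (t - collision_time \<zeta> w (n - 1)))"

section \<open>Convergence in distribution\<close>

text \<open>The notion \<^const>\<open>weak_conv_m\<close>, for families indexed along an arbitrary filter.\<close>

definition weak_conv_along :: "'i filter \<Rightarrow> ('i \<Rightarrow> real measure) \<Rightarrow> real measure \<Rightarrow> bool" where
  "weak_conv_along F \<mu> M \<longleftrightarrow>
     (\<forall>x. isCont (cdf M) x \<longrightarrow> ((\<lambda>i. cdf (\<mu> i) x) \<longlongrightarrow> cdf M x) F)"

lemma weak_conv_along_sequentially: "weak_conv_along sequentially \<mu> M \<longleftrightarrow> weak_conv_m \<mu> M"
  by (simp add: weak_conv_along_def weak_conv_m_def weak_conv_def)

text \<open>Parametrised by the variance, unlike \<^const>\<open>normal_density\<close>, which takes the standard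
  deviation.\<close>

definition centered_gaussian :: "real \<Rightarrow> real measure" where
  "centered_gaussian v = density lborel (\<lambda>x. ennreal (normal_density 0 (sqrt v) x))"

end

theory Submission
  imports Defs "HOL-Real_Asymp.Real_Asymp"
begin

text \<open>
  Given the past, step \<open>n + 1\<close> of the walk has mean \<open>a S\<^sub>n / n\<close> with \<open>a = 2p - 1 < 1/2\<close>. This makes the
  walk a perturbed martingale: \<open>E S\<^sub>n\<^sup>2 = O(n)\<close>, Kolmogorov's maximal inequality holds up to a small drift,
  and replacing one step after the other by a Gaussian in \<open>E exp (i \<theta> S\<^sub>n)\<close> gives the central limit
  theorem with variance \<open>1 / (1 - 2a) = 1 / (3 - 4p)\<close>.

  By the ergodic theorem \<open>\<omega>\<^sub>x = l x + h x\<close> with \<open>h x = o(|x|)\<close> almost surely. Fix such an environment. Then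
  \<open>X\<^sub>n = l S\<^sub>n + o(\<surd>n)\<close> in probability. The time \<open>T\<^sub>n - l n\<close> is the discrete quadratic covariation of \<open>S\<close>
  and \<open>h(S)\<close>; summation by parts writes it as \<open>G(S\<^sub>n) - 2 \<Sum> h(S\<^sub>k) V\<^sub>k\<^sub>+\<^sub>1\<close> with \<open>G x = o(x\<^sup>2)\<close>, which is
  \<open>o(n)\<close> in mean. So the number of collisions before time \<open>t\<close> is \<open>t/l + o(t)\<close>, and by the maximal
  inequality \<open>X\<^sub>t\<close> differs from \<open>l S\<close> at time \<open>t/l\<close> by \<open>o(\<surd>t)\<close>.
\<close>

section \<open>The ergodic theorem\<close>

text \<open>A fixed environment supplies \<open>h x = o(|x|)\<close> without any rate. All estimates
  are therefore made for an arbitrary pair \<open>e\<close>, \<open>C\<close> with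
  \<open>|h x| \<le> e |x| + C\<close>, and use only first and second moments of the walk. Termwise
  estimates of \<open>T n - l n\<close> are useless: single gaps may differ from \<open>l\<close> by
  order one, and even after the summation by parts the sizes \<open>|h (S k)|\<close> may add up to
  order \<open>e n^(3/2)\<close>. What helps is that each step is a martingale difference plus the
  drift \<open>a S k / k\<close>: orthogonality gains a factor \<open>sqrt n\<close>, and the drift
  has mean size of order \<open>k^(-1/2)\<close>. The restriction \<open>a < 1/2\<close> enters
  through the products of the factors \<open>1 + a / j\<close>, which grow like \<open>n^a\<close>.
  They weigh the influence of early steps on \<open>S n\<close>: each weight must be
  \<open>o(sqrt n)\<close>, while the squares must sum to order \<open>n\<close>. That sum behaves
  like the sum of \<open>(n / k)^(2 a)\<close>, which is where \<open>1 / (1 - 2 a)\<close> comes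
  from.\<close>

lemma birkhoff_sum_funpow:
  fixes f :: "'a \<Rightarrow> real"
  shows "(\<Sum>i<Suc n. f ((T ^^ i) x)) = f x + (\<Sum>i<n. f ((T ^^ i) (T x)))"
  by (subst sum.lessThan_Suc_shift) (simp add: funpow_swap1)

context prob_space
begin

lemma integral_measure_preserving:
  fixes g :: "'a \<Rightarrow> real"
  assumes T[measurable]: "T \<in> M \<rightarrow>\<^sub>M M" and mp: "distr M M T = M"
    and g: "integrable M g"
  shows "integrable M (\<lambda>x. g (T x))" "(\<integral>x. g (T x) \<partial>M) = (\<integral>x. g x \<partial>M)"
proof -
  have [measurable]: "g \<in> borel_measurable M" using g by auto
  have "integrable (distr M M T) g" using g mp by simp
  then show "integrable M (\<lambda>x. g (T x))" by (subst (asm) integrable_distr_eq) auto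
  have "(\<integral>x. g x \<partial>distr M M T) = (\<integral>x. g (T x) \<partial>M)" by (intro integral_distr) auto
  then show "(\<integral>x. g (T x) \<partial>M) = (\<integral>x. g x \<partial>M)" using mp by simp
qed

text \<open>The running maxima \<open>m n\<close> of the Birkhoff sums satisfy \<open>m (n+1) - m n \<circ> T = f - min 0 (m n \<circ> T)\<close>. The
  left-hand side has nonnegative mean, and the right-hand side tends to \<open>f\<close> where the sums are unbounded.\<close>

lemma birkhoff_sums_bounded_above:
  fixes f :: "'a \<Rightarrow> real"
  assumes T[measurable]: "T \<in> M \<rightarrow>\<^sub>M M" and mp: "distr M M T = M"
    and erg: "\<And>B. B \<in> sets M \<Longrightarrow> T -` B \<inter> space M = B \<Longrightarrow> prob B = 0 \<or> prob B = 1"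
    and f: "integrable M f" and neg: "expectation f < 0"
  shows "AE x in M. \<exists>K. \<forall>n. (\<Sum>i<n. f ((T ^^ i) x)) \<le> K"
proof -
  have [measurable]: "f \<in> borel_measurable M" using f by auto
  define S where "S n x = (\<Sum>i<n. f ((T ^^ i) x))" for n x
  have SSuc: "S (Suc n) x = f x + S n (T x)" for n x
    unfolding S_def by (rule birkhoff_sum_funpow)
  have S_meas[measurable]: "S n \<in> borel_measurable M" for n
    unfolding S_def[abs_def] by measurable
  have S_int: "integrable M (S n)" for n
  proof (induction n)
    case 0 then show ?case by (simp add: S_def[abs_def])
  next
    case (Suc n)
    have "S (Suc n) = (\<lambda>x. f x + S n (T x))" by (auto simp: SSuc)
    then show ?case using f integral_measure_preserving(1)[OF T mp Suc] by simp
  qed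
  \<comment> \<open>Unboundedness is insensitive to the single summand \<open>f x\<close> by which
    \<open>S (Suc n) x\<close> and \<open>S n (T x)\<close> differ. Hence \<open>A\<close> is
    invariant, and ergodicity leaves only probability 0 or 1.\<close>
  define A where "A = {x \<in> space M. \<forall>K::nat. \<exists>n. S n x > real K}"
  have A_meas: "A \<in> sets M" unfolding A_def by measurable
  have A_iff: "x \<in> A \<longleftrightarrow> T x \<in> A" if x: "x \<in> space M" for x
  proof
    have Tx: "T x \<in> space M" using x measurable_space[OF T] by auto
    assume "x \<in> A"
    show "T x \<in> A" unfolding A_def
    proof (intro CollectI conjI Tx allI)
      fix K :: nat
      obtain n where n: "S n x > real (nat \<lceil>\<bar>real K + f x\<bar>\<rceil>)"
        using \<open>x \<in> A\<close> unfolding A_def by blast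
      then have *: "S n x > \<bar>real K + f x\<bar>" by linarith
      then obtain m where "n = Suc m" by (cases n) (auto simp: S_def)
      with * SSuc[of m x] show "\<exists>n. S n (T x) > real K" by (intro exI[of _ m]) simp
    qed
  next
    assume "T x \<in> A"
    show "x \<in> A" unfolding A_def
    proof (intro CollectI conjI x allI)
      fix K :: nat
      obtain n where n: "S n (T x) > real (nat \<lceil>\<bar>real K - f x\<bar>\<rceil>)"
        using \<open>T x \<in> A\<close> unfolding A_def by blast
      then have *: "S n (T x) > \<bar>real K - f x\<bar>" by linarith
      with SSuc[of n x] show "\<exists>n. S n x > real K" by (intro exI[of _ "Suc n"]) simp
    qed
  qed
  have "T -` A \<inter> space M = A"
    using A_iff by (auto simp: A_def)
  then have "prob A = 0 \<or> prob A = 1" using erg A_meas by blast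
  moreover have "prob A \<noteq> 1"
  proof
    assume "prob A = 1"
    then have AA: "AE x in M. x \<in> A" using A_meas by (simp add: prob_eq_1)
    have AT: "AE x in M. T x \<in> A" using AA by eventually_elim (use A_iff A_def in auto)
    \<comment> \<open>The maximum starts at \<open>S 1\<close>, not at the empty sum: this keeps
      \<open>f \<le> m n\<close>, which supplies the dominating function below. The empty sum
      returns as \<open>max 0\<close> in the recursion.\<close>
    define m where "m n x = Max ((\<lambda>k. S k x) ` {1..Suc n})" for n x
    have m_rec: "m (Suc n) x = f x + max 0 (m n (T x))" for n x
    proof -
      have e: "{1..Suc (Suc n)} = insert 1 (Suc ` {1..Suc n})"
        by (metis One_nat_def Suc_le_mono atLeastAtMost_insertL image_Suc_atLeastAtMost zero_le)
      have "m (Suc n) x = Max (insert (S 1 x) ((\<lambda>k. S (Suc k) x) ` {1..Suc n}))"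
        unfolding m_def e by (simp only: image_insert image_image)
      also have "\<dots> = Max (insert (f x) ((\<lambda>k. f x + S k (T x)) ` {1..Suc n}))"
      proof -
        have "S 1 x = f x" by (simp add: S_def)
        then show ?thesis by (simp only: SSuc)
      qed
      also have "\<dots> = max (f x) (Max ((\<lambda>k. f x + S k (T x)) ` {1..Suc n}))"
        by (subst Max_insert) auto
      also have "Max ((\<lambda>k. f x + S k (T x)) ` {1..Suc n}) = f x + m n (T x)"
        unfolding m_def using Max_add_commute[of "{1..Suc n}" "\<lambda>k. S k (T x)" "f x"] by (simp add: add.commute)
      finally show ?thesis by (simp add: max_def)
    qed
    have m_meas[measurable]: "m n \<in> borel_measurable M" for n
      unfolding m_def[abs_def] by (intro borel_measurable_Max) auto
    have m_int: "integrable M (m n)" for n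
    proof (induction n)
      case 0
      have "m 0 = S 1" by (auto simp: m_def)
      then show ?case using S_int by simp
    next
      case (Suc n)
      have "m (Suc n) = (\<lambda>x. f x + max 0 (m n (T x)))" by (auto simp: m_rec)
      then show ?case using f integral_measure_preserving(1)[OF T mp Suc] by simp
    qed
    have m_mono: "m n x \<le> m (Suc n) x" for n x
      unfolding m_def by (intro Max_mono) auto
    have m_ge: "f x \<le> m n x" for n x
    proof -
      have "S 1 x \<le> m n x" unfolding m_def by (intro Max_ge) auto
      then show ?thesis by (simp add: S_def)
    qed
    define r where "r n x = min 0 (m n (T x))" for n x
    have r_eq: "m (Suc n) x - m n (T x) = f x - r n x" for n x
      by (auto simp: m_rec r_def)
    have [measurable]: "r n \<in> borel_measurable M" for n unfolding r_def[abs_def] by measurable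
    have lim: "(\<lambda>n. expectation (\<lambda>x. f x - r n x)) \<longlonglongrightarrow> expectation f"
    proof (rule integral_dominated_convergence[where w="\<lambda>x. \<bar>f x\<bar> + \<bar>f (T x)\<bar>"])
      show "integrable M (\<lambda>x. \<bar>f x\<bar> + \<bar>f (T x)\<bar>)"
        using f integral_measure_preserving(1)[OF T mp f] by auto
      show "AE x in M. (\<lambda>n. f x - r n x) \<longlonglongrightarrow> f x"
        using AT
      proof eventually_elim
        case (elim x)
        then obtain n where n: "S n (T x) > real 0" unfolding A_def by blast
        then have n0: "n \<noteq> 0" by (cases n) (auto simp: S_def)
        have ev: "r N x = 0" if "N \<ge> n" for N
        proof -
          have "S n (T x) \<le> m N (T x)" unfolding m_def using n0 that by (intro Max_ge) auto
          with n show ?thesis by (simp add: r_def)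
        qed
        have "eventually (\<lambda>N. f x - r N x = f x) sequentially"
          using ev eventually_sequentially by auto
        then show ?case by (rule tendsto_eventually)
      qed
      fix n
      show "AE x in M. norm (f x - r n x) \<le> \<bar>f x\<bar> + \<bar>f (T x)\<bar>"
      proof (rule AE_I2)
        fix x
        have "\<bar>r n x\<bar> \<le> \<bar>f (T x)\<bar>" using m_ge[of "T x" n] by (auto simp: r_def)
        then show "norm (f x - r n x) \<le> \<bar>f x\<bar> + \<bar>f (T x)\<bar>" by (auto simp: abs_if split: if_splits)
      qed
    qed auto
    have "0 \<le> expectation (\<lambda>x. f x - r n x)" for n
    proof -
      have "expectation (\<lambda>x. f x - r n x) = expectation (\<lambda>x. m (Suc n) x - m n (T x))"
        by (simp add: r_eq)
      also have "\<dots> = expectation (m (Suc n)) - expectation (m n)"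
        using integral_measure_preserving[OF T mp m_int[of n]] m_int[of "Suc n"] by simp
      also have "\<dots> \<ge> 0"
        using integral_mono[OF m_int[of n] m_int[of "Suc n"]] m_mono by simp
      finally show ?thesis .
    qed
    then have "0 \<le> expectation f" using lim LIMSEQ_le_const by blast
    with neg show False by simp
  qed
  ultimately have "prob A = 0" by blast
  then have "AE x in M. x \<notin> A"
    using A_meas by (simp add: prob_eq_0)
  moreover have "AE x in M. x \<in> space M" by (rule AE_space)
  ultimately show ?thesis
    unfolding S_def[symmetric]
    by eventually_elim (auto simp: A_def not_less)
qed

text \<open>The preceding lemma applies to \<open>f - E f - e\<close> and to
  \<open>E f - f - e\<close>, both of mean \<open>-e < 0\<close>, so the Birkhoff sum stays within
  \<open>n e + K\<close> of \<open>n E f\<close>. Using countably many values \<open>e j\<close>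
  that tend to 0 keeps the exceptional set null.\<close>

theorem birkhoff_ergodic:
  fixes f :: "'a \<Rightarrow> real"
  assumes T[measurable]: "T \<in> M \<rightarrow>\<^sub>M M" and mp: "distr M M T = M"
    and erg: "\<And>B. B \<in> sets M \<Longrightarrow> T -` B \<inter> space M = B \<Longrightarrow> prob B = 0 \<or> prob B = 1"
    and f: "integrable M f"
  shows "AE x in M. (\<lambda>n. (\<Sum>i<n. f ((T ^^ i) x)) / real n) \<longlonglongrightarrow> expectation f"
proof -
  define e where "e j = inverse (real (Suc j))" for j
  have e_pos: "e j > 0" for j by (simp add: e_def)
  have up: "AE x in M. \<forall>j. \<exists>K. \<forall>n. (\<Sum>i<n. f ((T ^^ i) x) - expectation f - e j) \<le> K"
    by (subst AE_all_countable, rule allI, rule birkhoff_sums_bounded_above[OF T mp erg])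
      (use f e_pos in \<open>auto simp: prob_space\<close>)
  have lo: "AE x in M. \<forall>j. \<exists>K. \<forall>n. (\<Sum>i<n. expectation f - f ((T ^^ i) x) - e j) \<le> K"
    by (subst AE_all_countable, rule allI, rule birkhoff_sums_bounded_above[OF T mp erg])
      (use f e_pos in \<open>auto simp: prob_space\<close>)
  from up lo show ?thesis
  proof eventually_elim
    case (elim x)
    let ?S = "\<lambda>n. \<Sum>i<n. f ((T ^^ i) x)"
    show ?case
    proof (rule LIMSEQ_I)
      fix r :: real assume "r > 0"
      then obtain j where j: "e j < r / 2"
        unfolding e_def using reals_Archimedean[of "r/2"] by auto
      obtain K1 K2 where K1: "\<And>n. ?S n - n * expectation f - n * e j \<le> K1"
        and K2: "\<And>n. n * expectation f - ?S n - n * e j \<le> K2"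
        using elim by (simp add: sum_subtractf) meson
      define K where "K = max 1 (max K1 K2)"
      have "K > 0" by (simp add: K_def)
      obtain N where N: "real N > 2 * K / r" using reals_Archimedean2 by blast
      show "\<exists>no. \<forall>n\<ge>no. norm (?S n / real n - expectation f) < r"
      proof (intro exI[of _ "max 1 N"] allI impI)
        fix n assume n: "n \<ge> max 1 N"
        then have n0: "real n > 0" and "real n > 2 * K / r" using N by auto
        then have nK: "K < n * (r / 2)" using \<open>r > 0\<close> by (simp add: field_simps)
        have "n * e j \<le> n * (r/2)" using j n0 by (intro mult_left_mono) auto
        then have "\<bar>?S n - n * expectation f\<bar> < n * r"
          using K1[of n] K2[of n] nK by (auto simp: K_def abs_less_iff)
        then have "\<bar>(?S n - n * expectation f) / n\<bar> < r"
          using n0 by (simp add: abs_divide field_simps)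
        then show "norm (?S n / real n - expectation f) < r"
          using n0 by (simp add: field_simps)
      qed
    qed
  qed
qed

end

section \<open>The environment\<close>

lemma space_config_space: "space config_space = {\<zeta>. \<forall>r. \<zeta> r > 0}"
  by (auto simp: config_space_def gap_space_def space_PiM space_restrict_space PiE_UNIV_domain)

lemma measurable_gap[measurable]: "(\<lambda>\<zeta>. \<zeta> r) \<in> borel_measurable config_space"
proof -
  have "(\<lambda>\<zeta>. \<zeta> r) \<in> config_space \<rightarrow>\<^sub>M gap_space"
    unfolding config_space_def by (rule measurable_component_singleton) simp
  moreover have "(\<lambda>x. x) \<in> gap_space \<rightarrow>\<^sub>M borel"
    unfolding gap_space_def by (intro measurable_restrict_space1) auto
  ultimately show ?thesis by (rule measurable_compose)
qed

lemma measurable_translate: "(\<lambda>\<zeta> r. \<zeta> (r + k)) \<in> config_space \<rightarrow>\<^sub>M config_space"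
proof -
  have "(\<lambda>\<zeta> r. \<zeta> (r + k)) \<in> PiM UNIV (\<lambda>_. gap_space) \<rightarrow>\<^sub>M PiM UNIV (\<lambda>_. gap_space)"
    by (rule measurable_PiM_single') (auto simp: space_PiM PiE_UNIV_domain)
  then show ?thesis by (simp add: config_space_def)
qed

lemma shift_funpow: "(shift ^^ n) \<zeta> r = \<zeta> (r + int n)"
  by (induction n arbitrary: \<zeta> r) (auto simp: shift_def algebra_simps)

text \<open>The inverse of \<open>shift\<close>. Scatterers with negative index are, up to sign,
  Birkhoff sums of this map.\<close>

definition unshift :: "(int \<Rightarrow> real) \<Rightarrow> (int \<Rightarrow> real)" where
  "unshift \<zeta> = (\<lambda>r. \<zeta> (r - 1))"

lemma unshift_funpow: "(unshift ^^ n) \<zeta> r = \<zeta> (r - int n)"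
  by (induction n arbitrary: \<zeta> r) (auto simp: unshift_def algebra_simps)

lemma shift_unshift: "shift (unshift \<zeta>) = \<zeta>" "unshift (shift \<zeta>) = \<zeta>"
  by (auto simp: shift_def unshift_def)

lemma scatterer_int: "scatterer \<zeta> (int n) = (\<Sum>i<n. \<zeta> (1 + int i))"
proof -
  have "(\<Sum>i\<in>{1..int n}. \<zeta> i) = (\<Sum>i<n. \<zeta> (1 + int i))"
    by (rule sum.reindex_bij_witness[of _ "\<lambda>i. 1 + int i" "\<lambda>i. nat (i - 1)"]) auto
  then show ?thesis by (simp add: scatterer_def)
qed

lemma scatterer_neg_int: "scatterer \<zeta> (- int n) = - (\<Sum>i<n. \<zeta> (0 - int i))"
proof -
  have "(\<Sum>i\<in>{- int n + 1..0}. \<zeta> i) = (\<Sum>i<n. \<zeta> (0 - int i))"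
    by (rule sum.reindex_bij_witness[of _ "\<lambda>i. - int i" "\<lambda>i. nat (- i)"]) auto
  then show ?thesis by (simp add: scatterer_def)
qed

text \<open>The ergodic theorem is used twice, for \<open>shift\<close> with coordinate 1 and for
  its inverse with coordinate 0. Stationarity gives both coordinates the same mean, so one
  \<open>l\<close> serves in both directions; it is positive because the gaps are.\<close>

lemma scatterer_law_of_large_numbers:
  assumes P: "prob_space P" and sets: "sets P = sets config_space"
    and inv: "shift_invariant P" and erg: "shift_ergodic P"
    and int: "integrable P (\<lambda>\<zeta>. \<zeta> 1)"
  shows "\<exists>l>0. AE \<zeta> in P. (\<forall>r. \<zeta> r > 0) \<and>
    (\<lambda>n. scatterer \<zeta> (int n) / real n) \<longlonglongrightarrow> l \<and>
    (\<lambda>n. scatterer \<zeta> (- int n) / real n) \<longlonglongrightarrow> - l"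
proof -
  interpret prob_space P by fact
  note [measurable_cong] = sets
  have space: "space P = {\<zeta>. \<forall>r. \<zeta> r > 0}"
    using sets_eq_imp_space_eq[OF sets] by (simp add: space_config_space)
  have sh[measurable]: "shift \<in> P \<rightarrow>\<^sub>M P"
    using measurable_translate[of 1] by (simp add: shift_def[abs_def] cong: measurable_cong_sets)
  have ush[measurable]: "unshift \<in> P \<rightarrow>\<^sub>M P"
    using measurable_translate[of "-1"] by (simp add: unshift_def[abs_def] cong: measurable_cong_sets)
  have inv1: "distr P P shift = P" using inv by (simp add: shift_invariant_def)
  have "distr P P unshift = distr (distr P P shift) P unshift" by (simp add: inv1)
  also have "\<dots> = distr P P (unshift \<circ> shift)" by (rule distr_distr) measurable
  also have "unshift \<circ> shift = (\<lambda>x. x)" by (auto simp: shift_unshift)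
  finally have inv2: "distr P P unshift = P" by (simp add: distr_id)
  have erg1: "prob B = 0 \<or> prob B = 1" if "B \<in> sets P" "shift -` B \<inter> space P = B" for B
    using erg that by (auto simp: shift_ergodic_def)
  \<comment> \<open>A set invariant under the inverse shift is invariant under \<open>shift\<close>,
    so ergodicity carries over.\<close>
  have erg2: "prob B = 0 \<or> prob B = 1" if B: "B \<in> sets P" "unshift -` B \<inter> space P = B" for B
  proof (rule erg1[OF B(1)])
    show "shift -` B \<inter> space P = B"
    proof (intro set_eqI iffI)
      fix x assume x: "x \<in> shift -` B \<inter> space P"
      then have "shift x \<in> unshift -` B" using B by auto
      then show "x \<in> B" by (simp add: shift_unshift)
    next
      fix x assume x: "x \<in> B"
      then have "x \<in> space P" using sets.sets_into_space[OF B(1)] by auto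
      moreover from this have "shift x \<in> space P" by (auto simp: space shift_def)
      moreover have "unshift (shift x) \<in> B" using x by (simp add: shift_unshift)
      ultimately show "x \<in> shift -` B \<inter> space P" using B(2) by auto
    qed
  qed
  have int0: "integrable P (\<lambda>\<zeta>. \<zeta> 0)" "(\<integral>\<zeta>. \<zeta> 0 \<partial>P) = (\<integral>\<zeta>. \<zeta> 1 \<partial>P)"
    using integral_measure_preserving[OF ush inv2 int] by (auto simp: unshift_def)
  define l where "l = (\<integral>\<zeta>. \<zeta> 1 \<partial>P)"
  have "l > 0"
  proof -
    have "l \<ge> 0" unfolding l_def by (rule Bochner_Integration.integral_nonneg_AE)
        (auto simp: space intro!: AE_I2 less_imp_le)
    moreover have "l \<noteq> 0"
    proof
      assume "l = 0"
      then have "AE \<zeta> in P. \<zeta> 1 = 0" unfolding l_def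
        by (subst (asm) integral_nonneg_eq_0_iff_AE[OF int])
          (auto simp: space intro!: AE_I2 less_imp_le)
      moreover have "AE \<zeta> in P. \<zeta> 1 > 0" by (auto simp: space intro!: AE_I2)
      ultimately have "AE \<zeta> in P. False" by eventually_elim auto
      then show False by simp
    qed
    ultimately show ?thesis by simp
  qed
  moreover have "AE \<zeta> in P. (\<lambda>n. (\<Sum>i<n. (shift ^^ i) \<zeta> 1) / real n) \<longlonglongrightarrow> l"
    unfolding l_def by (rule birkhoff_ergodic[OF sh inv1 erg1 int])
  then have "AE \<zeta> in P. (\<lambda>n. scatterer \<zeta> (int n) / real n) \<longlonglongrightarrow> l"
    by (simp add: shift_funpow scatterer_int)
  moreover have "AE \<zeta> in P. (\<lambda>n. (\<Sum>i<n. (unshift ^^ i) \<zeta> 0) / real n) \<longlonglongrightarrow> l"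
    unfolding l_def int0(2)[symmetric] by (rule birkhoff_ergodic[OF ush inv2 erg2 int0(1)])
  then have "AE \<zeta> in P. (\<lambda>n. scatterer \<zeta> (- int n) / real n) \<longlonglongrightarrow> - l"
    by eventually_elim (drule tendsto_minus, simp add: unshift_funpow scatterer_neg_int)
  moreover have "AE \<zeta> in P. \<forall>r. \<zeta> r > 0" by (auto simp: space intro!: AE_I2)
  ultimately show ?thesis by (intro exI[of _ l] conjI) auto
qed

text \<open>\<open>C\<close> collects the finitely many indices before the ratio is within
  \<open>e\<close> of \<open>c\<close>. The index \<open>N\<close> itself is counted among them, so
  that \<open>n = 0\<close>, where the ratio is a division by zero, always falls under
  \<open>C\<close>.\<close>

lemma sublinear_bound_nat:
  fixes f :: "nat \<Rightarrow> real"
  assumes "(\<lambda>n. f n / real n) \<longlonglongrightarrow> c" and "e > 0"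
  shows "\<exists>C\<ge>0. \<forall>n. \<bar>f n - c * real n\<bar> \<le> e * real n + C"
proof -
  obtain N where N: "\<And>n. n \<ge> N \<Longrightarrow> \<bar>f n / real n - c\<bar> < e"
    using LIMSEQ_D[OF assms] by auto
  define C where "C = (\<Sum>n\<le>N. \<bar>f n - c * real n\<bar>)"
  have "\<bar>f n - c * real n\<bar> \<le> e * real n + C" for n
  proof (cases "n > N")
    case True
    then have "\<bar>f n / real n - c\<bar> * real n \<le> e * real n"
      using N[of n] by (intro mult_right_mono) auto
    moreover have "\<bar>f n / real n - c\<bar> * real n = \<bar>f n - c * real n\<bar>"
    proof -
      have "\<bar>f n / real n - c\<bar> * real n = \<bar>(f n / real n - c) * real n\<bar>" by (simp add: abs_mult)
      also have "(f n / real n - c) * real n = f n - c * real n" using True by (simp add: field_simps)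
      finally show ?thesis .
    qed
    moreover have "C \<ge> 0" by (simp add: C_def sum_nonneg)
    ultimately show ?thesis by linarith
  next
    case False
    then have "\<bar>f n - c * real n\<bar> \<le> C" unfolding C_def by (intro member_le_sum) auto
    moreover have "e * real n \<ge> 0" using \<open>e > 0\<close> by simp
    ultimately show ?thesis by linarith
  qed
  moreover have "C \<ge> 0" by (simp add: C_def sum_nonneg)
  ultimately show ?thesis by auto
qed

text \<open>Apart from positivity of the gaps and of \<open>l\<close>, this is the only property of
  a fixed environment on which the limit theorems for the gas rest. \<open>C\<close> depends on
  \<open>e\<close> and on the environment.\<close>

lemma scatterer_sublinear_deviation:
  assumes "(\<lambda>n. scatterer \<zeta> (int n) / real n) \<longlonglongrightarrow> l"
    and "(\<lambda>n. scatterer \<zeta> (- int n) / real n) \<longlonglongrightarrow> - l" and "e > 0"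
  shows "\<exists>C\<ge>0. \<forall>x. \<bar>scatterer \<zeta> x - l * of_int x\<bar> \<le> e * \<bar>of_int x\<bar> + C"
proof -
  obtain C1 where C1: "C1 \<ge> 0" "\<And>n. \<bar>scatterer \<zeta> (int n) - l * real n\<bar> \<le> e * real n + C1"
    using sublinear_bound_nat[OF assms(1,3)] by auto
  obtain C2 where C2: "C2 \<ge> 0" "\<And>n. \<bar>scatterer \<zeta> (- int n) - (- l) * real n\<bar> \<le> e * real n + C2"
    using sublinear_bound_nat[OF assms(2,3)] by metis
  have "\<bar>scatterer \<zeta> x - l * of_int x\<bar> \<le> e * \<bar>of_int x\<bar> + (C1 + C2)" for x
  proof (cases "x \<ge> 0")
    case True
    then show ?thesis using C1(2)[of "nat x"] C2(1) by simp
  next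
    case False
    then show ?thesis using C2(2)[of "nat (- x)"] C1(1) by simp
  qed
  with C1(1) C2(1) show ?thesis by (intro exI[of _ "C1 + C2"]) auto
qed

section \<open>The step-reinforced walk as a Markov chain\<close>

text \<open>The joint law of the coordinates is the image of the product measure under the identity,
  hence the product of its own marginals.\<close>

lemma indep_vars_PiM_coordinates:
  assumes "\<And>i. i \<in> I \<Longrightarrow> prob_space (N i)" and "I \<noteq> {}"
  shows "prob_space.indep_vars (PiM I N) N (\<lambda>i f. f i) I"
proof -
  interpret Q: prob_space "PiM I N" by (intro prob_space_PiM assms)
  have "distr (PiM I N) (PiM I N) (\<lambda>x. \<lambda>i\<in>I. x i) = distr (PiM I N) (PiM I N) (\<lambda>x. x)"
    by (intro distr_cong) (auto simp: space_PiM PiE_restrict)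
  also have "\<dots> = PiM I N" by (rule distr_id2) simp
  also have "\<dots> = PiM I (\<lambda>i. distr (PiM I N) (N i) (\<lambda>f. f i))"
    by (intro PiM_cong refl distr_PiM_component[symmetric] assms)
  finally show ?thesis
    by (subst Q.indep_vars_iff_distr_eq_PiM') (auto simp: assms(2))
qed

section \<open>Functions of the first n steps: measurability and boundedness\<close>

definition hist :: "nat \<Rightarrow> walk_outcome \<Rightarrow> int list" where
  "hist n w = map (reinforced_step w) [0..<Suc n]"

text \<open>Adaptedness is factorization through the first \<open>n\<close> steps instead of
  measurability for a sigma-algebra. Almost surely these steps take finitely many values, so
  arbitrary functions of the past are measurable and integrable.\<close>

definition adapted :: "nat \<Rightarrow> (walk_outcome \<Rightarrow> 'b) \<Rightarrow> bool" where
  "adapted n f \<longleftrightarrow> (\<forall>w w'. (\<forall>k\<le>n. reinforced_step w k = reinforced_step w' k) \<longrightarrow> f w = f w')"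

lemma adaptedD:
  assumes "adapted n f" and "\<forall>k\<le>n. reinforced_step w k = reinforced_step w' k"
  shows "f w = f w'"
  using assms(1)[unfolded adapted_def, THEN spec, THEN spec, THEN mp, OF assms(2)] .

lemma hist_eq_iff:
  "hist n w = hist n w' \<longleftrightarrow> (\<forall>k\<le>n. reinforced_step w k = reinforced_step w' k)"
  by (auto simp: hist_def simp del: upt_Suc)

lemma adapted_obtain_hist:
  assumes "adapted n f"
  obtains F where "\<And>w. f w = F (hist n w)"
proof (rule that[of "\<lambda>h. f (SOME w'. hist n w' = h)"])
  fix w
  have "hist n (SOME w'. hist n w' = hist n w) = hist n w" by (rule someI[of _ w]) simp
  from hist_eq_iff[THEN iffD1, OF this]
  have "f (SOME w'. hist n w' = hist n w) = f w"
    by (rule adaptedD[OF assms])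
  then show "f w = f (SOME w'. hist n w' = hist n w)" by (rule sym)
qed

lemma adapted_mono: "adapted n f \<Longrightarrow> n \<le> m \<Longrightarrow> adapted m f"
  unfolding adapted_def by (meson le_trans)

lemma adapted_const[simp]: "adapted n (\<lambda>w. c)"
  by (simp add: adapted_def)

lemma adapted_step: "k \<le> n \<Longrightarrow> adapted n (\<lambda>w. reinforced_step w k)"
  by (simp add: adapted_def)

lemma adapted_walk: "k \<le> n \<Longrightarrow> adapted n (\<lambda>w. walk w k)"
  unfolding adapted_def walk_def by (auto intro!: sum.cong)

lemma adaptedI:
  "(\<And>w w'. \<forall>k\<le>n. reinforced_step w k = reinforced_step w' k \<Longrightarrow> f w = f w') \<Longrightarrow> adapted n f"
  unfolding adapted_def by iprover

lemma adapted_comp: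
  assumes "adapted n f" shows "adapted n (\<lambda>w. g (f w))"
proof (rule adaptedI)
  fix w w' :: walk_outcome assume *: "\<forall>k\<le>n. reinforced_step w k = reinforced_step w' k"
  show "g (f w) = g (f w')" by (simp only: adaptedD[OF assms *])
qed

lemma adapted_comp2:
  assumes "adapted n f" "adapted n g" shows "adapted n (\<lambda>w. h (f w) (g w))"
proof (rule adaptedI)
  fix w w' :: walk_outcome assume *: "\<forall>k\<le>n. reinforced_step w k = reinforced_step w' k"
  show "h (f w) (g w) = h (f w') (g w')"
    by (simp only: adaptedD[OF assms(1) *] adaptedD[OF assms(2) *])
qed

lemma adapted_sum: "(\<And>i. i \<in> I \<Longrightarrow> adapted n (f i)) \<Longrightarrow> adapted n (\<lambda>w. \<Sum>i\<in>I. f i w)"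
  unfolding adapted_def by (auto intro!: sum.cong)

text \<open>Step \<open>k \<ge> 2\<close> is decided by the choice with index \<open>k - 1\<close>
  and by earlier steps, so the first \<open>n\<close> steps read only the choices in
  \<open>{1..<n}\<close>. This leaves choice \<open>n\<close>, which decides step
  \<open>n + 1\<close>, independent of them.\<close>

lemma reinforced_step_past:
  "k \<le> n \<Longrightarrow> reinforced_step (v, restrict c {1..<n}) k = reinforced_step (v, c) k"
proof (induction k rule: less_induct)
  case (less k)
  consider "k = 0" | "k = 1" | m where "k = Suc (Suc m)" by (metis One_nat_def not0_implies_Suc)
  then show ?case
  proof cases
    case 3
    then have "Suc m \<in> {1..<n}" using less.prems by auto
    then show ?thesis using less 3 by (auto simp: Let_def)
  qed auto
qed

lemma adapted_past: "adapted n f \<Longrightarrow> f (v, restrict c {1..<n}) = f (v, c)"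
  unfolding adapted_def using reinforced_step_past by blast

lemma reinforced_step_unit:
  assumes "fst w \<in> {-1, 1}" and "k \<ge> 1" shows "reinforced_step w k \<in> {-1, 1}"
  using assms(2)
proof (induction k rule: less_induct)
  case (less k)
  consider "k = 1" | m where "k = Suc (Suc m)" using less.prems by (metis One_nat_def not0_implies_Suc not_one_le_zero)
  then show ?case
  proof cases
    case (2 m)
    let ?k = "fst (snd w (Suc m))"
    have "reinforced_step w ?k \<in> {-1, 1}" if "1 \<le> ?k" "?k \<le> Suc m" using less.IH[of ?k] that 2 by auto
    then show ?thesis using 2 assms(1) by (auto simp: Let_def)
  qed (use assms in auto)
qed

text \<open>The recursion jumps back to a random time, so measurability comes from splitting over
  the countably many values of the choice. The outcome \<open>w\<close> lives on an arbitrary space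
  because products over only a part of the choices occur later.\<close>

lemma measurable_reinforced_step_comp:
  fixes w :: "'a \<Rightarrow> walk_outcome"
  assumes m1[measurable]: "(\<lambda>x. fst (w x)) \<in> N \<rightarrow>\<^sub>M count_space UNIV"
    and m2[measurable]: "\<And>n. n \<ge> 1 \<Longrightarrow> (\<lambda>x. snd (w x) n) \<in> N \<rightarrow>\<^sub>M count_space UNIV"
  shows "(\<lambda>x. reinforced_step (w x) k) \<in> N \<rightarrow>\<^sub>M count_space UNIV"
proof (induction k rule: less_induct)
  case (less k)
  consider "k = 0" | "k = 1" | m where "k = Suc (Suc m)" by (metis One_nat_def not0_implies_Suc)
  then show ?case
  proof cases
    case (3 m)
    define f :: "nat \<times> bool \<Rightarrow> 'a \<Rightarrow> int" where
      "f = (\<lambda>(k, b) x. if 1 \<le> k \<and> k \<le> Suc m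
      then (if b then reinforced_step (w x) k else - reinforced_step (w x) k)
      else fst (w x))"
    have fm: "f i \<in> N \<rightarrow>\<^sub>M count_space UNIV" for i
    proof (cases i)
      case (Pair k b)
      show ?thesis
      proof (cases "1 \<le> k \<and> k \<le> Suc m")
        case True
        then have [measurable]: "(\<lambda>x. reinforced_step (w x) k) \<in> N \<rightarrow>\<^sub>M count_space UNIV"
          using less 3 by auto
        have "(\<lambda>x. - reinforced_step (w x) k) \<in> N \<rightarrow>\<^sub>M count_space UNIV" by measurable
        then show ?thesis using True Pair by (cases b) (auto simp: f_def)
      next
        case False
        then have "f i = (\<lambda>x. fst (w x))" using Pair by (auto simp: f_def fun_eq_iff)
        then show ?thesis by simp
      qed
    qed
    have "(\<lambda>x. f (snd (w x) (Suc m)) x) \<in> N \<rightarrow>\<^sub>M count_space UNIV"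
      by (rule measurable_compose_countable[OF fm m2]) simp
    also have "(\<lambda>x. f (snd (w x) (Suc m)) x) = (\<lambda>x. reinforced_step (w x) k)"
      using 3 by (auto simp: f_def fun_eq_iff Let_def split: prod.split)
    finally show ?thesis .
  qed auto
qed

lemma measurable_map_count_space:
  assumes "\<And>k. (\<lambda>x. g x k) \<in> N \<rightarrow>\<^sub>M count_space (UNIV :: int set)"
  shows "(\<lambda>x. map (g x) xs) \<in> N \<rightarrow>\<^sub>M count_space (UNIV :: int list set)"
proof (induction xs)
  case (Cons y ys)
  have [measurable]: "(\<lambda>x. g x y) \<in> N \<rightarrow>\<^sub>M count_space UNIV" by fact
  note [measurable] = Cons
  have "(\<lambda>x. g x y # map (g x) ys) \<in> N \<rightarrow>\<^sub>M count_space UNIV" by measurable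
  then show ?case by simp
qed simp

lemma measurable_adapted_comp:
  fixes w :: "'a \<Rightarrow> walk_outcome"
  assumes "(\<lambda>x. fst (w x)) \<in> N \<rightarrow>\<^sub>M count_space UNIV"
    and "\<And>n. n \<ge> 1 \<Longrightarrow> (\<lambda>x. snd (w x) n) \<in> N \<rightarrow>\<^sub>M count_space UNIV"
    and f: "adapted n f" and sp: "range f \<subseteq> space L"
  shows "(\<lambda>x. f (w x)) \<in> N \<rightarrow>\<^sub>M L"
proof -
  have h: "(\<lambda>x. hist n (w x)) \<in> N \<rightarrow>\<^sub>M count_space UNIV"
    unfolding hist_def
    by (intro measurable_map_count_space measurable_reinforced_step_comp assms(1,2))
  obtain F where F: "\<And>w. f w = F (hist n w)" using f by (rule adapted_obtain_hist) blast
  \<comment> \<open>\<open>F\<close> is unconstrained on lists that are no history; there a value of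
    \<open>f\<close> is substituted, so that the factor maps into \<open>space L\<close>
    everywhere.\<close>
  have "(\<lambda>x. f (w x)) = (\<lambda>x. (\<lambda>h. if h \<in> range (hist n) then F h else f undefined) (hist n (w x)))"
    by (auto simp: F)
  also have "\<dots> \<in> N \<rightarrow>\<^sub>M L"
  proof (rule measurable_compose[OF h])
    have fsp: "f w \<in> space L" for w by (rule subsetD[OF sp]) simp
    then show "(\<lambda>h. if h \<in> range (hist n) then F h else f undefined) \<in> count_space UNIV \<rightarrow>\<^sub>M L"
      by (auto simp: F[symmetric] fsp)
  qed
  finally show ?thesis .
qed

text \<open>A history is a list of length \<open>n + 1\<close> over \<open>{-1, 0, 1}\<close>, the 0
  being the convention at time 0, and there are finitely many of those.\<close>

lemma adapted_bounded:
  fixes f :: "walk_outcome \<Rightarrow> 'b::real_normed_vector"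
  assumes "adapted n f"
  shows "\<exists>B. \<forall>w. fst w \<in> {-1, 1} \<longrightarrow> norm (f w) \<le> B"
proof -
  obtain F where F: "\<And>w. f w = F (hist n w)" using assms by (rule adapted_obtain_hist) blast
  define L where "L = {xs. set xs \<subseteq> {-1, 0, 1::int} \<and> length xs = Suc n}"
  have fin: "finite L" unfolding L_def by (rule finite_lists_length_eq) simp
  have "norm (f w) \<le> (\<Sum>h\<in>L. norm (F h))" if "fst w \<in> {-1, 1}" for w
  proof -
    have "reinforced_step w k \<in> {-1, 0, 1}" for k
      using reinforced_step_unit[OF that, of k] by (cases k) auto
    then have "hist n w \<in> L" unfolding L_def hist_def by (auto simp del: upt_Suc)
    then show ?thesis unfolding F by (intro member_le_sum fin) auto
  qed
  then show ?thesis by blast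
qed

section \<open>The law of the choices and the conditional mean of the next step\<close>

definition recall_law :: "real \<Rightarrow> (nat \<Rightarrow> nat \<times> bool) measure" where
  "recall_law p = (\<Pi>\<^sub>M n\<in>{1..}. measure_pmf (pair_pmf (pmf_of_set {1..n}) (bernoulli_pmf p)))"

lemma walk_law_eq: "walk_law p = measure_pmf (pmf_of_set {- 1, 1}) \<Otimes>\<^sub>M recall_law p"
  by (simp add: walk_law_def recall_law_def)

lemma prob_space_recall_law: "prob_space (recall_law p)"
  unfolding recall_law_def by (intro prob_space_PiM) (rule measure_pmf.prob_space_axioms)

lemma prob_space_walk_law: "prob_space (walk_law p)"
proof -
  interpret A: prob_space "recall_law p" by (rule prob_space_recall_law)
  interpret pair_prob_space "measure_pmf (pmf_of_set {- 1, 1::int})" "recall_law p" ..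
  show ?thesis unfolding walk_law_eq by (rule prob_space_axioms)
qed

lemma measurable_recall_law_component:
  "n \<ge> 1 \<Longrightarrow> (\<lambda>c. c n) \<in> recall_law p \<rightarrow>\<^sub>M count_space UNIV"
proof -
  assume "n \<ge> 1"
  then have "(\<lambda>c. c n) \<in> recall_law p \<rightarrow>\<^sub>M measure_pmf (pair_pmf (pmf_of_set {1..n}) (bernoulli_pmf p))"
    unfolding recall_law_def by (intro measurable_component_singleton) simp
  then show ?thesis by simp
qed

lemma measurable_walk_law_fst: "fst \<in> walk_law p \<rightarrow>\<^sub>M count_space UNIV"
proof -
  have "fst \<in> walk_law p \<rightarrow>\<^sub>M measure_pmf (pmf_of_set {- 1, 1})"
    unfolding walk_law_eq by measurable
  then show ?thesis by simp
qed

lemma measurable_walk_law_snd: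
  assumes "n \<ge> 1" shows "(\<lambda>w. snd w n) \<in> walk_law p \<rightarrow>\<^sub>M count_space UNIV"
proof -
  have "snd \<in> walk_law p \<rightarrow>\<^sub>M recall_law p" unfolding walk_law_eq by (rule measurable_snd)
  then show ?thesis by (rule measurable_compose) (rule measurable_recall_law_component[OF assms])
qed

lemma adapted_measurable:
  assumes "adapted n f" "range f \<subseteq> space L" shows "f \<in> walk_law p \<rightarrow>\<^sub>M L"
  using measurable_adapted_comp[of "\<lambda>x. x" "walk_law p" n f L]
    measurable_walk_law_fst measurable_walk_law_snd assms by auto

lemma adapted_borel_measurable:
  fixes f :: "walk_outcome \<Rightarrow> 'b::topological_space"
  assumes "adapted n f" shows "f \<in> borel_measurable (walk_law p)"
  by (rule adapted_measurable[OF assms]) simp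

lemma AE_first_step: "AE w in walk_law p. fst w \<in> {-1, 1}"
proof -
  interpret A: prob_space "recall_law p" by (rule prob_space_recall_law)
  interpret pair_prob_space "measure_pmf (pmf_of_set {- 1, 1::int})" "recall_law p" ..
  have "AE v in measure_pmf (pmf_of_set {- 1, 1::int}). v \<in> {-1, 1}"
    by (subst AE_measure_pmf_iff) auto
  then have "AE v in measure_pmf (pmf_of_set {- 1, 1::int}). AE c in recall_law p. fst (v, c) \<in> {-1, 1}"
    by eventually_elim auto
  moreover have "{w \<in> space (measure_pmf (pmf_of_set {- 1, 1::int}) \<Otimes>\<^sub>M recall_law p). fst w \<in> {-1, 1}}
      \<in> sets (measure_pmf (pmf_of_set {- 1, 1::int}) \<Otimes>\<^sub>M recall_law p)"
    using measurable_sets[OF measurable_walk_law_fst[of p], of "{-1, 1}"]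
    by (simp add: walk_law_eq vimage_def Int_def conj_commute)
  ultimately show ?thesis unfolding walk_law_eq by (intro AE_pair_measure)
qed

lemma adapted_integrable:
  fixes f :: "walk_outcome \<Rightarrow> 'b::{banach, second_countable_topology}"
  assumes "adapted n f" shows "integrable (walk_law p) f"
proof -
  interpret prob_space "walk_law p" by (rule prob_space_walk_law)
  obtain B where B: "\<And>w. fst w \<in> {-1, 1} \<Longrightarrow> norm (f w) \<le> B"
    using adapted_bounded[OF assms] by blast
  show ?thesis
  proof (rule integrable_const_bound)
    show "AE w in walk_law p. norm (f w) \<le> B" using AE_first_step by eventually_elim (rule B)
  qed (rule adapted_borel_measurable[OF assms])
qed

text \<open>Step \<open>n + 1\<close> is the sum over \<open>k\<close> of step \<open>k\<close>
  times a sign \<open>s k\<close> that is nonzero only if \<open>k\<close> is recalled. This sign is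
  a function of choice \<open>n\<close> alone, has mean \<open>(2 * p - 1) / n\<close>, and is
  independent of the first \<open>n\<close> steps. The first step \<open>v\<close> is frozen, so
  that only independence of the choices enters.\<close>

lemma recall_law_next_step:
  fixes f :: "walk_outcome \<Rightarrow> 'b::{real_normed_field, banach, second_countable_topology}"
  assumes p: "0 \<le> p" "p \<le> 1" and f: "adapted n f" and n: "n \<ge> 1" and v: "v \<in> {-1, 1}"
  shows "(\<integral>c. f (v, c) * of_int (reinforced_step (v, c) (Suc n)) \<partial>recall_law p) =
    (\<integral>c. f (v, c) * of_real ((2 * p - 1) * of_int (walk (v, c) n) / real n) \<partial>recall_law p)"
proof -
  interpret prob_space "recall_law p" by (rule prob_space_recall_law)
  let ?N = "\<lambda>n::nat. measure_pmf (pair_pmf (pmf_of_set {1..n}) (bernoulli_pmf p))"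
  let ?I = "{1::nat..}"
  define s :: "nat \<Rightarrow> nat \<times> bool \<Rightarrow> 'b" where
    "s k x = (if fst x = k then if snd x then 1 else -1 else 0)" for k x
  have N: "prob_space (?N i)" for i by (rule measure_pmf.prob_space_axioms)
  have ind: "indep_vars ?N (\<lambda>i c. c i) ?I"
    using indep_vars_PiM_coordinates[of ?I ?N] N unfolding recall_law_def by simp
  have comp: "(\<lambda>r. snd (v, r) m) \<in> PiM A ?N \<rightarrow>\<^sub>M count_space UNIV" for m A
  proof (cases "m \<in> A")
    case True
    then have "(\<lambda>r. r m) \<in> PiM A ?N \<rightarrow>\<^sub>M ?N m" by (rule measurable_component_singleton)
    then show ?thesis by simp
  next
    case False
    \<comment> \<open>Outside \<open>A\<close> an element of the product space is
      \<open>undefined\<close>, so this coordinate is constant.\<close>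
    then have "(\<lambda>r. snd (v, r) m) \<in> PiM A ?N \<rightarrow>\<^sub>M count_space UNIV \<longleftrightarrow>
      (\<lambda>r. undefined) \<in> PiM A ?N \<rightarrow>\<^sub>M count_space (UNIV :: (nat \<times> bool) set)"
      by (intro measurable_cong) (auto simp: space_PiM PiE_def extensional_def)
    then show ?thesis by simp
  qed
  have meas: "(\<lambda>r. g (v, r)) \<in> borel_measurable (PiM A ?N)" if "adapted m g" 
    for g :: "walk_outcome \<Rightarrow> 'b" and A m
    by (rule measurable_adapted_comp[OF _ _ that]) (auto intro: comp[simplified])
  have integ: "integrable (recall_law p) (\<lambda>c. g (v, c))" if g: "adapted m g" for g :: "walk_outcome \<Rightarrow> 'b" and m
  proof -
    obtain B where B: "\<And>w. fst w \<in> {-1, 1} \<Longrightarrow> norm (g w) \<le> B"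
      using adapted_bounded[OF g] by blast
    show ?thesis
      by (rule integrable_const_bound[of _ B])
        (use B v meas[OF g, of ?I] in \<open>auto simp: recall_law_def\<close>)
  qed
  have cn: "(\<lambda>c. c n) \<in> recall_law p \<rightarrow>\<^sub>M count_space UNIV" using n by (rule measurable_recall_law_component)
  have s_meas: "(\<lambda>c. s k (c n)) \<in> borel_measurable (recall_law p)" for k
    by (rule measurable_compose[OF cn]) simp
  have s_int: "integrable (recall_law p) (\<lambda>c. s k (c n))" for k
    by (rule integrable_const_bound[of _ 1, OF _ s_meas]) (auto simp: s_def)
  have s_exp: "(\<integral>c. s k (c n) \<partial>recall_law p) = of_real ((2 * p - 1) / real n)" if k: "k \<in> {1..n}" for k
  proof -
    have "(\<integral>c. s k (c n) \<partial>recall_law p) = (\<integral>x. s k x \<partial>distr (recall_law p) (?N n) (\<lambda>c. c n))"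
      by (rule integral_distr[symmetric]) (use cn in auto)
    also have "distr (recall_law p) (?N n) (\<lambda>c. c n) = ?N n"
      unfolding recall_law_def by (rule distr_PiM_component) (use n N in auto)
    \<comment> \<open>Only the pairs \<open>(k, True)\<close> and \<open>(k, False)\<close>
      contribute, with masses \<open>p / n\<close> and \<open>(1 - p) / n\<close> and opposite
      signs.\<close>
    also have "(\<integral>x. s k x \<partial>?N n) = (\<Sum>x\<in>{(k, True), (k, False)}.
        pmf (pair_pmf (pmf_of_set {1..n}) (bernoulli_pmf p)) x *\<^sub>R s k x)"
      by (rule integral_measure_pmf) (auto simp: s_def split: if_splits)
    also have "\<dots> = of_real ((2 * p - 1) / real n)"
      using k p n by (simp add: s_def pmf_pair pmf_of_set_def[symmetric] scaleR_conv_of_real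
          flip: of_real_diff of_real_mult of_real_add of_real_minus) (simp add: field_simps)
    finally show ?thesis .
  qed
  have fV: "adapted n (\<lambda>w. f w * of_int (reinforced_step w k))" if "k \<le> n" for k
    by (rule adapted_comp2[OF f adapted_comp[OF adapted_step[OF that]]])
  have prod: "integrable (recall_law p) (\<lambda>c. g (v, c) * s k (c n))"
    "(\<integral>c. g (v, c) * s k (c n) \<partial>recall_law p) = (\<integral>c. g (v, c) \<partial>recall_law p) * (\<integral>c. s k (c n) \<partial>recall_law p)"
    if g: "adapted n g" for g k
  proof -
    have "indep_var (PiM {1..<n} ?N) (\<lambda>c. restrict (\<lambda>i. c i) {1..<n}) (PiM {n} ?N) (\<lambda>c. restrict (\<lambda>i. c i) {n})"
      by (rule indep_var_restrict[OF ind]) (use n in auto)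
    then have "indep_var borel ((\<lambda>r. g (v, r)) \<circ> (\<lambda>c. restrict (\<lambda>i. c i) {1..<n}))
       borel ((\<lambda>r. s k (r n)) \<circ> (\<lambda>c. restrict (\<lambda>i. c i) {n}))"
    proof (rule indep_var_compose)
      show "(\<lambda>r. g (v, r)) \<in> borel_measurable (PiM {1..<n} ?N)" by (rule meas[OF g])
      have "(\<lambda>r. r n) \<in> PiM {n} ?N \<rightarrow>\<^sub>M count_space UNIV" using comp[of n "{n}"] by simp
      then show "(\<lambda>r. s k (r n)) \<in> borel_measurable (PiM {n} ?N)"
        by (rule measurable_compose) simp
    qed
    then have "indep_var borel (\<lambda>c. g (v, c)) borel (\<lambda>c. s k (c n))"
      by (simp add: comp_def adapted_past[OF g] del: One_nat_def)
    from indep_var_integrable[OF this integ[OF g] s_int] indep_var_lebesgue_integral[OF this integ[OF g] s_int]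
    show "integrable (recall_law p) (\<lambda>c. g (v, c) * s k (c n))"
      "(\<integral>c. g (v, c) * s k (c n) \<partial>recall_law p) = (\<integral>c. g (v, c) \<partial>recall_law p) * (\<integral>c. s k (c n) \<partial>recall_law p)"
      by auto
  qed
  have "AE x in ?N n. fst x \<in> {1..n}"
    using n by (auto simp: AE_measure_pmf_iff)
  then have AE: "AE c in recall_law p. fst (c n) \<in> {1..n}"
    unfolding recall_law_def by (intro AE_PiM_component) (use n N in auto)
  obtain m where m: "n = Suc m" using n by (cases n) auto
  have step: "of_int (reinforced_step (v, c) (Suc n)) =
      (\<Sum>k\<in>{1..n}. of_int (reinforced_step (v, c) k) * s k (c n))" if "fst (c n) \<in> {1..n}" for c
  proof -
    have "(\<Sum>k\<in>{1..n}. of_int (reinforced_step (v, c) k) * s k (c n)) =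
      (\<Sum>k\<in>{1..n}. if k = fst (c n) then of_int (reinforced_step (v, c) k) * s k (c n) else 0)"
      by (intro sum.cong) (auto simp: s_def)
    also have "\<dots> = of_int (reinforced_step (v, c) (fst (c n))) * s (fst (c n)) (c n)"
      using that by simp
    finally show ?thesis using that m by (auto simp: s_def Let_def)
  qed
  have "(\<integral>c. f (v, c) * of_int (reinforced_step (v, c) (Suc n)) \<partial>recall_law p) =
      (\<integral>c. (\<Sum>k\<in>{1..n}. f (v, c) * of_int (reinforced_step (v, c) k) * s k (c n)) \<partial>recall_law p)"
  proof (rule integral_cong_AE)
    show "AE c in recall_law p. f (v, c) * of_int (reinforced_step (v, c) (Suc n)) =
      (\<Sum>k\<in>{1..n}. f (v, c) * of_int (reinforced_step (v, c) k) * s k (c n))"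
      using AE by eventually_elim (simp only: step sum_distrib_left mult.assoc)
    show "(\<lambda>c. f (v, c) * of_int (reinforced_step (v, c) (Suc n))) \<in> borel_measurable (recall_law p)"
      unfolding recall_law_def
      by (rule meas[of "Suc n" "\<lambda>w. f w * of_int (reinforced_step w (Suc n))"])
        (rule adapted_comp2[OF adapted_mono[OF f] adapted_comp[OF adapted_step]], simp_all)
    show "(\<lambda>c. \<Sum>k\<in>{1..n}. f (v, c) * of_int (reinforced_step (v, c) k) * s k (c n)) \<in> borel_measurable (recall_law p)"
      by (intro borel_measurable_sum borel_measurable_integrable prod(1)[OF fV]) auto
  qed
  also have "\<dots> = (\<Sum>k\<in>{1..n}. \<integral>c. f (v, c) * of_int (reinforced_step (v, c) k) * s k (c n) \<partial>recall_law p)"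
    by (intro Bochner_Integration.integral_sum prod(1)[OF fV]) auto
  also have "\<dots> = (\<Sum>k\<in>{1..n}. (\<integral>c. f (v, c) * of_int (reinforced_step (v, c) k) \<partial>recall_law p) * of_real ((2 * p - 1) / real n))"
    by (intro sum.cong refl) (subst prod(2)[OF fV], use s_exp in auto)
  also have "\<dots> = (\<Sum>k\<in>{1..n}. (\<integral>c. f (v, c) * of_int (reinforced_step (v, c) k) \<partial>recall_law p)) * of_real ((2 * p - 1) / real n)"
    by (rule sum_distrib_right[symmetric])
  also have "(\<Sum>k\<in>{1..n}. (\<integral>c. f (v, c) * of_int (reinforced_step (v, c) k) \<partial>recall_law p)) =
      (\<integral>c. (\<Sum>k\<in>{1..n}. f (v, c) * of_int (reinforced_step (v, c) k)) \<partial>recall_law p)"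
    by (intro Bochner_Integration.integral_sum[symmetric] integ[OF fV]) auto
  also have "\<dots> * of_real ((2 * p - 1) / real n) =
     (\<integral>c. (\<Sum>k\<in>{1..n}. f (v, c) * of_int (reinforced_step (v, c) k)) * of_real ((2 * p - 1) / real n) \<partial>recall_law p)"
    by simp
  also have "\<dots> = (\<integral>c. f (v, c) * of_real ((2 * p - 1) * of_int (walk (v, c) n) / real n) \<partial>recall_law p)"
    by (intro Bochner_Integration.integral_cong refl)
      (simp add: walk_def sum_distrib_left[symmetric] mult_ac)
  finally show ?thesis .
qed

text \<open>The conditional mean of the next step in weak form, tested against functions of the
  past; the first step is integrated out by Fubini. The codomain is a general field because moments
  need real test functions and characteristic functions complex ones.\<close>

lemma expectation_next_step:
  fixes f :: "walk_outcome \<Rightarrow> 'b::{real_normed_field, banach, second_countable_topology}"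
  assumes p: "0 \<le> p" "p \<le> 1" and f: "adapted n f" and n: "n \<ge> 1"
  shows "(\<integral>w. f w * of_int (reinforced_step w (Suc n)) \<partial>walk_law p) =
    (\<integral>w. f w * of_real ((2 * p - 1) * of_int (walk w n) / real n) \<partial>walk_law p)"
proof -
  interpret A: prob_space "recall_law p" by (rule prob_space_recall_law)
  interpret pair_prob_space "measure_pmf (pmf_of_set {- 1, 1::int})" "recall_law p" ..
  have 1: "integrable (walk_law p) (\<lambda>w. f w * of_int (reinforced_step w (Suc n)))"
    by (rule adapted_integrable[of "Suc n"], rule adapted_comp2[OF adapted_mono[OF f] adapted_comp[OF adapted_step]], simp_all)
  have 2: "integrable (walk_law p) (\<lambda>w. f w * of_real ((2 * p - 1) * of_int (walk w n) / real n))"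
    by (rule adapted_integrable[of "n"], rule adapted_comp2[OF f], rule adapted_comp[OF adapted_walk], simp)
  have "AE v in measure_pmf (pmf_of_set {- 1, 1::int}). v \<in> {-1, 1}"
    by (subst AE_measure_pmf_iff) auto
  then have "AE v in measure_pmf (pmf_of_set {- 1, 1::int}).
     (\<integral>c. f (v, c) * of_int (reinforced_step (v, c) (Suc n)) \<partial>recall_law p) =
    (\<integral>c. f (v, c) * of_real ((2 * p - 1) * of_int (walk (v, c) n) / real n) \<partial>recall_law p)"
    by eventually_elim (rule recall_law_next_step[OF p f n])
  then have "(\<integral>v. (\<integral>c. f (v, c) * of_int (reinforced_step (v, c) (Suc n)) \<partial>recall_law p) \<partial>measure_pmf (pmf_of_set {- 1, 1})) =
    (\<integral>v. (\<integral>c. f (v, c) * of_real ((2 * p - 1) * of_int (walk (v, c) n) / real n) \<partial>recall_law p) \<partial>measure_pmf (pmf_of_set {- 1, 1}))"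
    by (intro integral_cong_AE) auto
  then show ?thesis
    using integral_fst'[OF 1[unfolded walk_law_eq]] integral_fst'[OF 2[unfolded walk_law_eq]]
    unfolding walk_law_eq by simp
qed

section \<open>Moments and maximal inequalities of the walk\<close>

locale reinforced_walk =
  fixes p :: real
  assumes p_nonneg: "0 \<le> p" and p_less: "p < 3 / 4"
begin

abbreviation W :: "walk_outcome measure" where "W \<equiv> walk_law p"

abbreviation V :: "nat \<Rightarrow> walk_outcome \<Rightarrow> real" where
  "V n w \<equiv> of_int (reinforced_step w n)"

abbreviation S :: "nat \<Rightarrow> walk_outcome \<Rightarrow> real" where
  "S n w \<equiv> of_int (walk w n)"

definition a :: real where "a = 2 * p - 1"

text \<open>\<open>K * n\<close> must dominate the recursion
  \<open>x (n+1) = (1 + 2 * a / n) * x n + 1\<close> of the second moments, which requires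
  \<open>K * (1 - 2 * a) \<ge> 1\<close>. The bound \<open>K \<ge> 1\<close> serves the first step
  and the case of a negative factor.\<close>

definition K :: real where "K = max 1 (1 / (1 - 2 * a))"

sublocale prob_space W by (rule prob_space_walk_law)

lemma a_bounds: "-1 \<le> a" "a < 1 / 2" "\<bar>a\<bar> \<le> 1"
  using p_nonneg p_less by (auto simp: a_def)

lemma K_ge: "K \<ge> 1" "K * (1 - 2 * a) \<ge> 1"
proof -
  have "1 / (1 - 2 * a) * (1 - 2 * a) \<le> K * (1 - 2 * a)"
    using a_bounds by (intro mult_right_mono) (auto simp: K_def)
  then show "K * (1 - 2 * a) \<ge> 1" using a_bounds by simp
qed (simp add: K_def)

lemma walk_0[simp]: "walk w 0 = 0"
  by (simp add: walk_def)

lemma walk_Suc: "walk w (Suc n) = walk w n + reinforced_step w (Suc n)"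
  by (simp add: walk_def)

lemma AE_unit_steps: "AE w in W. \<forall>k\<ge>1. reinforced_step w k \<in> {-1, 1}"
  using AE_first_step by eventually_elim (use reinforced_step_unit in blast)

lemma adapted_S: "adapted n (S n)"
  by (rule adapted_comp[OF adapted_walk]) simp

lemma adapted_V: "adapted n (V n)"
  by (rule adapted_comp[OF adapted_step]) simp

lemma expectation_V:
  assumes "adapted n f" "n \<ge> 1"
  shows "expectation (\<lambda>w. f w * V (Suc n) w) = expectation (\<lambda>w. f w * (a * S n w / n))"
  using expectation_next_step[OF p_nonneg _ assms] p_less by (simp add: a_def)

lemma second_moment_Suc:
  assumes n: "n \<ge> 1"
  shows "expectation (\<lambda>w. (S (Suc n) w)\<^sup>2) = (1 + 2 * a / n) * expectation (\<lambda>w. (S n w)\<^sup>2) + 1"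
proof -
  have i1: "integrable W (\<lambda>w. (S n w)\<^sup>2)"
    by (rule adapted_integrable, rule adapted_comp[OF adapted_S])
  have i2: "integrable W (\<lambda>w. S n w * V (Suc n) w)"
    by (rule adapted_integrable[of "Suc n"], rule adapted_comp2[OF adapted_mono[OF adapted_S] adapted_V]) simp
  have "expectation (\<lambda>w. (S (Suc n) w)\<^sup>2) = expectation (\<lambda>w. (S n w)\<^sup>2 + 2 * (S n w * V (Suc n) w) + 1)"
  proof (rule integral_cong_AE)
    show "AE w in W. (S (Suc n) w)\<^sup>2 = (S n w)\<^sup>2 + 2 * (S n w * V (Suc n) w) + 1"
      using AE_unit_steps
    proof eventually_elim
      case (elim w)
      then have "reinforced_step w (Suc n) \<in> {-1, 1}" by simp
      then have "(V (Suc n) w)\<^sup>2 = 1" by auto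
      then show ?case by (simp add: walk_Suc power2_sum)
    qed
    show "(\<lambda>w. (S (Suc n) w)\<^sup>2) \<in> borel_measurable W"
      by (rule adapted_borel_measurable, rule adapted_comp[OF adapted_S])
    show "(\<lambda>w. (S n w)\<^sup>2 + 2 * (S n w * V (Suc n) w) + 1) \<in> borel_measurable W"
      using i1 i2 by measurable
  qed
  also have "\<dots> = expectation (\<lambda>w. (S n w)\<^sup>2) + 2 * expectation (\<lambda>w. S n w * V (Suc n) w) + 1"
    using i1 i2 by (simp add: prob_space)
  also have "expectation (\<lambda>w. S n w * V (Suc n) w) = expectation (\<lambda>w. a / n * (S n w)\<^sup>2)"
    by (subst expectation_V[OF adapted_S n]) (simp add: power2_eq_square mult_ac)
  finally show ?thesis using i1 by (simp add: algebra_simps)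
qed

lemma second_moment_le: "expectation (\<lambda>w. (S n w)\<^sup>2) \<le> K * n"
proof (induction n)
  case (Suc n)
  let ?x = "expectation (\<lambda>w. (S n w)\<^sup>2)"
  show ?case
  proof (cases "n = 0")
    case True
    have "expectation (\<lambda>w. (S 1 w)\<^sup>2) = expectation (\<lambda>w. 1)"
    proof (rule integral_cong_AE)
      show "AE w in W. (S 1 w)\<^sup>2 = 1"
        using AE_first_step by eventually_elim (auto simp: walk_def)
    qed (auto intro!: adapted_borel_measurable[of 1] adapted_comp[OF adapted_S])
    then show ?thesis using True K_ge by (simp add: prob_space)
  next
    case False
    have x0: "?x \<ge> 0" by simp
    have "expectation (\<lambda>w. (S (Suc n) w)\<^sup>2) = (1 + 2 * a / n) * ?x + 1"
      using False by (intro second_moment_Suc) simp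
    also have "\<dots> \<le> K * Suc n"
    proof (cases "1 + 2 * a / n \<ge> 0")
      case True
      then have "(1 + 2 * a / n) * ?x \<le> (1 + 2 * a / n) * (K * n)"
        using Suc by (intro mult_left_mono)
      also have "\<dots> = K * n + 2 * a * K" using False by (simp add: field_simps)
      finally show ?thesis using K_ge(2) by (simp add: algebra_simps)
    next
      \<comment> \<open>The factor is negative only at \<open>n = 1\<close> with
        \<open>a < -1/2\<close>. The induction hypothesis cannot be multiplied by it, but the first
        summand is then at most 0 and the constant 1 remains.\<close>
      case neg: False
      then have "(1 + 2 * a / n) * ?x \<le> 0" using x0 by (intro mult_nonpos_nonneg) auto
      moreover have "K * Suc n \<ge> 1 * 1" using K_ge by (intro mult_mono) auto
      ultimately show ?thesis by simp
    qed
    finally show ?thesis .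
  qed
qed simp

lemma expectation_abs_le:
  fixes X :: "walk_outcome \<Rightarrow> real"
  assumes "adapted m X" and "expectation (\<lambda>w. (X w)\<^sup>2) \<le> c"
  shows "expectation (\<lambda>w. \<bar>X w\<bar>) \<le> sqrt c"
proof -
  have i: "integrable W (\<lambda>w. \<bar>X w\<bar>)" "integrable W (\<lambda>w. \<bar>X w\<bar>\<^sup>2)"
    by (rule adapted_integrable, rule adapted_comp[OF assms(1)])+
  have "0 \<le> variance (\<lambda>w. \<bar>X w\<bar>)" by (rule variance_positive)
  also have "\<dots> = expectation (\<lambda>w. \<bar>X w\<bar>\<^sup>2) - (expectation (\<lambda>w. \<bar>X w\<bar>))\<^sup>2"
    by (rule variance_eq[OF i])
  finally have "(expectation (\<lambda>w. \<bar>X w\<bar>))\<^sup>2 \<le> c" using assms(2) by simp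
  then show ?thesis by (rule real_le_rsqrt)
qed

lemma expectation_abs_walk_le: "expectation (\<lambda>w. \<bar>S n w\<bar>) \<le> sqrt (K * n)"
  by (rule expectation_abs_le[OF adapted_S second_moment_le])

text \<open>The martingale difference: a step minus its conditional mean. It is known only at time
  \<open>k + 1\<close>, so a factor adapted at time \<open>k\<close> is predictable for it.\<close>

definition D :: "nat \<Rightarrow> walk_outcome \<Rightarrow> real" where
  "D k w = V (Suc k) w - a * S k w / k"

lemma adapted_D: "adapted (Suc k) (D k)"
  unfolding D_def
  by (rule adapted_comp2[OF adapted_V adapted_comp[OF adapted_mono[OF adapted_S]]]) simp

lemma adapted_transform:
  fixes H :: "nat \<Rightarrow> walk_outcome \<Rightarrow> real"
  assumes "\<And>k. adapted k (H k)"
  shows "adapted n (\<lambda>w. \<Sum>k\<in>{m..<n}. H k w * D k w)"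
  by (rule adapted_sum, rule adapted_comp2[OF adapted_mono[OF assms] adapted_mono[OF adapted_D]]) auto

text \<open>Cross terms vanish because \<open>D n\<close> has conditional mean 0, while
  \<open>H n\<close> and the partial sum are known at time \<open>n\<close>. The conditional
  variance of \<open>D n\<close> is \<open>1 - (a * S n / n)^2\<close>, which is at most 1, so the
  isometry becomes an inequality.\<close>

lemma martingale_transform_second_moment:
  fixes H :: "nat \<Rightarrow> walk_outcome \<Rightarrow> real"
  assumes H: "\<And>k. adapted k (H k)" and m: "m \<ge> 1"
  shows "expectation (\<lambda>w. (\<Sum>k\<in>{m..<n}. H k w * D k w)\<^sup>2) \<le> (\<Sum>k\<in>{m..<n}. expectation (\<lambda>w. (H k w)\<^sup>2))"
proof (induction n)
  case (Suc n)
  show ?case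
  proof (cases "m \<le> n")
    case False
    then show ?thesis by simp
  next
    case True
    then have n: "n \<ge> 1" using m by simp
    define M where "M w = (\<Sum>k\<in>{m..<n}. H k w * D k w)" for w
    have M: "adapted n M" unfolding M_def[abs_def] by (rule adapted_transform[OF H])
    have MH: "adapted n (\<lambda>w. M w * H n w)" by (rule adapted_comp2[OF M H])
    have HH: "adapted n (\<lambda>w. (H n w)\<^sup>2)" by (rule adapted_comp[OF H])
    have HS: "adapted n (\<lambda>w. (H n w)\<^sup>2 * (a * S n w / n))"
      by (rule adapted_comp2[OF HH adapted_comp[OF adapted_S]])
    have HSS: "adapted n (\<lambda>w. (H n w)\<^sup>2 * (a * S n w / n)\<^sup>2)"
      by (rule adapted_comp2[OF HH adapted_comp[OF adapted_S]])
    have MHS: "adapted n (\<lambda>w. M w * H n w * (a * S n w / n))"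
      by (rule adapted_comp2[OF MH adapted_comp[OF adapted_S]])
    have iM: "integrable W (\<lambda>w. (M w)\<^sup>2)" by (rule adapted_integrable, rule adapted_comp[OF M])
    have iV: "integrable W (\<lambda>w. f w * V (Suc n) w)" if "adapted n f" for f
      by (rule adapted_integrable[of "Suc n"], rule adapted_comp2[OF adapted_mono[OF that] adapted_V]) simp
    note ii = iM iV[OF MH] iV[OF HS] HH[THEN adapted_integrable] HSS[THEN adapted_integrable]
      MHS[THEN adapted_integrable]
    have "expectation (\<lambda>w. (\<Sum>k\<in>{m..<Suc n}. H k w * D k w)\<^sup>2) =
      expectation (\<lambda>w. (M w)\<^sup>2 + 2 * (M w * H n w * V (Suc n) w - M w * H n w * (a * S n w / n))
        + ((H n w)\<^sup>2 - 2 * ((H n w)\<^sup>2 * (a * S n w / n) * V (Suc n) w) + (H n w)\<^sup>2 * (a * S n w / n)\<^sup>2))"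
    proof (rule integral_cong_AE)
      show "AE w in W. (\<Sum>k\<in>{m..<Suc n}. H k w * D k w)\<^sup>2 =
        (M w)\<^sup>2 + 2 * (M w * H n w * V (Suc n) w - M w * H n w * (a * S n w / n))
        + ((H n w)\<^sup>2 - 2 * ((H n w)\<^sup>2 * (a * S n w / n) * V (Suc n) w) + (H n w)\<^sup>2 * (a * S n w / n)\<^sup>2)"
        using AE_unit_steps
      proof eventually_elim
        case (elim w)
        then have "reinforced_step w (Suc n) \<in> {-1, 1}" by simp
        then have v: "(V (Suc n) w)\<^sup>2 = 1" by auto
        have "(\<Sum>k\<in>{m..<Suc n}. H k w * D k w) = M w + H n w * (V (Suc n) w - a * S n w / n)"
          using True by (simp add: M_def D_def)
        moreover have "(M + H * (v - y))\<^sup>2 = M\<^sup>2 + 2 * (M * H * v - M * H * y) + (H\<^sup>2 * v\<^sup>2 - 2 * (H\<^sup>2 * y * v) + H\<^sup>2 * y\<^sup>2)"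
          for M H v y :: real by (simp add: power2_eq_square algebra_simps)
        ultimately show ?case using v by simp
      qed
      show "(\<lambda>w. (\<Sum>k\<in>{m..<Suc n}. H k w * D k w)\<^sup>2) \<in> borel_measurable W"
        by (rule adapted_borel_measurable, rule adapted_comp[OF adapted_transform[OF H]])
      show "(\<lambda>w. (M w)\<^sup>2 + 2 * (M w * H n w * V (Suc n) w - M w * H n w * (a * S n w / n))
        + ((H n w)\<^sup>2 - 2 * ((H n w)\<^sup>2 * (a * S n w / n) * V (Suc n) w) + (H n w)\<^sup>2 * (a * S n w / n)\<^sup>2)) \<in> borel_measurable W"
        by (intro borel_measurable_integrable Bochner_Integration.integrable_add
            Bochner_Integration.integrable_diff integrable_mult_right ii)
    qed
    also have "\<dots> = expectation (\<lambda>w. (M w)\<^sup>2) + 2 * (expectation (\<lambda>w. M w * H n w * V (Suc n) w) - expectation (\<lambda>w. M w * H n w * (a * S n w / n)))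
        + (expectation (\<lambda>w. (H n w)\<^sup>2) - 2 * expectation (\<lambda>w. (H n w)\<^sup>2 * (a * S n w / n) * V (Suc n) w) + expectation (\<lambda>w. (H n w)\<^sup>2 * (a * S n w / n)\<^sup>2))"
      using ii by (simp del: times_divide_eq_right times_divide_eq_left)
    also have "\<dots> = expectation (\<lambda>w. (M w)\<^sup>2) + expectation (\<lambda>w. (H n w)\<^sup>2) - expectation (\<lambda>w. (H n w)\<^sup>2 * (a * S n w / n)\<^sup>2)"
      using expectation_V[OF MH n] expectation_V[OF HS n] by (simp add: power2_eq_square mult_ac)
    also have "\<dots> \<le> expectation (\<lambda>w. (M w)\<^sup>2) + expectation (\<lambda>w. (H n w)\<^sup>2)"
      by simp
    also have "\<dots> \<le> (\<Sum>k\<in>{m..<Suc n}. expectation (\<lambda>w. (H k w)\<^sup>2))"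
      using Suc True by (simp add: M_def)
    finally show ?thesis .
  qed
qed simp

text \<open>Stopping the martingale when it first leaves \<open>[-c, c]\<close> is the transform by a predictable
  indicator.\<close>

lemma martingale_maximal_inequality:
  assumes m: "m \<ge> 1" and c: "c > 0"
  shows "prob {w \<in> space W. \<exists>n\<in>{m..m'}. \<bar>\<Sum>k\<in>{m..<n}. D k w\<bar> > c} \<le> real (m' - m) / c\<^sup>2"
proof -
  define M where "M n w = (\<Sum>k\<in>{m..<n}. D k w)" for n w
  define H where "H k w = (if \<forall>j\<in>{m..k}. \<bar>M j w\<bar> \<le> c then 1 else 0::real)" for k w
  define Z where "Z w = (\<Sum>k\<in>{m..<m'}. H k w * D k w)" for w
  have M: "adapted n (M n)" for n
    using adapted_transform[of "\<lambda>_ _. 1" n m] by (simp add: M_def[abs_def])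
  have H: "adapted k (H k)" for k
  proof (rule adaptedI)
    fix w w' :: walk_outcome assume *: "\<forall>j\<le>k. reinforced_step w j = reinforced_step w' j"
    have "M j w = M j w'" if "j \<in> {m..k}" for j
      by (rule adaptedD[OF adapted_mono[OF M] *]) (use that in simp)
    then show "H k w = H k w'" by (simp add: H_def)
  qed
  have Z: "adapted m' Z" unfolding Z_def[abs_def] by (rule adapted_transform[OF H])
  have "(Z w)\<^sup>2 \<ge> c\<^sup>2" if ex: "\<exists>n\<in>{m..m'}. \<bar>M n w\<bar> > c" for w
  proof -
    \<comment> \<open>At the first exit time the indicator switches off for good, so
      \<open>Z\<close> keeps the value \<open>M n\<close>, whose modulus exceeds
      \<open>c\<close>.\<close>
    define n where "n = (LEAST n. n \<in> {m..m'} \<and> \<bar>M n w\<bar> > c)"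
    have n: "n \<in> {m..m'}" "\<bar>M n w\<bar> > c"
    proof -
      have "n \<in> {m..m'} \<and> \<bar>M n w\<bar> > c" unfolding n_def by (rule LeastI_ex) (use ex in blast)
      then show "n \<in> {m..m'}" "\<bar>M n w\<bar> > c" by blast+
    qed
    have before: "\<bar>M j w\<bar> \<le> c" if "j \<in> {m..<n}" for j
      using not_less_Least[of j "\<lambda>n. n \<in> {m..m'} \<and> \<bar>M n w\<bar> > c"] that n unfolding n_def by auto
    have "Z w = (\<Sum>k\<in>{m..<n}. H k w * D k w) + (\<Sum>k\<in>{n..<m'}. H k w * D k w)"
      unfolding Z_def using n by (subst sum.atLeastLessThan_concat) auto
    also have "(\<Sum>k\<in>{m..<n}. H k w * D k w) = M n w"
      unfolding M_def by (intro sum.cong) (use before in \<open>auto simp: H_def M_def\<close>)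
    also have "(\<Sum>k\<in>{n..<m'}. H k w * D k w) = 0"
    proof (intro sum.neutral ballI)
      fix k assume "k \<in> {n..<m'}"
      then have "n \<in> {m..k}" using n by auto
      then have "\<not> (\<forall>j\<in>{m..k}. \<bar>M j w\<bar> \<le> c)" using n(2) by (meson not_le)
      then have "H k w = 0" unfolding H_def by (rule if_not_P)
      then show "H k w * D k w = 0" by simp
    qed
    finally have "\<bar>c\<bar> \<le> \<bar>Z w\<bar>" using n c by simp
    then show ?thesis by (simp only: abs_le_square_iff)
  qed
  then have "prob {w \<in> space W. \<exists>n\<in>{m..m'}. \<bar>M n w\<bar> > c} \<le> prob {w \<in> space W. (Z w)\<^sup>2 \<ge> c\<^sup>2}"
    using adapted_borel_measurable[OF Z, of p] by (intro finite_measure_mono) auto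
  also have "\<dots> \<le> expectation (\<lambda>w. (Z w)\<^sup>2) / c\<^sup>2"
    by (rule integral_Markov_inequality_measure[where A="{}"])
      (use c in \<open>auto intro!: adapted_integrable[of m'] adapted_comp[OF Z]\<close>)
  also have "expectation (\<lambda>w. (Z w)\<^sup>2) \<le> (\<Sum>k\<in>{m..<m'}. expectation (\<lambda>w. (H k w)\<^sup>2))"
    unfolding Z_def by (rule martingale_transform_second_moment[OF H m])
  also have "\<dots> \<le> (\<Sum>k\<in>{m..<m'}. 1)"
  proof (rule sum_mono)
    fix k
    have "expectation (\<lambda>w. (H k w)\<^sup>2) \<le> expectation (\<lambda>w. 1)"
      by (intro integral_mono adapted_integrable[of k] adapted_comp[OF H]) (auto simp: H_def)
    then show "expectation (\<lambda>w. (H k w)\<^sup>2) \<le> 1" by (simp add: prob_space)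
  qed
  finally show ?thesis using c by (simp add: M_def divide_right_mono)
qed

text \<open>The increment is a martingale plus the drift \<open>a * S k / k\<close> summed over the
  window, and each part gets half of the threshold. The drift is controlled by Markov's inequality
  with \<open>E |S k| / k \<le> sqrt (K / k)\<close>. For \<open>c\<close> of order
  \<open>sqrt m\<close> both terms are of the order of the relative window length
  \<open>(m' - m) / m\<close>.\<close>

lemma walk_maximal_inequality:
  assumes m: "m \<ge> 1" and c: "c > 0"
  shows "prob {w \<in> space W. \<exists>n\<in>{m..m'}. \<bar>S n w - S m w\<bar> > 2 * c}
    \<le> real (m' - m) * (1 / c\<^sup>2 + sqrt (K / m) / c)"
proof -
  define R where "R w = (\<Sum>k\<in>{m..<m'}. \<bar>S k w\<bar> / k)" for w
  let ?A = "{w \<in> space W. \<exists>n\<in>{m..m'}. \<bar>\<Sum>k\<in>{m..<n}. D k w\<bar> > c}"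
  let ?B = "{w \<in> space W. R w \<ge> c}"
  have R: "adapted m' R" unfolding R_def[abs_def]
    by (rule adapted_sum, rule adapted_comp[OF adapted_walk]) simp
  have Dm[measurable]: "D k \<in> borel_measurable W" for k by (rule adapted_borel_measurable[OF adapted_D])
  have A: "?A \<in> sets W" by measurable
  have B: "?B \<in> sets W" using adapted_borel_measurable[OF R, of p] by measurable
  have decomp: "S n w - S m w = (\<Sum>k\<in>{m..<n}. D k w) + a * (\<Sum>k\<in>{m..<n}. S k w / k)" if "m \<le> n" for n w
    using that
  proof (induction n rule: dec_induct)
    case (step n)
    then show ?case by (simp add: walk_Suc D_def algebra_simps)
  qed simp
  have "{w \<in> space W. \<exists>n\<in>{m..m'}. \<bar>S n w - S m w\<bar> > 2 * c} \<subseteq> ?A \<union> ?B"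
  proof (safe, rule ccontr)
    fix v c' n
    let ?w = "(v, c') :: walk_outcome"
    assume n: "n \<in> {m..m'}" and big: "2 * c < \<bar>S n ?w - S m ?w\<bar>" and sp: "?w \<in> space W"
      and nB: "\<not> c \<le> R ?w" and nA: "\<not> (\<exists>n\<in>{m..m'}. c < \<bar>\<Sum>k\<in>{m..<n}. D k ?w\<bar>)"
    have "\<bar>\<Sum>k\<in>{m..<n}. D k ?w\<bar> \<le> c" using nA n by (meson not_less)
    moreover have "\<bar>a * (\<Sum>k\<in>{m..<n}. S k ?w / k)\<bar> \<le> R ?w"
    proof -
      have "\<bar>a * (\<Sum>k\<in>{m..<n}. S k ?w / k)\<bar> = \<bar>a\<bar> * \<bar>\<Sum>k\<in>{m..<n}. S k ?w / k\<bar>" by (rule abs_mult)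
      also have "\<dots> \<le> 1 * \<bar>\<Sum>k\<in>{m..<n}. S k ?w / k\<bar>" using a_bounds by (intro mult_right_mono) auto
      also have "\<dots> \<le> (\<Sum>k\<in>{m..<n}. \<bar>S k ?w / k\<bar>)" by (simp only: mult_1) (rule sum_abs)
      also have "\<dots> \<le> R ?w" unfolding R_def abs_divide using n by (simp, intro sum_mono2) auto
      finally show ?thesis .
    qed
    ultimately show False using nB big decomp[of n ?w] n by auto
  qed
  then have "prob {w \<in> space W. \<exists>n\<in>{m..m'}. \<bar>S n w - S m w\<bar> > 2 * c} \<le> prob (?A \<union> ?B)"
    using A B by (intro finite_measure_mono) auto
  also have "\<dots> \<le> prob ?A + prob ?B" using A B by (rule measure_Un_le)
  also have "prob ?A \<le> real (m' - m) / c\<^sup>2" by (rule martingale_maximal_inequality[OF m c])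
  also have "prob ?B \<le> expectation R / c"
    by (rule integral_Markov_inequality_measure[OF adapted_integrable[OF R], where A="{}"])
      (use c in \<open>auto simp: R_def intro!: sum_nonneg\<close>)
  also have "expectation R = (\<Sum>k\<in>{m..<m'}. expectation (\<lambda>w. \<bar>S k w\<bar> / k))"
    unfolding R_def by (intro Bochner_Integration.integral_sum adapted_integrable) (rule adapted_comp[OF adapted_S])
  also have "\<dots> \<le> (\<Sum>k\<in>{m..<m'}. sqrt (K / m))"
  proof (rule sum_mono)
    fix k assume k: "k \<in> {m..<m'}"
    then have k0: "real k > 0" using m by auto
    have "expectation (\<lambda>w. \<bar>S k w\<bar> / k) = expectation (\<lambda>w. \<bar>S k w\<bar>) / k" by simp
    also have "\<dots> \<le> sqrt (K * k) / k" using expectation_abs_walk_le by (intro divide_right_mono) auto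
    also have "\<dots> = sqrt (K / k)" using k0 by (simp add: real_sqrt_mult real_sqrt_divide field_simps)
    also have "\<dots> \<le> sqrt (K / m)" using k m K_ge by (intro real_sqrt_le_mono divide_left_mono) auto
    finally show "expectation (\<lambda>w. \<bar>S k w\<bar> / k) \<le> sqrt (K / m)" .
  qed
  finally show ?thesis using c by (simp add: field_simps)
qed

end

section \<open>Collision times\<close>

lemma sum_inverse_sqrt_le: "(\<Sum>k\<in>{1..n}. 1 / sqrt (real k)) \<le> 2 * sqrt (real n)"
proof (induction n)
  case (Suc n)
  define r s where "r = sqrt (real n)" and "s = sqrt (real (Suc n))"
  have rs: "0 \<le> r" "r \<le> s" "s > 0" by (auto simp: r_def s_def)
  have "1 = (s - r) * (s + r)" by (simp add: r_def s_def algebra_simps)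
  also have "\<dots> \<le> (s - r) * (2 * s)" using rs by (intro mult_left_mono) auto
  also have "\<dots> = 2 * (s - r) * s" by simp
  finally have "1 / s \<le> 2 * (s - r)" using rs(3) by (subst pos_divide_le_eq)
  then show ?case using Suc by (simp add: r_def s_def)
qed simp

definition deviation :: "(int \<Rightarrow> real) \<Rightarrow> real \<Rightarrow> int \<Rightarrow> real" where
  "deviation \<zeta> l x = scatterer \<zeta> x - l * of_int x"

lemma deviation_0[simp]: "deviation \<zeta> l 0 = 0"
  by (simp add: deviation_def scatterer_0)

text \<open>Here \<open>scatterer\<close> serves as discrete integration of a function that need not
  be positive. With \<open>h\<close> the deviation, the potential vanishes at 0 and increases by
  \<open>h x + h (x - 1)\<close> from \<open>x - 1\<close> to \<open>x\<close>: it is twice the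
  trapezoidal sum of \<open>h\<close>.\<close>

definition deviation_potential :: "(int \<Rightarrow> real) \<Rightarrow> real \<Rightarrow> int \<Rightarrow> real" where
  "deviation_potential \<zeta> l = scatterer (\<lambda>x. deviation \<zeta> l x + deviation \<zeta> l (x - 1))"

text \<open>There are \<open>|x|\<close> summands, and both arguments in each lie between 0 and
  \<open>x\<close>, so each is at most \<open>2 * (e * |x| + C)\<close>.\<close>

lemma abs_deviation_potential_le:
  assumes dev: "\<And>x. \<bar>deviation \<zeta> l x\<bar> \<le> e * \<bar>of_int x\<bar> + C" and e: "e \<ge> 0"
  shows "\<bar>deviation_potential \<zeta> l x\<bar> \<le> 2 * e * (of_int x)\<^sup>2 + 2 * C * \<bar>of_int x\<bar>"
proof -
  define g where "g i = deviation \<zeta> l i + deviation \<zeta> l (i - 1)" for i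
  define B where "B = 2 * (e * \<bar>of_int x\<bar> + C)"
  have g: "\<bar>g i\<bar> \<le> B" if "\<bar>i\<bar> \<le> \<bar>x\<bar>" "\<bar>i - 1\<bar> \<le> \<bar>x\<bar>" for i
  proof -
    have "e * \<bar>of_int i\<bar> \<le> e * \<bar>of_int x\<bar>" "e * \<bar>of_int (i - 1)\<bar> \<le> e * \<bar>of_int x\<bar>"
      using that e by (intro mult_left_mono; linarith)+
    then have "\<bar>deviation \<zeta> l i\<bar> \<le> e * \<bar>of_int x\<bar> + C" "\<bar>deviation \<zeta> l (i - 1)\<bar> \<le> e * \<bar>of_int x\<bar> + C"
      using dev[of i] dev[of "i - 1"] by (metis add_right_mono order_trans)+
    then have "\<bar>deviation \<zeta> l i\<bar> + \<bar>deviation \<zeta> l (i - 1)\<bar> \<le> B" by (simp add: B_def)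
    then show ?thesis unfolding g_def by (rule order_trans[OF abs_triangle_ineq])
  qed
  have "\<bar>\<Sum>i\<in>A. g i\<bar> \<le> real (card A) * B" if "\<And>i. i \<in> A \<Longrightarrow> \<bar>i\<bar> \<le> \<bar>x\<bar> \<and> \<bar>i - 1\<bar> \<le> \<bar>x\<bar>" for A
  proof -
    have "\<bar>\<Sum>i\<in>A. g i\<bar> \<le> (\<Sum>i\<in>A. \<bar>g i\<bar>)" by (rule sum_abs)
    also have "\<dots> \<le> real (card A) * B" using that g by (intro sum_bounded_above) auto
    finally show ?thesis .
  qed
  note bound = this
  have "\<bar>scatterer g x\<bar> \<le> \<bar>of_int x\<bar> * B"
  proof (cases "x \<ge> 0")
    case True
    then have "scatterer g x = (\<Sum>i\<in>{1..x}. g i)" by (simp add: scatterer_def)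
    then show ?thesis using bound[of "{1..x}"] True by auto
  next
    case False
    then have "scatterer g x = - (\<Sum>i\<in>{x+1..0}. g i)" by (simp add: scatterer_def)
    then show ?thesis using bound[of "{x+1..0}"] False by auto
  qed
  also have "\<dots> = 2 * e * (of_int x)\<^sup>2 + 2 * C * \<bar>of_int x\<bar>"
    by (simp add: B_def power2_eq_square algebra_simps)
  finally show ?thesis by (simp add: deviation_potential_def g_def[abs_def])
qed

text \<open>Positive gaps make \<open>scatterer\<close> increasing, so the step is the sign of the
  increment. Without absolute values the collision time is linear in the environment, and
  cancellations can be used.\<close>

lemma abs_scatterer_step:
  assumes pos: "\<And>r. \<zeta> r > 0" and v: "v \<in> {-1, 1}"
  shows "\<bar>scatterer \<zeta> (x + v) - scatterer \<zeta> x\<bar> = of_int v * (scatterer \<zeta> (x + v) - scatterer \<zeta> x)"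
  using v scatterer_diff[of \<zeta> x] scatterer_diff[of \<zeta> "x + 1"] pos[of x] pos[of "x + 1"] by auto

text \<open>The collision time is a discrete quadratic covariation of the walk and \<open>scatterer \<zeta>\<close> along
  the walk; a trapezoidal summation turns it into a boundary term and a stochastic integral.\<close>

lemma collision_time_eq:
  assumes pos: "\<And>r. \<zeta> r > 0" and unit: "\<And>k. k \<ge> 1 \<Longrightarrow> reinforced_step w k \<in> {-1, 1}"
  shows "collision_time \<zeta> w n = l * n + deviation_potential \<zeta> l (walk w n)
    - 2 * (\<Sum>k\<in>{1..<n}. deviation \<zeta> l (walk w k) * of_int (reinforced_step w (Suc k)))"
proof -
  let ?h = "deviation \<zeta> l" and ?G = "deviation_potential \<zeta> l"
  let ?I = "\<lambda>k. ?h (walk w k) * of_int (reinforced_step w (Suc k))"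
  have walk_Suc: "walk w (Suc k) = walk w k + reinforced_step w (Suc k)" for k by (simp add: walk_def)
  have "collision_time \<zeta> w n = l * n + ?G (walk w n) - 2 * (\<Sum>k<n. ?I k)"
  proof (induction n)
    case 0
    then show ?case by (simp add: collision_time_def walk_def deviation_potential_def scatterer_0)
  next
    case (Suc n)
    define v x where "v = reinforced_step w (Suc n)" and "x = walk w n"
    have v: "v \<in> {-1, 1}" using unit by (simp add: v_def)
    have "collision_time \<zeta> w (Suc n) = collision_time \<zeta> w n + \<bar>scatterer \<zeta> (x + v) - scatterer \<zeta> x\<bar>"
      by (simp add: collision_time_def gas_def walk_Suc v_def x_def)
    also have "\<bar>scatterer \<zeta> (x + v) - scatterer \<zeta> x\<bar> = l + of_int v * (?h (x + v) - ?h x)"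
      unfolding abs_scatterer_step[OF pos v] using v by (auto simp: deviation_def algebra_simps)
    \<comment> \<open>For unit steps the trapezoid rule is exact. Moving the integrand to the
      starting point \<open>x\<close>, which is known before the step, produces the term
      \<open>2 * (?h x * of_int v)\<close>.\<close>
    also have "of_int v * (?h (x + v) - ?h x) = ?G (x + v) - ?G x - 2 * (?h x * of_int v)"
      using v scatterer_diff[of "\<lambda>x. ?h x + ?h (x - 1)" x] scatterer_diff[of "\<lambda>x. ?h x + ?h (x - 1)" "x + 1"]
      by (auto simp: deviation_potential_def)
    finally show ?case using Suc by (simp add: walk_Suc v_def x_def algebra_simps)
  qed
  \<comment> \<open>The term \<open>k = 0\<close> vanishes with the deviation at 0. Starting at 1
    keeps the drift \<open>a * S k / k\<close> away from \<open>k = 0\<close>.\<close>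
  moreover have "(\<Sum>k<n. ?I k) = (\<Sum>k\<in>{1..<n}. ?I k)"
    by (rule sum.mono_neutral_right) (auto simp: walk_def)
  ultimately show ?thesis by simp
qed

context reinforced_walk
begin

lemma collision_time_adapted: "adapted n (\<lambda>w. collision_time \<zeta> w n)"
  unfolding collision_time_def gas_def
proof (rule adapted_sum)
  fix i assume i: "i \<in> {1..n}"
  show "adapted n (\<lambda>w. \<bar>scatterer \<zeta> (walk w i) - scatterer \<zeta> (walk w (i - 1))\<bar>)"
    by (rule adapted_comp2[OF adapted_walk adapted_walk]) (use i in auto)
qed

text \<open>\<open>X1\<close> is the boundary term, \<open>X2\<close> and \<open>X3\<close> are the
  martingale and drift parts of the stochastic integral. \<open>X1\<close> gives
  \<open>2 e K n + 2 C sqrt (K n)\<close>, \<open>2 X3\<close> gives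
  \<open>2 e K n + 4 C sqrt (K n)\<close>, and the last square root comes from \<open>2 X2\<close>
  by orthogonality of the increments.\<close>

lemma expectation_collision_time_deviation_le:
  assumes pos: "\<And>r. \<zeta> r > 0" and e: "e \<ge> 0" and C: "C \<ge> 0"
    and dev: "\<And>x. \<bar>deviation \<zeta> l x\<bar> \<le> e * \<bar>of_int x\<bar> + C"
  shows "expectation (\<lambda>w. \<bar>collision_time \<zeta> w n - l * n\<bar>) \<le>
    4 * e * K * n + 6 * C * sqrt (K * n) + 2 * sqrt (real n * (2 * e\<^sup>2 * K * n + 2 * C\<^sup>2))"
proof -
  define h where "h k w = deviation \<zeta> l (walk w k)" for k and w :: walk_outcome
  have h: "adapted k (h k)" for k unfolding h_def by (rule adapted_comp[OF adapted_walk]) simp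
  define X1 where "X1 w = deviation_potential \<zeta> l (walk w n)" for w :: walk_outcome
  define X2 where "X2 w = (\<Sum>k\<in>{1..<n}. h k w * D k w)" for w
  define X3 where "X3 w = (\<Sum>k\<in>{1..<n}. h k w * (a * S k w / k))" for w
  have X1: "adapted n X1" unfolding X1_def[abs_def] by (rule adapted_comp[OF adapted_walk]) simp
  have X2: "adapted n X2" unfolding X2_def[abs_def] by (rule adapted_transform[OF h])
  have hS: "adapted k (\<lambda>w. h k w * (a * S k w / k))" for k
    by (rule adapted_comp2[OF h adapted_comp[OF adapted_S]])
  have X3: "adapted n X3" unfolding X3_def[abs_def]
    by (rule adapted_sum, rule adapted_mono[OF hS]) simp
  have iS2: "integrable W (\<lambda>w. (S k w)\<^sup>2)" for k by (rule adapted_integrable, rule adapted_comp[OF adapted_S])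
  have iS1: "integrable W (\<lambda>w. \<bar>S k w\<bar>)" for k by (rule adapted_integrable, rule adapted_comp[OF adapted_S])
  have iX: "integrable W (\<lambda>w. \<bar>X1 w\<bar>)" "integrable W (\<lambda>w. \<bar>X2 w\<bar>)" "integrable W (\<lambda>w. \<bar>X3 w\<bar>)"
    by (rule adapted_integrable[OF adapted_comp], fact)+
  have "expectation (\<lambda>w. \<bar>collision_time \<zeta> w n - l * n\<bar>) \<le> expectation (\<lambda>w. \<bar>X1 w\<bar> + 2 * (\<bar>X2 w\<bar> + \<bar>X3 w\<bar>))"
  proof (rule integral_mono_AE)
    show "integrable W (\<lambda>w. \<bar>collision_time \<zeta> w n - l * n\<bar>)"
      by (rule adapted_integrable[OF adapted_comp[OF collision_time_adapted]])
    show "integrable W (\<lambda>w. \<bar>X1 w\<bar> + 2 * (\<bar>X2 w\<bar> + \<bar>X3 w\<bar>))" using iX by simp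
    show "AE w in W. \<bar>collision_time \<zeta> w n - l * n\<bar> \<le> \<bar>X1 w\<bar> + 2 * (\<bar>X2 w\<bar> + \<bar>X3 w\<bar>)"
      using AE_unit_steps
    proof eventually_elim
      case (elim w)
      have "(\<Sum>k\<in>{1..<n}. deviation \<zeta> l (walk w k) * of_int (reinforced_step w (Suc k))) = X2 w + X3 w"
        unfolding X2_def X3_def h_def D_def sum.distrib[symmetric]
        by (intro sum.cong refl) (simp add: algebra_simps)
      then have "collision_time \<zeta> w n - l * n = X1 w - 2 * (X2 w + X3 w)"
        using collision_time_eq[OF pos, where w=w and n=n and l=l] elim by (simp add: X1_def)
      moreover have "\<bar>X1 w - 2 * (X2 w + X3 w)\<bar> \<le> \<bar>X1 w\<bar> + \<bar>2 * (X2 w + X3 w)\<bar>" by (rule abs_triangle_ineq4)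
      moreover have "\<bar>2 * (X2 w + X3 w)\<bar> \<le> 2 * (\<bar>X2 w\<bar> + \<bar>X3 w\<bar>)" by (simp add: abs_mult abs_triangle_ineq)
      ultimately show ?case by simp
    qed
  qed
  also have "\<dots> = expectation (\<lambda>w. \<bar>X1 w\<bar>) + 2 * (expectation (\<lambda>w. \<bar>X2 w\<bar>) + expectation (\<lambda>w. \<bar>X3 w\<bar>))"
    using iX by simp
  also have "expectation (\<lambda>w. \<bar>X1 w\<bar>) \<le> expectation (\<lambda>w. 2 * e * (S n w)\<^sup>2 + 2 * C * \<bar>S n w\<bar>)"
    using abs_deviation_potential_le[OF dev e] iX iS1 iS2 by (intro integral_mono) (auto simp: X1_def)
  also have "\<dots> = 2 * e * expectation (\<lambda>w. (S n w)\<^sup>2) + 2 * C * expectation (\<lambda>w. \<bar>S n w\<bar>)"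
    using iS1 iS2 by simp
  also have "\<dots> \<le> 2 * e * (K * n) + 2 * C * sqrt (K * n)"
    using second_moment_le expectation_abs_walk_le e C by (intro add_mono mult_left_mono) auto
  also have "expectation (\<lambda>w. \<bar>X2 w\<bar>) \<le> sqrt (real n * (2 * e\<^sup>2 * K * n + 2 * C\<^sup>2))"
  proof (rule expectation_abs_le[OF X2])
    have "expectation (\<lambda>w. (X2 w)\<^sup>2) \<le> (\<Sum>k\<in>{1..<n}. expectation (\<lambda>w. (h k w)\<^sup>2))"
      unfolding X2_def by (rule martingale_transform_second_moment[OF h]) simp
    also have "\<dots> \<le> (\<Sum>k\<in>{1..<n}. 2 * e\<^sup>2 * K * n + 2 * C\<^sup>2)"
    proof (rule sum_mono)
      fix k assume k: "k \<in> {1..<n}"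
      have "expectation (\<lambda>w. (h k w)\<^sup>2) \<le> expectation (\<lambda>w. 2 * e\<^sup>2 * (S k w)\<^sup>2 + 2 * C\<^sup>2)"
      proof (rule integral_mono)
        show "integrable W (\<lambda>w. (h k w)\<^sup>2)" by (rule adapted_integrable[OF adapted_comp[OF h]])
        show "integrable W (\<lambda>w. 2 * e\<^sup>2 * (S k w)\<^sup>2 + 2 * C\<^sup>2)" using iS2 by simp
        fix w
        have "\<bar>h k w\<bar>\<^sup>2 \<le> (e * \<bar>S k w\<bar> + C)\<^sup>2" using dev unfolding h_def by (intro power_mono) auto
        also have "\<dots> \<le> 2 * (e * \<bar>S k w\<bar>)\<^sup>2 + 2 * C\<^sup>2"
          using sum_squares_ge_zero[of "e * \<bar>S k w\<bar> - C" 0] by (simp add: power2_eq_square algebra_simps)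
        finally show "(h k w)\<^sup>2 \<le> 2 * e\<^sup>2 * (S k w)\<^sup>2 + 2 * C\<^sup>2" by (simp add: power_mult_distrib)
      qed
      also have "\<dots> = 2 * e\<^sup>2 * expectation (\<lambda>w. (S k w)\<^sup>2) + 2 * C\<^sup>2" using iS2 by (simp add: prob_space)
      also have "\<dots> \<le> 2 * e\<^sup>2 * (K * n) + 2 * C\<^sup>2"
      proof -
        have "expectation (\<lambda>w. (S k w)\<^sup>2) \<le> K * k" by (rule second_moment_le)
        also have "\<dots> \<le> K * n" using k K_ge by (intro mult_left_mono) auto
        finally show ?thesis by (intro add_mono mult_left_mono) auto
      qed
      finally show "expectation (\<lambda>w. (h k w)\<^sup>2) \<le> 2 * e\<^sup>2 * K * n + 2 * C\<^sup>2" by (simp add: mult_ac)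
    qed
    also have "\<dots> = real (n - 1) * (2 * e\<^sup>2 * K * n + 2 * C\<^sup>2)" by simp
    also have "\<dots> \<le> real n * (2 * e\<^sup>2 * K * n + 2 * C\<^sup>2)"
      using K_ge by (intro mult_right_mono add_nonneg_nonneg mult_nonneg_nonneg) auto
    finally show "expectation (\<lambda>w. (X2 w)\<^sup>2) \<le> real n * (2 * e\<^sup>2 * K * n + 2 * C\<^sup>2)" .
  qed
  also have "expectation (\<lambda>w. \<bar>X3 w\<bar>) \<le> expectation (\<lambda>w. \<Sum>k\<in>{1..<n}. e / k * (S k w)\<^sup>2 + C / k * \<bar>S k w\<bar>)"
  proof (rule integral_mono[OF iX(3)])
    show "integrable W (\<lambda>w. \<Sum>k\<in>{1..<n}. e / k * (S k w)\<^sup>2 + C / k * \<bar>S k w\<bar>)"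
      using iS1 iS2 by (intro Bochner_Integration.integrable_sum Bochner_Integration.integrable_add integrable_mult_right)
    fix w
    have "\<bar>X3 w\<bar> \<le> (\<Sum>k\<in>{1..<n}. \<bar>h k w * (a * S k w / k)\<bar>)" unfolding X3_def by (rule sum_abs)
    also have "\<dots> \<le> (\<Sum>k\<in>{1..<n}. e / k * (S k w)\<^sup>2 + C / k * \<bar>S k w\<bar>)"
    proof (rule sum_mono)
      fix k
      have "\<bar>h k w * (a * S k w / k)\<bar> = \<bar>h k w\<bar> * (\<bar>a\<bar> * (\<bar>S k w\<bar> / k))" by (simp add: abs_mult)
      also have "\<dots> \<le> (e * \<bar>S k w\<bar> + C) * (1 * (\<bar>S k w\<bar> / k))"
        using dev a_bounds e C unfolding h_def by (intro mult_mono) auto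
      finally show "\<bar>h k w * (a * S k w / k)\<bar> \<le> e / k * (S k w)\<^sup>2 + C / k * \<bar>S k w\<bar>"
        by (simp add: power2_eq_square algebra_simps add_divide_distrib)
    qed
    finally show "\<bar>X3 w\<bar> \<le> (\<Sum>k\<in>{1..<n}. e / k * (S k w)\<^sup>2 + C / k * \<bar>S k w\<bar>)" .
  qed
  also have "\<dots> = (\<Sum>k\<in>{1..<n}. e / k * expectation (\<lambda>w. (S k w)\<^sup>2) + C / k * expectation (\<lambda>w. \<bar>S k w\<bar>))"
    using iS1 iS2 by simp
  also have "\<dots> \<le> (\<Sum>k\<in>{1..<n}. e * K + C * sqrt K * (1 / sqrt k))"
  proof (rule sum_mono)
    fix k assume "k \<in> {1..<n}"
    then have k: "real k > 0" by simp
    have "e / k * expectation (\<lambda>w. (S k w)\<^sup>2) + C / k * expectation (\<lambda>w. \<bar>S k w\<bar>) \<le> e / k * (K * k) + C / k * sqrt (K * k)"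
      using second_moment_le expectation_abs_walk_le e C k by (intro add_mono mult_left_mono) auto
    also have "\<dots> = e * K + C * sqrt K * (sqrt k / k)" using k by (simp add: real_sqrt_mult)
    also have "sqrt k / k = 1 / sqrt k" using k by (simp add: real_div_sqrt field_simps)
    finally show "e / k * expectation (\<lambda>w. (S k w)\<^sup>2) + C / k * expectation (\<lambda>w. \<bar>S k w\<bar>) \<le> e * K + C * sqrt K * (1 / sqrt k)" .
  qed
  also have "\<dots> = real (n - 1) * (e * K) + C * sqrt K * (\<Sum>k\<in>{1..<n}. 1 / sqrt k)"
    by (simp add: sum.distrib sum_distrib_left)
  also have "\<dots> \<le> real n * (e * K) + C * sqrt K * (2 * sqrt n)"
  proof (intro add_mono mult_left_mono mult_right_mono)
    have "(\<Sum>k\<in>{1..<n}. 1 / sqrt k) \<le> (\<Sum>k\<in>{1..n}. 1 / sqrt k)" by (intro sum_mono2) auto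
    also have "\<dots> \<le> 2 * sqrt n" by (rule sum_inverse_sqrt_le)
    finally show "(\<Sum>k\<in>{1..<n}. 1 / sqrt k) \<le> 2 * sqrt n" .
  qed (use e C K_ge in auto)
  also have "\<dots> = e * K * n + 2 * C * sqrt (K * n)" by (simp add: real_sqrt_mult)
  finally show ?thesis by (simp add: algebra_simps)
qed

lemma collision_time_tendsto:
  assumes pos: "\<And>r. \<zeta> r > 0"
    and dev: "\<And>e. e > 0 \<Longrightarrow> \<exists>C\<ge>0. \<forall>x. \<bar>deviation \<zeta> l x\<bar> \<le> e * \<bar>of_int x\<bar> + C"
  shows "(\<lambda>n. expectation (\<lambda>w. \<bar>collision_time \<zeta> w n / n - l\<bar>)) \<longlonglongrightarrow> 0"
proof (rule tendstoI)
  fix r :: real assume r: "r > 0"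
  \<comment> \<open>The bound divided by \<open>n\<close> tends to
    \<open>4 e K + 2 e sqrt (2 K)\<close>, and \<open>sqrt (2 K) < 2 K\<close> because
    \<open>K \<ge> 1\<close>; so the limit is below \<open>8 e K = r\<close>.\<close>
  define e where "e = r / (8 * K)"
  have e: "e > 0" using r K_ge by (simp add: e_def)
  obtain C where C: "C \<ge> 0" "\<And>x. \<bar>deviation \<zeta> l x\<bar> \<le> e * \<bar>of_int x\<bar> + C" using dev[OF e] by blast
  define B where "B n = 4 * e * K + 6 * C * sqrt K * sqrt (1 / n) + 2 * sqrt (2 * e\<^sup>2 * K + 2 * C\<^sup>2 * (1 / n))" for n :: nat
  have "B \<longlonglongrightarrow> 4 * e * K + 6 * C * sqrt K * sqrt 0 + 2 * sqrt (2 * e\<^sup>2 * K + 2 * C\<^sup>2 * 0)"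
    unfolding B_def by (intro tendsto_intros lim_1_over_n)
  moreover have "4 * e * K + 6 * C * sqrt K * sqrt 0 + 2 * sqrt (2 * e\<^sup>2 * K + 2 * C\<^sup>2 * 0) < r"
  proof -
    have "sqrt (2 * e\<^sup>2 * K) = e * sqrt (2 * K)" using e by (simp add: real_sqrt_mult)
    also have "sqrt (2 * K) < 2 * K" using K_ge by (intro real_less_lsqrt) (auto simp: power2_eq_square)
    then have "e * sqrt (2 * K) < e * (2 * K)" using e by (intro mult_strict_left_mono)
    finally have "2 * sqrt (2 * e\<^sup>2 * K) < 4 * e * K" by simp
    moreover have "8 * (e * K) = r" using K_ge by (simp add: e_def)
    ultimately show ?thesis by simp
  qed
  ultimately have "eventually (\<lambda>n. B n < r) sequentially" by (rule order_tendstoD(2))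
  then show "eventually (\<lambda>n. dist (expectation (\<lambda>w. \<bar>collision_time \<zeta> w n / n - l\<bar>)) 0 < r) sequentially"
    using eventually_gt_at_top[of 0]
  proof eventually_elim
    case (elim n)
    have n: "real n > 0" using elim by simp
    have "expectation (\<lambda>w. \<bar>collision_time \<zeta> w n / n - l\<bar>) = expectation (\<lambda>w. \<bar>collision_time \<zeta> w n - l * n\<bar> / n)"
    proof (rule Bochner_Integration.integral_cong[OF refl])
      fix w
      have "collision_time \<zeta> w n / n - l = (collision_time \<zeta> w n - l * n) / n" using n by (simp add: field_simps)
      then show "\<bar>collision_time \<zeta> w n / n - l\<bar> = \<bar>collision_time \<zeta> w n - l * n\<bar> / n" by (simp add: abs_divide)
    qed
    also have "\<dots> \<le> (4 * e * K * n + 6 * C * sqrt (K * n) + 2 * sqrt (real n * (2 * e\<^sup>2 * K * n + 2 * C\<^sup>2))) / n"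
      using expectation_collision_time_deviation_le[OF pos _ C(1) C(2), of n] e n by (simp add: divide_right_mono)
    also have "\<dots> = B n"
    proof -
      have s: "sqrt (1 / n) = sqrt n / n" using n by (simp add: real_sqrt_divide real_div_sqrt field_simps)
      have "2 * e\<^sup>2 * K + 2 * C\<^sup>2 * (1 / n) = (real n * (2 * e\<^sup>2 * K * n + 2 * C\<^sup>2)) / n\<^sup>2"
        using n by (simp add: field_simps power2_eq_square)
      then have "sqrt (2 * e\<^sup>2 * K + 2 * C\<^sup>2 * (1 / n)) = sqrt (real n * (2 * e\<^sup>2 * K * n + 2 * C\<^sup>2)) / n"
        using n by (simp add: real_sqrt_divide)
      then show ?thesis unfolding B_def s using n by (simp add: field_simps real_sqrt_mult)
    qed
    finally show ?case using elim by (simp add: dist_norm)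
  qed
qed

end

section \<open>Characteristic functions of the walk\<close>

lemma inverse_Suc_le_ln: "n \<ge> 1 \<Longrightarrow> 1 / real (Suc n) \<le> ln (real (Suc n) / real n)"
proof -
  assume n: "n \<ge> 1"
  have "ln (real n / real (Suc n)) \<le> real n / real (Suc n) - 1"
    using n by (intro ln_le_minus_one) simp
  also have "\<dots> = - (1 / real (Suc n))" by (simp add: field_simps)
  finally show ?thesis using n by (simp add: ln_div)
qed

lemma harmonic_sum_le: "n \<ge> 1 \<Longrightarrow> (\<Sum>k\<in>{1..n}. 1 / real k) \<le> 1 + ln (real n)"
proof (induction n rule: nat_induct_at_least)
  case (Suc n)
  then show ?case using inverse_Suc_le_ln[of n] by (simp add: ln_div)
qed simp

text \<open>For \<open>j \<ge> 2\<close> the factor is at most \<open>(j / (j - 1)) powr b\<close>,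
  and these telescope; the constant 2 bounds the factor \<open>1 + b\<close> at
  \<open>j = 1\<close>.\<close>

lemma prod_one_plus_le:
  assumes b: "0 \<le> b" "b \<le> 1" and n: "n \<ge> 1"
  shows "(\<Prod>j\<in>{1..n}. 1 + b / real j) \<le> 2 * real n powr b"
  using n
proof (induction n rule: nat_induct_at_least)
  case (Suc n)
  have n: "real n > 0" using Suc by simp
  have "1 + b / real (Suc n) \<le> 1 + b * ln (real (Suc n) / real n)"
    using inverse_Suc_le_ln[of n] Suc b mult_left_mono[of "1 / real (Suc n)" "ln (real (Suc n) / real n)" b] by simp
  also have "\<dots> \<le> exp (b * ln (real (Suc n) / real n))" by (rule exp_ge_add_one_self)
  also have "\<dots> = (real (Suc n) / real n) powr b" using n by (simp add: powr_def)
  finally have *: "1 + b / real (Suc n) \<le> (real (Suc n) / real n) powr b" .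
  have "(\<Prod>j\<in>{1..Suc n}. 1 + b / real j) = (\<Prod>j\<in>{1..n}. 1 + b / real j) * (1 + b / real (Suc n))"
    by simp
  also have "\<dots> \<le> (2 * real n powr b) * (real (Suc n) / real n) powr b"
    using Suc * b by (intro mult_mono) (auto intro!: add_nonneg_nonneg)
  also have "\<dots> = 2 * real (Suc n) powr b" using n by (simp add: powr_divide)
  finally show ?case .
qed (use b in simp)

lemma sum_inverse_squares_le: "(\<Sum>k\<in>{1..<n}. 1 / (real k)\<^sup>2) \<le> 2"
proof -
  have "(\<Sum>k\<in>{1..m}. 1 / (real k)\<^sup>2) \<le> 2 - 1 / real m" if "m \<ge> 1" for m
    using that
  proof (induction m rule: nat_induct_at_least)
    case (Suc m)
    have m: "real m > 0" using Suc by simp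
    have "1 / (real (Suc m))\<^sup>2 \<le> 1 / (real m * real (Suc m))"
      using m by (intro divide_left_mono) (auto simp: power2_eq_square)
    also have "\<dots> = 1 / real m - 1 / real (Suc m)" using m by (simp add: field_simps)
    finally show ?case using Suc by simp
  qed simp
  note * = this
  show ?thesis
  proof (cases "n \<ge> 2")
    case True
    then have "{1..<n} = {1..n-1}" by auto
    moreover have "2 - 1 / real (n - 1) \<le> 2" by simp
    ultimately show ?thesis using *[of "n - 1"] True by (metis add_leD1 le_diff_conv2 one_add_one order_trans)
  next
    case False
    then have "{1..<n} = {}" by auto
    then show ?thesis by simp
  qed
qed

text \<open>For a step \<open>v = \<plusminus>1\<close> of mean \<open>y\<close>, \<open>cos u + i y sin u = E exp (i u v)\<close> is compared with a Gaussian step of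
  mean \<open>y\<close> and variance 1.\<close>

lemma tilted_step_error:
  fixes u y :: real
  assumes u: "\<bar>u\<bar> \<le> 1" and y: "\<bar>y\<bar> \<le> 1"
  shows "cmod (cos u + \<i> * y * sin u - complex_of_real (exp (- u\<^sup>2 / 2)) * iexp (u * y)) \<le> 2 * \<bar>u\<bar> ^ 3 + u\<^sup>2 * y\<^sup>2"
proof -
  have "cmod (iexp u - (\<Sum>k\<le>2. (\<i> * u) ^ k / fact k)) \<le> \<bar>u\<bar> ^ 3 / 6"
    using iexp_approx1[of u 2] by (simp add: eval_nat_numeral)
  also have "(\<Sum>k\<le>2. (\<i> * u) ^ k / fact k) = (\<i> * u) ^ 0 / fact 0 + (\<i> * u) ^ 1 / fact 1 + (\<i> * u) ^ 2 / fact 2"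
    by (simp add: eval_nat_numeral)
  also have "\<dots> = 1 + \<i> * u - u\<^sup>2 / 2"
    by (simp add: power_mult_distrib)
  finally have e: "cmod (iexp u - (1 + \<i> * u - u\<^sup>2 / 2)) \<le> \<bar>u\<bar> ^ 3 / 6" .
  have "\<bar>Re (iexp u - (1 + \<i> * u - u\<^sup>2 / 2))\<bar> \<le> \<bar>u\<bar> ^ 3 / 6"
    by (rule order_trans[OF abs_Re_le_cmod e])
  then have c: "\<bar>cos u - (1 - u\<^sup>2 / 2)\<bar> \<le> \<bar>u\<bar> ^ 3 / 6" by (simp add: Re_exp algebra_simps)
  have "\<bar>Im (iexp u - (1 + \<i> * u - u\<^sup>2 / 2))\<bar> \<le> \<bar>u\<bar> ^ 3 / 6"
    by (rule order_trans[OF abs_Im_le_cmod e])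
  then have s: "\<bar>sin u - u\<bar> \<le> \<bar>u\<bar> ^ 3 / 6" by (simp add: Im_exp)
  have iy: "cmod (iexp (u * y) - (1 + \<i> * (u * y))) \<le> (u * y)\<^sup>2 / 2"
    using iexp_approx1[of "u * y" 1] by (simp add: eval_nat_numeral abs_mult)
  define g where "g = exp (- u\<^sup>2 / 2)"
  have g: "0 \<le> g" "g \<le> 1" by (auto simp: g_def)
  have g1: "1 - g \<le> u\<^sup>2 / 2" using exp_ge_add_one_self[of "- u\<^sup>2 / 2"] by (simp add: g_def)
  have g2: "\<bar>g - (1 - u\<^sup>2 / 2)\<bar> \<le> u ^ 4 / 4"
  proof -
    have "g * (1 + u\<^sup>2 / 2) \<le> g * exp (u\<^sup>2 / 2)" using g exp_ge_add_one_self by (intro mult_left_mono) auto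
    also have "\<dots> = 1" by (simp add: g_def flip: exp_add)
    finally have "g * (1 + u\<^sup>2 / 2) \<le> 1" .
    moreover have "(1 - g) * (u\<^sup>2 / 2) \<le> u\<^sup>2 / 2 * (u\<^sup>2 / 2)" using g1 by (intro mult_right_mono) auto
    moreover have "u\<^sup>2 / 2 * (u\<^sup>2 / 2) = u ^ 4 / 4" by (simp add: power2_eq_square eval_nat_numeral)
    moreover have "0 \<le> u ^ 4" by simp
    ultimately show ?thesis using g1 by (simp add: abs_le_iff algebra_simps)
  qed
  have u4: "u ^ 4 \<le> \<bar>u\<bar> ^ 3"
  proof -
    have "u ^ 4 = \<bar>u\<bar> * \<bar>u\<bar> ^ 3" by (simp add: eval_nat_numeral flip: abs_mult)
    also have "\<dots> \<le> 1 * \<bar>u\<bar> ^ 3" using u by (intro mult_right_mono) auto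
    finally show ?thesis by simp
  qed
  have u3: "\<bar>u\<bar> * (u\<^sup>2 / 2) = \<bar>u\<bar> ^ 3 / 2"
  proof -
    have "u\<^sup>2 = \<bar>u\<bar> * \<bar>u\<bar>" by (simp add: power2_eq_square)
    then show ?thesis by (simp add: eval_nat_numeral)
  qed
  \<comment> \<open>Both \<open>cos u\<close> and the Gaussian factor are compared with
    \<open>1 - u^2 / 2\<close>, so the second-order terms cancel. Every remainder is cubic in
    \<open>u\<close> except that of the phase \<open>exp (i u y)\<close>, which yields
    \<open>u^2 y^2\<close>.\<close>
  have split: "cos u + \<i> * y * sin u - complex_of_real (exp (- u\<^sup>2 / 2)) * iexp (u * y) =
      complex_of_real (cos u - (1 - u\<^sup>2 / 2)) + \<i> * (y * (sin u - u))
      - complex_of_real g * (iexp (u * y) - (1 + \<i> * (u * y)))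
      - complex_of_real (g - (1 - u\<^sup>2 / 2)) + \<i> * (u * y * (1 - g))"
    unfolding g_def by (simp add: algebra_simps)
  have t1: "cmod (complex_of_real (cos u - (1 - u\<^sup>2 / 2))) \<le> \<bar>u\<bar> ^ 3 / 6"
    unfolding norm_of_real by (rule c)
  have t2: "cmod (\<i> * (y * (sin u - u))) \<le> \<bar>u\<bar> ^ 3 / 6"
  proof -
    have "cmod (\<i> * (y * (sin u - u))) = \<bar>y\<bar> * \<bar>sin u - u\<bar>"
      unfolding norm_mult norm_of_real by (simp add: abs_mult flip: of_real_diff)
    also have "\<dots> \<le> 1 * (\<bar>u\<bar> ^ 3 / 6)" using y s by (intro mult_mono) auto
    finally show ?thesis by simp
  qed
  have t3: "cmod (complex_of_real g * (iexp (u * y) - (1 + \<i> * (u * y)))) \<le> u\<^sup>2 * y\<^sup>2 / 2"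
  proof -
    have "cmod (complex_of_real g * (iexp (u * y) - (1 + \<i> * (u * y)))) = g * cmod (iexp (u * y) - (1 + \<i> * (u * y)))"
      unfolding norm_mult using g by simp
    also have "\<dots> \<le> 1 * ((u * y)\<^sup>2 / 2)" using g iy by (intro mult_mono) auto
    finally show ?thesis by (simp add: power_mult_distrib)
  qed
  have t4: "cmod (complex_of_real (g - (1 - u\<^sup>2 / 2))) \<le> \<bar>u\<bar> ^ 3 / 4"
    unfolding norm_of_real using g2 u4 by linarith
  have t5: "cmod (\<i> * (u * y * (1 - g))) \<le> \<bar>u\<bar> ^ 3 / 2"
  proof -
    have "cmod (\<i> * (u * y * (1 - g))) = \<bar>u\<bar> * \<bar>1 - g\<bar> * \<bar>y\<bar>"
      unfolding norm_mult norm_of_real by (simp add: abs_mult flip: of_real_diff)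
    also have "\<dots> \<le> \<bar>u\<bar> * (u\<^sup>2 / 2) * 1" using g g1 y by (intro mult_mono) auto
    finally show ?thesis by (simp only: u3 mult_1_right)
  qed
  have "cmod (cos u + \<i> * y * sin u - complex_of_real (exp (- u\<^sup>2 / 2)) * iexp (u * y)) \<le>
      \<bar>u\<bar> ^ 3 / 6 + \<bar>u\<bar> ^ 3 / 6 + u\<^sup>2 * y\<^sup>2 / 2 + \<bar>u\<bar> ^ 3 / 4 + \<bar>u\<bar> ^ 3 / 2"
    unfolding split
    by (intro order_trans[OF norm_triangle_ineq] order_trans[OF norm_triangle_ineq4] add_mono t1 t2 t3 t4 t5)
  moreover have "0 \<le> \<bar>u\<bar> ^ 3" "0 \<le> u\<^sup>2 * y\<^sup>2" by auto
  ultimately show ?thesis by linarith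
qed

text \<open>Errors are carried forward by factors in \<open>[0, 1]\<close>, so they add up without
  amplification.\<close>

lemma perturbed_product_bound:
  fixes A :: "nat \<Rightarrow> complex" and b :: "nat \<Rightarrow> real"
  assumes "\<And>k. m \<le> k \<Longrightarrow> k < n \<Longrightarrow> cmod (A (Suc k) - b k * A k) \<le> \<epsilon> k"
    and "\<And>k. 0 \<le> b k \<and> b k \<le> 1" and "m \<le> n"
  shows "cmod (A n - complex_of_real (\<Prod>k\<in>{m..<n}. b k) * A m) \<le> (\<Sum>k\<in>{m..<n}. \<epsilon> k)"
  using assms(3,1)
proof (induction n rule: dec_induct)
  case (step n)
  let ?P = "complex_of_real (\<Prod>k\<in>{m..<n}. b k)"
  have "A (Suc n) - complex_of_real (\<Prod>k\<in>{m..<Suc n}. b k) * A m =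
      (A (Suc n) - b n * A n) + b n * (A n - ?P * A m)"
    using step.hyps by (simp add: algebra_simps)
  also have "cmod \<dots> \<le> \<epsilon> n + b n * cmod (A n - ?P * A m)"
    by (rule order_trans[OF norm_triangle_ineq]) (use step assms(2) in \<open>auto simp: norm_mult\<close>)
  also have "\<dots> \<le> \<epsilon> n + 1 * (\<Sum>k\<in>{m..<n}. \<epsilon> k)"
    using step assms(2) by (intro add_left_mono mult_mono) auto
  finally show ?case using step.hyps by simp
qed simp

context reinforced_walk
begin

text \<open>\<open>E(S\<^sub>n | S\<^sub>k) = c n k * S\<^sub>k\<close>, so freezing the factor \<open>c n k\<close> at time \<open>k\<close> removes the drift. The sum
  \<open>Q n\<close> of the squared factors is the variance that the steps contribute to \<open>S\<^sub>n\<close>.\<close>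

definition c :: "nat \<Rightarrow> nat \<Rightarrow> real" where
  "c n k = (\<Prod>j\<in>{k..<n}. 1 + a / real j)"

text \<open>With the positive part of \<open>a\<close> all factors \<open>1 + b / j\<close> are at
  least 1, so the product \<open>P n\<close> from 1 on bounds every \<open>c n k\<close> with
  \<open>k \<ge> 1\<close>. For negative \<open>a\<close> the product of the
  \<open>1 + a / j\<close> from 1 on would not.\<close>

definition b :: real where "b = max a 0"

definition P :: "nat \<Rightarrow> real" where
  "P n = (\<Prod>j\<in>{1..<n}. 1 + b / real j)"

definition Q :: "nat \<Rightarrow> real" where
  "Q n = (\<Sum>k\<in>{1..<n}. (c n (Suc k))\<^sup>2)"

text \<open>The slope with \<open>\<kappa> = 2 * a * \<kappa> + 1\<close>, for which
  \<open>\<kappa> * n\<close> solves the recursion of \<open>Q\<close> up to an error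
  \<open>a^2 * \<kappa> / n\<close>. In terms of \<open>p\<close> it is
  \<open>1 / (3 - 4 * p)\<close>.\<close>

definition \<kappa> :: real where "\<kappa> = 1 / (1 - 2 * a)"

lemma \<kappa>_pos: "\<kappa> > 0"
  using a_bounds by (simp add: \<kappa>_def)

lemma b_bounds: "0 \<le> b" "b < 1 / 2" "b \<le> 1" "a \<le> b"
  using a_bounds by (auto simp: b_def)

lemma P_ge_1: "P n \<ge> 1"
  unfolding P_def using b_bounds by (intro prod_ge_1) auto

lemma P_le: "n \<ge> 1 \<Longrightarrow> P n \<le> 2 * real n powr b"
proof -
  assume n: "n \<ge> 1"
  have "P n \<le> (\<Prod>j\<in>{1..n}. 1 + b / real j)"
    unfolding P_def using b_bounds by (intro prod_mono2) auto
  also have "\<dots> \<le> 2 * real n powr b" using b_bounds n by (intro prod_one_plus_le) auto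
  finally show ?thesis .
qed

lemma factor_bounds: "j \<ge> 1 \<Longrightarrow> 0 \<le> 1 + a / real j" "j \<ge> 1 \<Longrightarrow> 1 + a / real j \<le> 1 + b / real j"
proof -
  assume j: "j \<ge> 1"
  have "\<bar>a / real j\<bar> \<le> 1" using a_bounds(3) j by (simp add: abs_divide divide_le_eq)
  then show "0 \<le> 1 + a / real j" by linarith
  show "1 + a / real j \<le> 1 + b / real j" using b_bounds j by (simp add: divide_right_mono)
qed

lemma c_bounds: "k \<ge> 1 \<Longrightarrow> 0 \<le> c n k" "k \<ge> 1 \<Longrightarrow> c n k \<le> P n"
proof -
  assume k: "k \<ge> 1"
  show "0 \<le> c n k" unfolding c_def using factor_bounds(1) k by (intro prod_nonneg) auto
  have "c n k \<le> (\<Prod>j\<in>{k..<n}. 1 + b / real j)"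
    unfolding c_def using factor_bounds k by (intro prod_mono) auto
  also have "\<dots> \<le> P n"
    unfolding P_def using b_bounds k by (intro prod_mono2) auto
  finally show "c n k \<le> P n" .
qed

lemma c_step: "k < n \<Longrightarrow> c n k = (1 + a / real k) * c n (Suc k)"
  unfolding c_def by (simp add: prod.atLeast_Suc_lessThan)

lemma Q_Suc: "n \<ge> 1 \<Longrightarrow> Q (Suc n) = (1 + a / n)\<^sup>2 * Q n + 1"
proof -
  assume n: "n \<ge> 1"
  have "c (Suc n) (Suc k) = (1 + a / n) * c n (Suc k)" if "k \<in> {1..<n}" for k
    using that by (simp add: c_def)
  then show ?thesis
    using n by (simp add: Q_def sum_distrib_left power_mult_distrib) (simp add: c_def)
qed

text \<open>The error \<open>Q n - \<kappa> n\<close> obeys the recursion of \<open>Q\<close> with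
  source \<open>a^2 \<kappa> / n\<close> in place of 1. Solving it costs the factor
  \<open>(P n)^2\<close>, of order at most \<open>n powr (2 * b)\<close>, and a harmonic sum; the
  result is \<open>o(n)\<close> because \<open>2 * b < 1\<close>. The first \<open>\<kappa>\<close>
  in the bound is the error at \<open>n = 1\<close>, where \<open>Q\<close> is an empty sum.\<close>

lemma Q_asymp: "(\<lambda>n. Q n / n) \<longlonglongrightarrow> \<kappa>"
proof -
  have bound: "\<bar>Q n - \<kappa> * n\<bar> \<le> (P n)\<^sup>2 * (\<kappa> + \<kappa> * (\<Sum>k\<in>{1..<n}. 1 / real k))" if "n \<ge> 1" for n
    using that
  proof (induction n rule: nat_induct_at_least)
    case base
    then show ?case using \<kappa>_pos by (simp add: Q_def P_def)
  next
    case (Suc n)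
    let ?H = "\<Sum>k\<in>{1..<n}. 1 / real k"
    have n: "real n > 0" using Suc by simp
    have 1: "\<kappa> * (1 - 2 * a) = 1" using a_bounds by (simp add: \<kappa>_def)
    have "Q (Suc n) - \<kappa> * Suc n = (1 + a / n)\<^sup>2 * (Q n - \<kappa> * n) + a\<^sup>2 * \<kappa> / n + (1 - \<kappa> * (1 - 2 * a))"
      using n by (simp add: Q_Suc[OF Suc.hyps] power2_eq_square field_simps)
    then have "\<bar>Q (Suc n) - \<kappa> * Suc n\<bar> \<le> (1 + a / n)\<^sup>2 * \<bar>Q n - \<kappa> * n\<bar> + a\<^sup>2 * \<kappa> / n"
      using \<kappa>_pos n 1 by (simp add: abs_mult order_trans[OF abs_triangle_ineq])
    also have "\<dots> \<le> (1 + b / n)\<^sup>2 * ((P n)\<^sup>2 * (\<kappa> + \<kappa> * ?H)) + 1 * \<kappa> / n"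
    proof (intro add_mono mult_mono divide_right_mono)
      show "(1 + a / n)\<^sup>2 \<le> (1 + b / n)\<^sup>2" using factor_bounds[of n] Suc.hyps by (intro power_mono) auto
      show "a\<^sup>2 \<le> 1" using a_bounds by (simp add: abs_square_le_1)
    qed (use Suc \<kappa>_pos n in auto)
    also have "\<dots> = (P (Suc n))\<^sup>2 * (\<kappa> + \<kappa> * ?H) + 1 * (\<kappa> / n)"
      using Suc.hyps by (simp add: P_def power_mult_distrib)
    also have "\<dots> \<le> (P (Suc n))\<^sup>2 * (\<kappa> + \<kappa> * ?H) + (P (Suc n))\<^sup>2 * (\<kappa> / n)"
      using \<kappa>_pos n P_ge_1[of "Suc n"] by (intro add_left_mono mult_right_mono) auto
    also have "\<dots> = (P (Suc n))\<^sup>2 * (\<kappa> + \<kappa> * (\<Sum>k\<in>{1..<Suc n}. 1 / real k))"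
      using Suc.hyps by (simp add: algebra_simps)
    finally show ?case .
  qed
  have "(\<lambda>n. Q n / n - \<kappa>) \<longlonglongrightarrow> 0"
  proof (rule Lim_null_comparison)
    show "eventually (\<lambda>n. norm (Q n / n - \<kappa>) \<le> (2 * real n powr b)\<^sup>2 * (\<kappa> + \<kappa> * (1 + ln (real n))) / n) sequentially"
      using eventually_ge_at_top[of 1]
    proof eventually_elim
      case (elim n)
      then have n: "real n \<ge> 1" by simp
      have "(\<Sum>k\<in>{1..<n}. 1 / real k) \<le> (\<Sum>k\<in>{1..n}. 1 / real k)" by (intro sum_mono2) auto
      then have h: "(\<Sum>k\<in>{1..<n}. 1 / real k) \<le> 1 + ln (real n)" using harmonic_sum_le[OF elim] by simp
      have "\<bar>Q n - \<kappa> * n\<bar> \<le> (P n)\<^sup>2 * (\<kappa> + \<kappa> * (\<Sum>k\<in>{1..<n}. 1 / real k))" by (rule bound[OF elim])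
      also have "\<dots> \<le> (2 * real n powr b)\<^sup>2 * (\<kappa> + \<kappa> * (1 + ln (real n)))"
        using h \<kappa>_pos P_le[OF elim] P_ge_1[of n]
        by (intro mult_mono power_mono add_left_mono mult_left_mono add_nonneg_nonneg mult_nonneg_nonneg sum_nonneg) auto
      finally have "\<bar>Q n - \<kappa> * n\<bar> / n \<le> (2 * real n powr b)\<^sup>2 * (\<kappa> + \<kappa> * (1 + ln (real n))) / n"
        using n by (intro divide_right_mono) auto
      moreover have "Q n / n - \<kappa> = (Q n - \<kappa> * n) / n" using n by (simp add: field_simps)
      ultimately show ?case by simp
    qed
    show "(\<lambda>n. (2 * real n powr b)\<^sup>2 * (\<kappa> + \<kappa> * (1 + ln (real n))) / n) \<longlonglongrightarrow> 0"
      using b_bounds by real_asymp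
  qed
  then show ?thesis by (rule LIM_zero_cancel)
qed

lemma abs_walk_le:
  assumes "\<And>k. k \<ge> 1 \<Longrightarrow> reinforced_step w k \<in> {-1, 1}"
  shows "\<bar>S n w\<bar> \<le> n"
proof (induction n)
  case (Suc n)
  have "\<bar>V (Suc n) w\<bar> \<le> 1" using assms[of "Suc n"] by auto
  then show ?case using Suc by (simp add: walk_Suc)
qed simp

text \<open>Given the past, a step of mean \<open>y\<close> contributes
  \<open>cos u + i y sin u\<close>, and its Gaussian substitute
  \<open>exp (- u^2 / 2) * exp (i u y)\<close>. The phase \<open>u y\<close> is absorbed exactly,
  because \<open>(1 + a / k) * c n (Suc k) = c n k\<close>, so only a deterministic factor remains.
  The term \<open>K / k\<close> bounds \<open>E y^2\<close>.\<close>

lemma characteristic_step_error: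
  assumes k: "1 \<le> k" "k < n" and u: "u = \<theta> * c n (Suc k)" "\<bar>u\<bar> \<le> 1"
  shows "cmod (expectation (\<lambda>w. iexp (\<theta> * c n (Suc k) * S (Suc k) w))
      - complex_of_real (exp (- u\<^sup>2 / 2)) * expectation (\<lambda>w. iexp (\<theta> * c n k * S k w))) \<le> 2 * \<bar>u\<bar> ^ 3 + u\<^sup>2 * (K / k)"
proof -
  define f where "f w = iexp (u * S k w)" for w
  define y where "y w = a * S k w / k" for w
  have f: "adapted k f" unfolding f_def by (rule adapted_comp[OF adapted_S])
  have y: "adapted k y" unfolding y_def by (rule adapted_comp[OF adapted_S])
  have fy: "adapted k (\<lambda>w. f w * of_real (y w))" by (rule adapted_comp2[OF f y])
  have fV: "adapted (Suc k) (\<lambda>w. f w * of_int (reinforced_step w (Suc k)))"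
    by (rule adapted_comp2[OF adapted_mono[OF f] adapted_comp[OF adapted_step]]) simp_all
  have fe: "adapted k (\<lambda>w. f w * (cos u + \<i> * y w * sin u - complex_of_real (exp (- u\<^sup>2 / 2)) * iexp (u * y w)))"
    by (rule adapted_comp2[OF f adapted_comp[OF y]])
  have fi: "adapted k (\<lambda>w. f w * iexp (u * y w))" by (rule adapted_comp2[OF f y])
  note ii = adapted_integrable[OF f] adapted_integrable[OF fy] adapted_integrable[OF fV] adapted_integrable[OF fi]
  have next_f: "expectation (\<lambda>w. f w * of_int (reinforced_step w (Suc k))) = expectation (\<lambda>w. f w * of_real (y w))"
    using expectation_next_step[OF p_nonneg _ f k(1)] p_less by (simp add: y_def a_def)
  have "expectation (\<lambda>w. iexp (\<theta> * c n (Suc k) * S (Suc k) w)) =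
      expectation (\<lambda>w. cos u * f w + \<i> * sin u * (f w * of_int (reinforced_step w (Suc k))))"
  proof (rule integral_cong_AE)
    show "AE w in W. iexp (\<theta> * c n (Suc k) * S (Suc k) w) = cos u * f w + \<i> * sin u * (f w * of_int (reinforced_step w (Suc k)))"
      using AE_unit_steps
    proof eventually_elim
      case (elim w)
      have "iexp (\<theta> * c n (Suc k) * S (Suc k) w) = f w * iexp (u * V (Suc k) w)"
        by (simp add: f_def u walk_Suc algebra_simps exp_add)
      \<comment> \<open>On the values 1 and -1 the exponential is affine in the step, so the
        conditional mean of the step suffices.\<close>
      also have "iexp (u * V (Suc k) w) = cos u + \<i> * sin u * of_int (reinforced_step w (Suc k))"
      proof -
        have "reinforced_step w (Suc k) = 1 \<or> reinforced_step w (Suc k) = -1" using elim by auto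
        moreover have "iexp u = cos u + \<i> * sin u" "iexp (- u) = cos u - \<i> * sin u"
          by (simp_all add: complex_eq_iff Re_exp Im_exp)
        ultimately show ?thesis by auto
      qed
      finally show ?case by (simp add: algebra_simps)
    qed
    show "(\<lambda>w. iexp (\<theta> * c n (Suc k) * S (Suc k) w)) \<in> borel_measurable W"
      by (rule adapted_borel_measurable, rule adapted_comp[OF adapted_S])
    show "(\<lambda>w. cos u * f w + \<i> * sin u * (f w * of_int (reinforced_step w (Suc k)))) \<in> borel_measurable W"
      using ii by (intro borel_measurable_integrable Bochner_Integration.integrable_add integrable_mult_right)
  qed
  also have "\<dots> = cos u * expectation f + \<i> * sin u * expectation (\<lambda>w. f w * of_int (reinforced_step w (Suc k)))"
    using ii by (subst Bochner_Integration.integral_add) auto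
  also have "\<dots> = cos u * expectation f + \<i> * sin u * expectation (\<lambda>w. f w * of_real (y w))"
    unfolding next_f ..
  finally have 1: "expectation (\<lambda>w. iexp (\<theta> * c n (Suc k) * S (Suc k) w)) = \<dots>" .
  have 2: "expectation (\<lambda>w. iexp (\<theta> * c n k * S k w)) = expectation (\<lambda>w. f w * iexp (u * y w))"
  proof (rule Bochner_Integration.integral_cong[OF refl])
    fix w
    have "\<theta> * c n k * S k w = u * S k w + u * y w"
      using k by (simp add: c_step[OF k(2)] u y_def algebra_simps)
    then have "iexp (\<theta> * c n k * S k w) = exp (\<i> * complex_of_real (u * S k w) + \<i> * complex_of_real (u * y w))"
      by (simp only: of_real_add distrib_left)
    also have "\<dots> = f w * iexp (u * y w)" by (simp only: exp_add f_def)
    finally show "iexp (\<theta> * c n k * S k w) = f w * iexp (u * y w)" .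
  qed
  have "cos u * expectation f + \<i> * sin u * expectation (\<lambda>w. f w * of_real (y w))
      - complex_of_real (exp (- u\<^sup>2 / 2)) * expectation (\<lambda>w. f w * iexp (u * y w)) =
     expectation (\<lambda>w. cos u * f w + \<i> * sin u * (f w * of_real (y w)) - complex_of_real (exp (- u\<^sup>2 / 2)) * (f w * iexp (u * y w)))"
  proof -
    have "integrable W (\<lambda>w. cos u * f w)" "integrable W (\<lambda>w. \<i> * sin u * (f w * of_real (y w)))"
      "integrable W (\<lambda>w. complex_of_real (exp (- u\<^sup>2 / 2)) * (f w * iexp (u * y w)))"
      by (rule integrable_mult_right, rule ii)+
    then show ?thesis by simp
  qed
  also have "\<dots> = expectation (\<lambda>w. f w * (cos u + \<i> * y w * sin u - complex_of_real (exp (- u\<^sup>2 / 2)) * iexp (u * y w)))"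
    by (rule Bochner_Integration.integral_cong) (simp_all add: algebra_simps)
  finally have diff: "cos u * expectation f + \<i> * sin u * expectation (\<lambda>w. f w * of_real (y w))
      - complex_of_real (exp (- u\<^sup>2 / 2)) * expectation (\<lambda>w. f w * iexp (u * y w)) = \<dots>" .
  have "cmod (cos u * expectation f + \<i> * sin u * expectation (\<lambda>w. f w * of_real (y w))
      - complex_of_real (exp (- u\<^sup>2 / 2)) * expectation (\<lambda>w. f w * iexp (u * y w)))
      \<le> expectation (\<lambda>w. cmod (f w * (cos u + \<i> * y w * sin u - complex_of_real (exp (- u\<^sup>2 / 2)) * iexp (u * y w))))"
    unfolding diff by (rule integral_norm_bound)
  also have "\<dots> \<le> expectation (\<lambda>w. 2 * \<bar>u\<bar> ^ 3 + u\<^sup>2 * (y w)\<^sup>2)"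
  proof (rule integral_mono_AE)
    show "integrable W (\<lambda>w. cmod (f w * (cos u + \<i> * y w * sin u - complex_of_real (exp (- u\<^sup>2 / 2)) * iexp (u * y w))))"
      by (rule adapted_integrable[OF adapted_comp[OF fe]])
    show "integrable W (\<lambda>w. 2 * \<bar>u\<bar> ^ 3 + u\<^sup>2 * (y w)\<^sup>2)"
      by (rule adapted_integrable[OF adapted_comp[OF y]])
    show "AE w in W. cmod (f w * (cos u + \<i> * y w * sin u - complex_of_real (exp (- u\<^sup>2 / 2)) * iexp (u * y w))) \<le> 2 * \<bar>u\<bar> ^ 3 + u\<^sup>2 * (y w)\<^sup>2"
      using AE_unit_steps
    proof eventually_elim
      case (elim w)
      have "\<bar>S k w\<bar> \<le> k" using elim by (intro abs_walk_le) auto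
      then have "\<bar>a\<bar> * (\<bar>S k w\<bar> / k) \<le> 1 * 1"
        using a_bounds k by (intro mult_mono) auto
      then have "\<bar>y w\<bar> \<le> 1" by (simp add: y_def abs_mult)
      then have "cmod (cos u + \<i> * y w * sin u - complex_of_real (exp (- u\<^sup>2 / 2)) * iexp (u * y w)) \<le> 2 * \<bar>u\<bar> ^ 3 + u\<^sup>2 * (y w)\<^sup>2"
        by (intro tilted_step_error u)
      then show ?case by (simp only: norm_mult f_def norm_exp_i_times mult_1)
    qed
  qed
  also have "\<dots> = 2 * \<bar>u\<bar> ^ 3 + u\<^sup>2 * expectation (\<lambda>w. (y w)\<^sup>2)"
    using adapted_integrable[OF adapted_comp[OF y, of "\<lambda>x. x\<^sup>2"], of p] by (simp add: prob_space)
  also have "\<dots> \<le> 2 * \<bar>u\<bar> ^ 3 + u\<^sup>2 * (K / k)"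
  proof (intro add_left_mono mult_left_mono)
    have "expectation (\<lambda>w. (y w)\<^sup>2) = (a / k)\<^sup>2 * expectation (\<lambda>w. (S k w)\<^sup>2)"
      by (simp add: y_def power_mult_distrib power_divide)
    also have "\<dots> \<le> (1 / k)\<^sup>2 * (K * k)"
      using second_moment_le[of k] a_bounds k
      by (intro mult_mono) (auto simp: power_divide abs_square_le_1 divide_right_mono)
    also have "\<dots> = K / k" using k by (simp add: power2_eq_square)
    finally show "expectation (\<lambda>w. (y w)\<^sup>2) \<le> K / k" .
  qed simp
  finally show ?thesis unfolding 1 2 .
qed

text \<open>\<open>\<delta>\<close> dominates every frozen frequency \<open>u k\<close>, and also
  the distance of the initial value \<open>A 1\<close> from 1, which is the summand 1 in the bound.
  The cubic terms and the terms with \<open>1 / k\<close> leave a factor \<open>\<delta>\<close>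
  beside the sum of squares \<open>\<theta>^2 * Q n\<close>; \<open>K / 2\<close> stems from the sum
  of the \<open>1 / k^2\<close>.\<close>

lemma characteristic_function_error:
  assumes n: "n \<ge> 1" and \<theta>: "\<theta> \<noteq> 0" and \<delta>: "\<delta> = \<bar>\<theta>\<bar> * P n" "\<delta> \<le> 1"
  shows "cmod (expectation (\<lambda>w. iexp (\<theta> * S n w)) - complex_of_real (exp (- (\<theta>\<^sup>2 * Q n / 2))))
    \<le> \<delta> * ((2 + K) * (\<theta>\<^sup>2 * Q n) + K / 2 + 1)"
proof -
  define A where "A k = expectation (\<lambda>w. iexp (\<theta> * c n k * S k w))" for k
  define u where "u k = \<theta> * c n (Suc k)" for k
  have \<delta>0: "\<delta> > 0" using \<theta> P_ge_1[of n] by (auto simp: \<delta>)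
  have u\<delta>: "\<bar>u k\<bar> \<le> \<delta>" for k
    using c_bounds[of "Suc k" n] by (simp add: u_def \<delta> abs_mult mult_left_mono)
  have Q: "(\<Sum>k\<in>{1..<n}. (u k)\<^sup>2) = \<theta>\<^sup>2 * Q n"
    by (simp add: u_def Q_def power_mult_distrib sum_distrib_left)
  have summand: "2 * \<bar>u k\<bar> ^ 3 + (u k)\<^sup>2 * (K / k) \<le> (2 + K) * \<delta> * (u k)\<^sup>2 + K * \<delta> / 4 * (1 / (real k)\<^sup>2)"
    if k: "k \<in> {1..<n}" for k
  proof -
    have k0: "real k > 0" using k by simp
    have "\<bar>u k\<bar> ^ 3 = \<bar>u k\<bar> * (u k)\<^sup>2" by (simp add: eval_nat_numeral flip: abs_mult)
    also have "\<dots> \<le> \<delta> * (u k)\<^sup>2" using u\<delta> by (intro mult_right_mono) auto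
    finally have 1: "\<bar>u k\<bar> ^ 3 \<le> \<delta> * (u k)\<^sup>2" .
    \<comment> \<open>AM-GM: \<open>1/k \<le> \<delta> + 1/(4 \<delta> k\<^sup>2)\<close>, and both terms are summable against \<open>(u k)\<^sup>2 \<le> \<delta>\<^sup>2\<close>\<close>
    have "0 \<le> (2 * \<delta> * k - 1)\<^sup>2" by simp
    then have "4 * \<delta> * k \<le> 4 * \<delta>\<^sup>2 * k\<^sup>2 + 1" by (simp add: power2_eq_square algebra_simps)
    then have "1 / k \<le> \<delta> + 1 / (4 * \<delta> * k\<^sup>2)"
      using \<delta>0 k0 by (simp add: field_simps power2_eq_square)
    then have "(u k)\<^sup>2 * (1 / k) \<le> (u k)\<^sup>2 * (\<delta> + 1 / (4 * \<delta> * k\<^sup>2))" by (intro mult_left_mono) auto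
    also have "\<dots> = \<delta> * (u k)\<^sup>2 + (u k)\<^sup>2 * (1 / (4 * \<delta> * k\<^sup>2))" by (simp add: algebra_simps)
    also have "(u k)\<^sup>2 * (1 / (4 * \<delta> * k\<^sup>2)) \<le> \<delta>\<^sup>2 * (1 / (4 * \<delta> * k\<^sup>2))"
    proof (rule mult_right_mono)
      have "\<bar>u k\<bar>\<^sup>2 \<le> \<delta>\<^sup>2" using u\<delta> by (intro power_mono) auto
      then show "(u k)\<^sup>2 \<le> \<delta>\<^sup>2" by simp
    qed (use \<delta>0 in auto)
    also have "\<delta>\<^sup>2 * (1 / (4 * \<delta> * k\<^sup>2)) = \<delta> / 4 * (1 / (real k)\<^sup>2)"
      using \<delta>0 by (simp add: power2_eq_square)
    finally have "K * ((u k)\<^sup>2 * (1 / k)) \<le> K * (\<delta> * (u k)\<^sup>2 + \<delta> / 4 * (1 / (real k)\<^sup>2))"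
      using K_ge by (intro mult_left_mono) auto
    then show ?thesis using 1 by (simp add: algebra_simps)
  qed
  have "cmod (A n - complex_of_real (\<Prod>k\<in>{1..<n}. exp (- (u k)\<^sup>2 / 2)) * A 1) \<le> (\<Sum>k\<in>{1..<n}. 2 * \<bar>u k\<bar> ^ 3 + (u k)\<^sup>2 * (K / k))"
  proof (rule perturbed_product_bound)
    fix k assume k: "1 \<le> k" "k < n"
    show "cmod (A (Suc k) - complex_of_real (exp (- (u k)\<^sup>2 / 2)) * A k) \<le> 2 * \<bar>u k\<bar> ^ 3 + (u k)\<^sup>2 * (K / k)"
      unfolding A_def using characteristic_step_error[OF k, of "u k" \<theta>] order_trans[OF u\<delta> \<delta>(2), of k] by (simp add: u_def mult_ac)
  qed (use n in auto)
  also have "\<dots> \<le> (\<Sum>k\<in>{1..<n}. (2 + K) * \<delta> * (u k)\<^sup>2 + K * \<delta> / 4 * (1 / (real k)\<^sup>2))"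
    by (intro sum_mono summand)
  also have "\<dots> = (2 + K) * \<delta> * (\<Sum>k\<in>{1..<n}. (u k)\<^sup>2) + K * \<delta> / 4 * (\<Sum>k\<in>{1..<n}. 1 / (real k)\<^sup>2)"
    by (simp only: sum.distrib sum_distrib_left)
  also have "\<dots> \<le> (2 + K) * \<delta> * (\<theta>\<^sup>2 * Q n) + K * \<delta> / 4 * 2"
    unfolding Q using K_ge \<delta>0 by (intro add_left_mono mult_left_mono sum_inverse_squares_le) auto
  also have "(\<Prod>k\<in>{1..<n}. exp (- (u k)\<^sup>2 / 2)) = exp (- (\<theta>\<^sup>2 * Q n / 2))"
    by (simp add: exp_sum[symmetric] Q[symmetric] sum_negf sum_divide_distrib)
  finally have main: "cmod (A n - complex_of_real (exp (- (\<theta>\<^sup>2 * Q n / 2))) * A 1) \<le> (2 + K) * \<delta> * (\<theta>\<^sup>2 * Q n) + K * \<delta> / 4 * 2" .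
  have "cmod (A 1 - 1) \<le> \<delta>"
  proof -
    have ad: "adapted 1 (\<lambda>w. iexp (\<theta> * c n 1 * S 1 w))" by (rule adapted_comp[OF adapted_S])
    have "A 1 - 1 = expectation (\<lambda>w. iexp (\<theta> * c n 1 * S 1 w) - 1)"
      unfolding A_def using adapted_integrable[OF ad, of p] by (simp add: prob_space)
    also have "cmod \<dots> \<le> expectation (\<lambda>w. cmod (iexp (\<theta> * c n 1 * S 1 w) - 1))"
      by (rule integral_norm_bound)
    also have "\<dots> \<le> expectation (\<lambda>w. \<delta>)"
    proof (rule integral_mono_AE)
      show "integrable W (\<lambda>w. cmod (iexp (\<theta> * c n 1 * S 1 w) - 1))"
        by (rule adapted_integrable[OF adapted_comp[OF adapted_S]])
      show "AE w in W. cmod (iexp (\<theta> * c n 1 * S 1 w) - 1) \<le> \<delta>"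
        using AE_unit_steps
      proof eventually_elim
        case (elim w)
        have "\<bar>S 1 w\<bar> \<le> real 1" using elim by (intro abs_walk_le) auto
        then have "\<bar>\<theta> * c n 1 * S 1 w\<bar> \<le> \<delta> * 1"
          using c_bounds[of 1 n] \<delta>0 unfolding abs_mult \<delta>(1) by (intro mult_mono mult_left_mono) auto
        moreover have "cmod (iexp (\<theta> * c n 1 * S 1 w) - 1) \<le> \<bar>\<theta> * c n 1 * S 1 w\<bar>"
          using iexp_approx1[of "\<theta> * c n 1 * S 1 w" 0] by simp
        ultimately show ?case by simp
      qed
    qed simp
    finally show ?thesis by (simp add: prob_space)
  qed
  moreover have "A n - complex_of_real (exp (- (\<theta>\<^sup>2 * Q n / 2))) =
      (A n - complex_of_real (exp (- (\<theta>\<^sup>2 * Q n / 2))) * A 1) + complex_of_real (exp (- (\<theta>\<^sup>2 * Q n / 2))) * (A 1 - 1)"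
    by (simp add: algebra_simps)
  moreover have "cmod (complex_of_real (exp (- (\<theta>\<^sup>2 * Q n / 2))) * (A 1 - 1)) \<le> 1 * cmod (A 1 - 1)"
  proof -
    have "exp (- (\<theta>\<^sup>2 * Q n / 2)) \<le> 1" by (simp add: Q_def sum_nonneg)
    then show ?thesis unfolding norm_mult by (intro mult_right_mono) auto
  qed
  ultimately have "cmod (A n - complex_of_real (exp (- (\<theta>\<^sup>2 * Q n / 2)))) \<le> ((2 + K) * \<delta> * (\<theta>\<^sup>2 * Q n) + K * \<delta> / 4 * 2) + \<delta>"
    using main by (smt (verit) norm_triangle_ineq)
  moreover have "A n = expectation (\<lambda>w. iexp (\<theta> * S n w))" by (simp add: A_def c_def)
  ultimately show ?thesis by (simp add: algebra_simps)
qed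

lemma S_measurable[measurable]: "S n \<in> borel_measurable W"
  by (rule adapted_borel_measurable[OF adapted_S])

text \<open>For \<open>\<theta> = t / sqrt (\<kappa> * n)\<close> the variance
  \<open>\<theta>^2 * Q n\<close> tends to \<open>t^2\<close>, while \<open>\<delta>\<close> is at
  most of order \<open>n powr (b - 1/2)\<close> and vanishes because \<open>b < 1/2\<close>.\<close>

theorem walk_central_limit_theorem:
  "weak_conv_m (\<lambda>n. distr W borel (\<lambda>w. S n w / sqrt (\<kappa> * n))) std_normal_distribution"
proof (rule levy_continuity)
  show "real_distribution (distr W borel (\<lambda>w. S n w / sqrt (\<kappa> * n)))" for n
    by (rule real_distribution_distr) measurable
  show "real_distribution std_normal_distribution" by (rule real_dist_normal_dist)
  fix t :: real
  have char: "char (distr W borel (\<lambda>w. S n w / sqrt (\<kappa> * n))) t = expectation (\<lambda>w. iexp (t / sqrt (\<kappa> * n) * S n w))" for n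
    unfolding char_def by (subst integral_distr) auto
  show "(\<lambda>n. char (distr W borel (\<lambda>w. S n w / sqrt (\<kappa> * n))) t) \<longlonglongrightarrow> char std_normal_distribution t"
  proof (cases "t = 0")
    case True
    then show ?thesis unfolding char by (simp add: char_std_normal_distribution prob_space)
  next
    case False
    define \<theta> where "\<theta> n = t / sqrt (\<kappa> * n)" for n :: nat
    define \<delta> where "\<delta> n = \<bar>\<theta> n\<bar> * P n" for n
    have "(\<lambda>n. t\<^sup>2 / \<kappa> * (Q n / n)) \<longlonglongrightarrow> t\<^sup>2 / \<kappa> * \<kappa>" by (intro tendsto_intros Q_asymp)
    moreover have "(\<theta> n)\<^sup>2 * Q n = t\<^sup>2 / \<kappa> * (Q n / n)" for n
      using \<kappa>_pos by (simp add: \<theta>_def power_divide)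
    ultimately have \<theta>Q: "(\<lambda>n. (\<theta> n)\<^sup>2 * Q n) \<longlonglongrightarrow> t\<^sup>2" using \<kappa>_pos by simp
    have \<delta>: "\<delta> \<longlonglongrightarrow> 0"
    proof (rule Lim_null_comparison)
      show "eventually (\<lambda>n. norm (\<delta> n) \<le> \<bar>t\<bar> / sqrt \<kappa> * (2 * real n powr b / sqrt n)) sequentially"
        using eventually_ge_at_top[of 1]
      proof eventually_elim
        case (elim n)
        have "norm (\<delta> n) = \<bar>t\<bar> / sqrt \<kappa> * (P n / sqrt n)"
          using P_ge_1[of n] \<kappa>_pos by (simp add: \<delta>_def \<theta>_def abs_mult real_sqrt_mult)
        also have "\<dots> \<le> \<bar>t\<bar> / sqrt \<kappa> * (2 * real n powr b / sqrt n)"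
          using P_le[OF elim] \<kappa>_pos by (intro mult_left_mono divide_right_mono) auto
        finally show ?case .
      qed
      have "(\<lambda>n. 2 * real n powr b / sqrt n) \<longlonglongrightarrow> 0" using b_bounds by real_asymp
      then show "(\<lambda>n. \<bar>t\<bar> / sqrt \<kappa> * (2 * real n powr b / sqrt n)) \<longlonglongrightarrow> 0" by (rule tendsto_mult_right_zero)
    qed
    have "(\<lambda>n. expectation (\<lambda>w. iexp (\<theta> n * S n w)) - complex_of_real (exp (- ((\<theta> n)\<^sup>2 * Q n / 2)))) \<longlonglongrightarrow> 0"
    proof (rule Lim_null_comparison)
      show "eventually (\<lambda>n. cmod (expectation (\<lambda>w. iexp (\<theta> n * S n w)) - complex_of_real (exp (- ((\<theta> n)\<^sup>2 * Q n / 2))))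
        \<le> \<delta> n * ((2 + K) * ((\<theta> n)\<^sup>2 * Q n) + K / 2 + 1)) sequentially"
        using order_tendstoD(2)[OF \<delta> zero_less_one] eventually_ge_at_top[of 1]
      proof eventually_elim
        case (elim n)
        show ?case
          by (rule characteristic_function_error) (use elim False \<kappa>_pos in \<open>auto simp: \<theta>_def \<delta>_def\<close>)
      qed
      have "(\<lambda>n. \<delta> n * ((2 + K) * ((\<theta> n)\<^sup>2 * Q n) + K / 2 + 1)) \<longlonglongrightarrow> 0 * ((2 + K) * t\<^sup>2 + K / 2 + 1)"
        by (intro tendsto_intros \<delta> \<theta>Q)
      then show "(\<lambda>n. \<delta> n * ((2 + K) * ((\<theta> n)\<^sup>2 * Q n) + K / 2 + 1)) \<longlonglongrightarrow> 0" by simp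
    qed
    moreover have "(\<lambda>n. complex_of_real (exp (- ((\<theta> n)\<^sup>2 * Q n / 2)))) \<longlonglongrightarrow> complex_of_real (exp (- (t\<^sup>2 / 2)))"
      by (intro tendsto_intros \<theta>Q) simp
    ultimately have "(\<lambda>n. (expectation (\<lambda>w. iexp (\<theta> n * S n w)) - complex_of_real (exp (- ((\<theta> n)\<^sup>2 * Q n / 2))))
       + complex_of_real (exp (- ((\<theta> n)\<^sup>2 * Q n / 2)))) \<longlonglongrightarrow> 0 + complex_of_real (exp (- (t\<^sup>2 / 2)))"
      by (rule tendsto_add)
    then show ?thesis by (simp add: char char_std_normal_distribution \<theta>_def)
  qed
qed

end

section \<open>Limit laws of the gas\<close>

lemma isCont_cdf_std_normal: "isCont (cdf std_normal_distribution) x"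
proof -
  interpret real_distribution std_normal_distribution by (rule real_dist_normal_dist)
  have "emeasure std_normal_distribution {x} = 0"
    by (subst emeasure_density) (auto simp: nn_integral_null_set)
  then show ?thesis by (simp add: isCont_cdf measure_def)
qed

lemma centered_gaussian_cdf:
  assumes v: "v > 0"
  shows "cdf (centered_gaussian v) x = cdf std_normal_distribution (x / sqrt v)"
proof -
  let ?N = "centered_gaussian v"
  have prob: "prob_space ?N"
    unfolding centered_gaussian_def using v by (intro prob_space_normal_density) simp
  interpret prob_space ?N by (rule prob)
  have "distributed ?N lborel (\<lambda>x. x) (normal_density 0 (sqrt v))"
    unfolding distributed_def centered_gaussian_def
    by (auto intro!: distr_id2 simp: distr_density_distr)
  then have "distributed ?N lborel (\<lambda>x. (x - 0) / sqrt v) std_normal_density"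
    using v by (subst (asm) normal_standard_normal_convert) auto
  then have d: "distr ?N lborel (\<lambda>x. x / sqrt v) = std_normal_distribution"
    by (simp add: distributed_def)
  have "cdf std_normal_distribution (x / sqrt v) = measure (distr ?N lborel (\<lambda>x. x / sqrt v)) {..x / sqrt v}"
    unfolding d cdf_def ..
  also have "\<dots> = measure ?N ((\<lambda>x. x / sqrt v) -` {..x / sqrt v} \<inter> space ?N)"
    by (subst measure_distr) (auto simp: centered_gaussian_def)
  also have "(\<lambda>x. x / sqrt v) -` {..x / sqrt v} \<inter> space ?N = {..x}"
    using v by (auto simp: centered_gaussian_def divide_le_cancel)
  finally show ?thesis by (simp add: cdf_def)
qed

lemma (in prob_space) cdf_distr_eq:
  fixes X :: "'a \<Rightarrow> real"
  assumes "X \<in> borel_measurable M"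
  shows "cdf (distr M borel X) x = prob {w \<in> space M. X w \<le> x}"
  unfolding cdf_def using assms by (subst measure_distr) (auto intro!: arg_cong[of _ _ prob])

text \<open>Unless the two variables differ by more than \<open>e\<close>,
  \<open>Z i \<le> x - e\<close> implies \<open>Y i \<le> x\<close>, which implies
  \<open>Z i \<le> x + e\<close>; continuity of the limit lets \<open>e\<close> shrink. An arbitrary
  filter covers both discrete and continuous time.\<close>

lemma (in prob_space) slutsky:
  fixes Y Z :: "'i \<Rightarrow> 'a \<Rightarrow> real"
  assumes Y[measurable]: "\<And>i. Y i \<in> borel_measurable M" and Z[measurable]: "\<And>i. Z i \<in> borel_measurable M"
    and cont: "\<And>x. isCont \<Phi> x"
    and conv: "\<And>x. ((\<lambda>i. cdf (distr M borel (Z i)) x) \<longlongrightarrow> \<Phi> x) F"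
    and close: "\<And>e. e > 0 \<Longrightarrow> ((\<lambda>i. prob {w \<in> space M. \<bar>Y i w - Z i w\<bar> > e}) \<longlongrightarrow> 0) F"
  shows "((\<lambda>i. cdf (distr M borel (Y i)) x) \<longlongrightarrow> \<Phi> x) F"
proof (rule tendstoI)
  fix r :: real assume r: "r > 0"
  obtain d where d: "d > 0" "\<And>y. dist y x < d \<Longrightarrow> dist (\<Phi> y) (\<Phi> x) < r / 3"
    using cont[of x, unfolded continuous_at_eps_delta, rule_format, of "r / 3"] r by auto
  define e where "e = d / 2"
  have e: "e > 0" "dist (\<Phi> (x + e)) (\<Phi> x) < r / 3" "dist (\<Phi> (x - e)) (\<Phi> x) < r / 3"
    using d by (auto simp: e_def dist_real_def intro!: d(2))
  have r3: "r / 3 > 0" using r by simp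
  from tendstoD[OF conv[of "x + e"] r3] tendstoD[OF conv[of "x - e"] r3] tendstoD[OF close[OF e(1)] r3]
  show "eventually (\<lambda>i. dist (cdf (distr M borel (Y i)) x) (\<Phi> x) < r) F"
  proof eventually_elim
    case (elim i)
    let ?D = "{w \<in> space M. \<bar>Y i w - Z i w\<bar> > e}"
    have D: "prob ?D < r / 3" using elim(3) by (simp add: dist_real_def)
    have "prob {w \<in> space M. Y i w \<le> x} \<le> prob ({w \<in> space M. Z i w \<le> x + e} \<union> ?D)"
      by (intro finite_measure_mono) auto
    also have "\<dots> \<le> prob {w \<in> space M. Z i w \<le> x + e} + prob ?D" by (intro measure_Un_le) auto
    finally have up: "prob {w \<in> space M. Y i w \<le> x} \<le> prob {w \<in> space M. Z i w \<le> x + e} + prob ?D" .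
    have "prob {w \<in> space M. Z i w \<le> x - e} \<le> prob ({w \<in> space M. Y i w \<le> x} \<union> ?D)"
      by (intro finite_measure_mono) auto
    also have "\<dots> \<le> prob {w \<in> space M. Y i w \<le> x} + prob ?D" by (intro measure_Un_le) auto
    finally have lo: "prob {w \<in> space M. Z i w \<le> x - e} \<le> prob {w \<in> space M. Y i w \<le> x} + prob ?D" .
    show ?case
      using elim(1,2) D e up lo unfolding cdf_distr_eq[OF Y] cdf_distr_eq[OF Z] dist_real_def
      by linarith
  qed
qed

lemma (in prob_space) weak_conv_centered_gaussian:
  fixes Y :: "'i \<Rightarrow> 'a \<Rightarrow> real"
  assumes Y[measurable]: "\<And>i. Y i \<in> borel_measurable M" and v: "v > 0"
    and conv: "\<And>x. ((\<lambda>i. cdf (distr M borel (Y i)) x) \<longlongrightarrow> cdf std_normal_distribution x) F"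
  shows "weak_conv_along F (\<lambda>i. distr M borel (\<lambda>w. sqrt v * Y i w)) (centered_gaussian v)"
  unfolding weak_conv_along_def
proof (intro allI impI)
  fix x
  have "cdf (distr M borel (\<lambda>w. sqrt v * Y i w)) x = cdf (distr M borel (Y i)) (x / sqrt v)" for i
    using v by (simp add: cdf_distr_eq pos_le_divide_eq mult.commute)
  then show "((\<lambda>i. cdf (distr M borel (\<lambda>w. sqrt v * Y i w)) x) \<longlongrightarrow> cdf (centered_gaussian v) x) F"
    using conv[of "x / sqrt v"] by (simp add: centered_gaussian_cdf[OF v])
qed

lemma (in prob_space) prob_abs_gt_le:
  fixes X :: "'a \<Rightarrow> real"
  assumes X: "integrable M X" and c: "c > 0"
  shows "prob {w \<in> space M. \<bar>X w\<bar> > c} \<le> expectation (\<lambda>w. \<bar>X w\<bar>) / c"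
proof -
  have [measurable]: "X \<in> borel_measurable M" using X by auto
  have "prob {w \<in> space M. \<bar>X w\<bar> > c} \<le> prob {w \<in> space M. \<bar>X w\<bar> \<ge> c}"
    by (intro finite_measure_mono) auto
  also have "\<dots> \<le> expectation (\<lambda>w. \<bar>X w\<bar>) / c"
    by (rule integral_Markov_inequality_measure[where A="{}"]) (use X c in auto)
  finally show ?thesis .
qed

lemma filterlim_nat_floor_linear:
  assumes "c > 0" shows "filterlim (\<lambda>t::real. nat \<lfloor>c * t\<rfloor>) at_top at_top"
proof -
  have "filterlim (\<lambda>t::real. c * t) at_top at_top" using assms by real_asymp
  then show ?thesis
    by (intro filterlim_compose[OF filterlim_nat_sequentially] filterlim_compose[OF filterlim_floor_sequentially])
qed

section \<open>Deterministic control of the continuous-time gas\<close>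

lemma collision_time_Suc:
  "collision_time \<zeta> w (Suc n) = collision_time \<zeta> w n + \<bar>gas \<zeta> w (Suc n) - gas \<zeta> w n\<bar>"
  by (simp add: collision_time_def)

lemma collision_time_mono: "m \<le> n \<Longrightarrow> collision_time \<zeta> w m \<le> collision_time \<zeta> w n"
  by (rule lift_Suc_mono_le[of "collision_time \<zeta> w"]) (auto simp: collision_time_Suc)

text \<open>Collision times are nondecreasing, so the intervals between them do not overlap. This
  serves to evaluate the definite description in \<open>cont_gas\<close> and to prove its
  measurability.\<close>

lemma collision_index_unique:
  assumes "1 \<le> i \<and> collision_time \<zeta> w (i - 1) \<le> t \<and> t < collision_time \<zeta> w i"
    and "1 \<le> j \<and> collision_time \<zeta> w (j - 1) \<le> t \<and> t < collision_time \<zeta> w j"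
  shows "i = j"
proof (rule ccontr)
  assume "i \<noteq> j"
  then consider "i \<le> j - 1" | "j \<le> i - 1" by linarith
  then show False
    using assms collision_time_mono[of i "j - 1" \<zeta> w] collision_time_mono[of j "i - 1" \<zeta> w] by cases auto
qed

text \<open>The last collision before \<open>t\<close> has an index between \<open>m\<close> and
  \<open>m'\<close>. The walk there contributes \<open>l * c\<close> and its deviation
  \<open>d\<close>; the free flight since then is no longer than the gap being crossed, which is at
  most \<open>l + 2 * d\<close>.\<close>

lemma cont_gas_deviation_le:
  assumes pos: "\<And>r. \<zeta> r > 0" and unit: "\<And>k. k \<ge> 1 \<Longrightarrow> reinforced_step w k \<in> {-1, 1}"
    and l: "l > 0" and T: "collision_time \<zeta> w m \<le> t" "t < collision_time \<zeta> w m'"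
    and s: "\<And>k. k \<in> {m..m'} \<Longrightarrow> \<bar>of_int (walk w k) - s\<bar> \<le> c"
    and d: "\<And>k. k \<in> {m..m'} \<Longrightarrow> \<bar>deviation \<zeta> l (walk w k)\<bar> \<le> d"
  shows "\<bar>cont_gas \<zeta> w t - l * s\<bar> \<le> l * c + l + 3 * d"
proof -
  define n where "n = (LEAST n. t < collision_time \<zeta> w n)"
  have n: "t < collision_time \<zeta> w n" unfolding n_def by (rule LeastI) (rule T(2))
  have "n \<le> m'" unfolding n_def by (rule Least_le) (rule T(2))
  have "m < n"
  proof (rule ccontr)
    assume "\<not> m < n"
    then have "collision_time \<zeta> w n \<le> collision_time \<zeta> w m" by (intro collision_time_mono) simp
    then show False using n T(1) by linarith
  qed
  then obtain k where k: "n = Suc k" by (cases n) auto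
  have "collision_time \<zeta> w k \<le> t"
    using not_less_Least[of k "\<lambda>n. t < collision_time \<zeta> w n"] k unfolding n_def[symmetric] by simp
  note k_le = this
  have km: "k \<in> {m..m'}" "n \<in> {m..m'}" using k \<open>n \<le> m'\<close> \<open>m < n\<close> by auto
  have idx: "1 \<le> n \<and> collision_time \<zeta> w (n - 1) \<le> t \<and> t < collision_time \<zeta> w n"
    using k k_le n by auto
  have "(THE n. 1 \<le> n \<and> collision_time \<zeta> w (n - 1) \<le> t \<and> t < collision_time \<zeta> w n) = n"
    by (rule the_equality, rule idx) (rule collision_index_unique[OF _ idx])
  then have X: "cont_gas \<zeta> w t = scatterer \<zeta> (walk w k) + of_int (reinforced_step w n) * (t - collision_time \<zeta> w k)"
    using k by (simp add: cont_gas_def Let_def)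
  have v: "\<bar>of_int (reinforced_step w n) :: real\<bar> = 1" using unit[of n] k by auto
  have "\<bar>of_int (reinforced_step w n) * (t - collision_time \<zeta> w k)\<bar> = t - collision_time \<zeta> w k"
    using v k_le by (simp add: abs_mult)
  also have "\<dots> \<le> \<bar>gas \<zeta> w n - gas \<zeta> w k\<bar>" using n k collision_time_Suc[of \<zeta> w k] by simp
  also have "gas \<zeta> w n - gas \<zeta> w k = l * of_int (reinforced_step w n) + (deviation \<zeta> l (walk w n) - deviation \<zeta> l (walk w k))"
    using k by (simp add: gas_def deviation_def walk_def algebra_simps)
  also have "\<bar>\<dots>\<bar> \<le> l + (d + d)"
  proof -
    have "\<bar>l * of_int (reinforced_step w n)\<bar> = l" using v l by (simp add: abs_mult)
    moreover have "\<bar>deviation \<zeta> l (walk w n) - deviation \<zeta> l (walk w k)\<bar> \<le> d + d"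
      using d[OF km(1)] d[OF km(2)] by linarith
    ultimately show ?thesis by linarith
  qed
  finally have 1: "\<bar>of_int (reinforced_step w n) * (t - collision_time \<zeta> w k)\<bar> \<le> l + (d + d)" .
  have "\<bar>l * (of_int (walk w k) - s)\<bar> \<le> l * c"
    unfolding abs_mult using l s[OF km(1)] by (intro mult_mono) auto
  moreover have "cont_gas \<zeta> w t - l * s = l * (of_int (walk w k) - s) + deviation \<zeta> l (walk w k)
      + of_int (reinforced_step w n) * (t - collision_time \<zeta> w k)"
    unfolding X deviation_def by (simp add: algebra_simps)
  ultimately show ?thesis using 1 d[OF km(1)] by linarith
qed

context reinforced_walk
begin

lemma collision_time_measurable[measurable]: "(\<lambda>w. collision_time \<zeta> w n) \<in> borel_measurable W"
  by (rule adapted_borel_measurable[OF collision_time_adapted])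

text \<open>The number of steps involved is random, so \<open>adapted\<close> does not apply
  directly; the value is split over the countably many collision indices.\<close>

lemma cont_gas_measurable[measurable]: "(\<lambda>w. cont_gas \<zeta> w t) \<in> borel_measurable W"
proof -
  define N where "N w = (THE n. 1 \<le> n \<and> collision_time \<zeta> w (n - 1) \<le> t \<and> t < collision_time \<zeta> w n)" for w
  define f where "f n w = scatterer \<zeta> (walk w (n - 1)) + V n w * (t - collision_time \<zeta> w (n - 1))" for n w
  have N: "N \<in> W \<rightarrow>\<^sub>M count_space UNIV"
    unfolding N_def
    by (rule measurable_THE[where I = UNIV]) (auto intro: collision_index_unique)
  have f: "f n \<in> borel_measurable W" for n
  proof (rule adapted_borel_measurable)
    have "adapted n (\<lambda>w. scatterer \<zeta> (walk w (n - 1)))" by (rule adapted_comp[OF adapted_walk]) simp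
    moreover have "adapted n (\<lambda>w. V n w * (t - collision_time \<zeta> w (n - 1)))"
      by (rule adapted_comp2[OF adapted_V adapted_comp[OF adapted_mono[OF collision_time_adapted]]]) simp
    ultimately show "adapted n (f n)" unfolding f_def by (rule adapted_comp2)
  qed
  have "(\<lambda>w. f (N w) w) \<in> borel_measurable W"
    by (rule measurable_compose_countable[OF f N])
  then show ?thesis by (simp add: cont_gas_def N_def f_def Let_def)
qed

lemma gas_measurable[measurable]: "(\<lambda>w. gas \<zeta> w n) \<in> borel_measurable W"
  unfolding gas_def by (rule adapted_borel_measurable, rule adapted_comp[OF adapted_walk], rule order_refl)

lemma walk_cdf_tendsto:
  "(\<lambda>n. cdf (distr W borel (\<lambda>w. S n w / sqrt (\<kappa> * n))) x) \<longlonglongrightarrow> cdf std_normal_distribution x"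
  using walk_central_limit_theorem isCont_cdf_std_normal by (auto simp: weak_conv_m_def weak_conv_def)

lemma expectation_deviation_tendsto:
  assumes dev: "\<And>e. e > 0 \<Longrightarrow> \<exists>C\<ge>0. \<forall>x. \<bar>deviation \<zeta> l x\<bar> \<le> e * \<bar>of_int x\<bar> + C"
  shows "(\<lambda>n. expectation (\<lambda>w. \<bar>deviation \<zeta> l (walk w n)\<bar>) / sqrt n) \<longlonglongrightarrow> 0"
proof (rule tendstoI)
  fix r :: real assume r: "r > 0"
  \<comment> \<open>\<open>E |S n| \<le> sqrt (K * n)\<close> turns the slope \<open>e\<close> into
    \<open>e * sqrt K = r / 2\<close>, leaving room for the vanishing term with
    \<open>C\<close>.\<close>
  define e where "e = r / (2 * sqrt K)"
  have e: "e > 0" using r K_ge by (simp add: e_def)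
  obtain C where C: "C \<ge> 0" "\<And>x. \<bar>deviation \<zeta> l x\<bar> \<le> e * \<bar>of_int x\<bar> + C" using dev[OF e] by blast
  have "(\<lambda>n. e * sqrt K + C / sqrt n) \<longlonglongrightarrow> e * sqrt K + 0"
    by (intro tendsto_intros) real_asymp
  moreover have "e * sqrt K + 0 < r" using r K_ge by (simp add: e_def)
  ultimately have "eventually (\<lambda>n. e * sqrt K + C / sqrt n < r) sequentially" by (rule order_tendstoD)
  then show "eventually (\<lambda>n. dist (expectation (\<lambda>w. \<bar>deviation \<zeta> l (walk w n)\<bar>) / sqrt n) 0 < r) sequentially"
    using eventually_gt_at_top[of 0]
  proof eventually_elim
    case (elim n)
    have iS: "integrable W (\<lambda>w. \<bar>S n w\<bar>)" by (rule adapted_integrable[OF adapted_comp[OF adapted_S]])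
    have "expectation (\<lambda>w. \<bar>deviation \<zeta> l (walk w n)\<bar>) \<le> expectation (\<lambda>w. e * \<bar>S n w\<bar> + C)"
      using C(2) iS by (intro integral_mono adapted_integrable[OF adapted_comp[OF adapted_walk[OF order_refl]]]) auto
    also have "\<dots> = e * expectation (\<lambda>w. \<bar>S n w\<bar>) + C" using iS by (simp add: prob_space)
    also have "\<dots> \<le> e * sqrt (K * n) + C" using e expectation_abs_walk_le by (intro add_right_mono mult_left_mono) auto
    finally have "expectation (\<lambda>w. \<bar>deviation \<zeta> l (walk w n)\<bar>) / sqrt n \<le> (e * sqrt (K * n) + C) / sqrt n"
      by (intro divide_right_mono) auto
    also have "\<dots> = e * sqrt K + C / sqrt n" using elim by (simp add: real_sqrt_mult add_divide_distrib)
    finally show ?case using elim by (simp add: dist_real_def)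
  qed
qed

text \<open>Divided by \<open>l * sqrt (\<kappa> * n)\<close>, the gas differs from the normalized
  walk by the deviation at \<open>walk w n\<close> over the same factor, which vanishes in
  mean.\<close>

lemma gas_weak_limit:
  assumes l: "l > 0"
    and dev: "\<And>e. e > 0 \<Longrightarrow> \<exists>C\<ge>0. \<forall>x. \<bar>deviation \<zeta> l x\<bar> \<le> e * \<bar>of_int x\<bar> + C"
  shows "weak_conv_along sequentially (\<lambda>n. distr W borel (\<lambda>w. gas \<zeta> w n / sqrt n)) (centered_gaussian (l\<^sup>2 * \<kappa>))"
proof -
  define Y where "Y n w = gas \<zeta> w n / (l * sqrt (\<kappa> * n))" for n w
  have "(\<lambda>n. cdf (distr W borel (Y n)) x) \<longlonglongrightarrow> cdf std_normal_distribution x" for x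
  proof (rule slutsky[OF _ _ isCont_cdf_std_normal walk_cdf_tendsto])
    fix e :: real assume e: "e > 0"
    define g where "g = e * l * sqrt \<kappa>"
    have g: "g > 0" using e l \<kappa>_pos by (simp add: g_def)
    show "(\<lambda>n. prob {w \<in> space W. \<bar>Y n w - S n w / sqrt (\<kappa> * n)\<bar> > e}) \<longlonglongrightarrow> 0"
    proof (rule Lim_null_comparison)
      have "(\<lambda>n. expectation (\<lambda>w. \<bar>deviation \<zeta> l (walk w n)\<bar>) / sqrt n * (1 / g)) \<longlonglongrightarrow> 0"
        by (rule tendsto_mult_left_zero[OF expectation_deviation_tendsto[OF dev]])
      then show "(\<lambda>n. expectation (\<lambda>w. \<bar>deviation \<zeta> l (walk w n)\<bar>) / (g * sqrt n)) \<longlonglongrightarrow> 0" by (simp add: mult.commute)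
      show "eventually (\<lambda>n. norm (prob {w \<in> space W. \<bar>Y n w - S n w / sqrt (\<kappa> * n)\<bar> > e})
          \<le> expectation (\<lambda>w. \<bar>deviation \<zeta> l (walk w n)\<bar>) / (g * sqrt n)) sequentially"
        using eventually_gt_at_top[of 0]
      proof eventually_elim
        case (elim n)
        have n: "real n > 0" using elim by simp
        have "\<bar>Y n w - S n w / sqrt (\<kappa> * n)\<bar> > e \<longleftrightarrow> \<bar>deviation \<zeta> l (walk w n)\<bar> > g * sqrt n" for w
        proof -
          have "Y n w - S n w / sqrt (\<kappa> * n) = deviation \<zeta> l (walk w n) / (l * sqrt (\<kappa> * n))"
            using l n \<kappa>_pos by (simp add: Y_def gas_def deviation_def field_simps)
          then have "\<bar>Y n w - S n w / sqrt (\<kappa> * n)\<bar> = \<bar>deviation \<zeta> l (walk w n)\<bar> / (l * sqrt (\<kappa> * n))"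
            using l n \<kappa>_pos by (simp add: abs_mult)
          then show ?thesis using l n \<kappa>_pos by (simp add: g_def pos_less_divide_eq real_sqrt_mult mult_ac)
        qed
        then have "prob {w \<in> space W. \<bar>Y n w - S n w / sqrt (\<kappa> * n)\<bar> > e} = prob {w \<in> space W. \<bar>deviation \<zeta> l (walk w n)\<bar> > g * sqrt n}"
          by simp
        also have "\<dots> \<le> expectation (\<lambda>w. \<bar>deviation \<zeta> l (walk w n)\<bar>) / (g * sqrt n)"
          by (rule prob_abs_gt_le) (use g n in \<open>auto intro!: adapted_integrable[OF adapted_comp[OF adapted_walk]]\<close>)
        finally show ?case by simp
      qed
    qed
  qed (simp_all add: Y_def[abs_def])
  then have "weak_conv_along sequentially (\<lambda>n. distr W borel (\<lambda>w. sqrt (l\<^sup>2 * \<kappa>) * Y n w)) (centered_gaussian (l\<^sup>2 * \<kappa>))"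
    using l \<kappa>_pos by (intro weak_conv_centered_gaussian) (simp_all add: Y_def[abs_def])
  moreover have "sqrt (l\<^sup>2 * \<kappa>) * Y n w = gas \<zeta> w n / sqrt n" for n w
    using l \<kappa>_pos by (simp add: Y_def real_sqrt_mult)
  ultimately show ?thesis by simp
qed

text \<open>Collision times concentrate at \<open>l n\<close>, so \<open>t\<close> falls between the
  collision times of steps \<open>m1\<close> and \<open>m2\<close>, near
  \<open>(1 - \<delta>) t / l\<close> and \<open>(1 + \<delta>) t / l\<close>. Within this window
  the walk moves by a small multiple of \<open>sqrt t\<close>. Four bad events of probability at
  most \<open>r / 8\<close> each are discarded.\<close>

lemma cont_gas_follows_walk:
  assumes pos: "\<And>r. \<zeta> r > 0" and l: "l > 0"
    and dev: "\<And>e. e > 0 \<Longrightarrow> \<exists>C\<ge>0. \<forall>x. \<bar>deviation \<zeta> l x\<bar> \<le> e * \<bar>of_int x\<bar> + C"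
    and \<eta>: "\<eta> > 0"
  shows "((\<lambda>t. prob {w \<in> space W. \<bar>cont_gas \<zeta> w t - l * S (nat \<lfloor>1 / l * t\<rfloor>) w\<bar> > \<eta> * sqrt t}) \<longlongrightarrow> 0) at_top"
proof (rule tendstoI)
  fix r :: real assume r: "r > 0"
  \<comment> \<open>Budget: with \<open>c = \<gamma> sqrt t\<close>, an oscillation
    \<open>4 c\<close> of the walk costs \<open>\<eta> / 2\<close> of the allowed
    \<open>\<eta> sqrt t\<close>. \<open>A0 / t\<close> is the bracket of the maximal inequality
    when \<open>m1 \<ge> t / (4 l)\<close>, and \<open>\<delta>\<close> keeps the part of the window
    proportional to \<open>t\<close> at \<open>r / 16\<close>. \<open>\<rho>\<close> makes the
    Markov bound \<open>sqrt (K / l) / \<rho>\<close> equal to \<open>r / 8\<close>.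
    \<open>e\<close> makes three deviations cost \<open>\<eta> / 4\<close>, and the last quarter is
    for \<open>l + 3 C\<close>.\<close>
  define \<gamma> where "\<gamma> = \<eta> / (8 * l)"
  define A0 where "A0 = 1 / \<gamma>\<^sup>2 + 2 * sqrt (l * K) / \<gamma>"
  define \<delta> where "\<delta> = min (1 / 2) (l * r / (32 * A0))"
  define \<rho> where "\<rho> = 8 * sqrt (K / l) / r"
  define e where "e = \<eta> / (12 * (\<rho> + 2 * \<gamma>))"
  have K: "K > 0" using K_ge by simp
  have \<gamma>: "\<gamma> > 0" using \<eta> l by (simp add: \<gamma>_def)
  have A0: "A0 > 0" using \<gamma> l K by (auto simp: A0_def intro!: add_pos_nonneg)
  have \<delta>: "0 < \<delta>" "\<delta> \<le> 1 / 2" "2 * \<delta> / l * A0 \<le> r / 16"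
  proof -
    have "\<delta> \<le> l * r / (32 * A0)" by (simp add: \<delta>_def)
    then show "2 * \<delta> / l * A0 \<le> r / 16" using l A0 by (simp add: field_simps)
  qed (use l r A0 in \<open>auto simp: \<delta>_def\<close>)
  have \<rho>: "\<rho> > 0" using l r K by (simp add: \<rho>_def)
  have e: "e > 0" using \<eta> \<rho> \<gamma> by (simp add: e_def)
  obtain C where C: "C \<ge> 0" "\<And>x. \<bar>deviation \<zeta> l x\<bar> \<le> e * \<bar>of_int x\<bar> + C" using dev[OF e] by blast
  \<comment> \<open>The successor in \<open>m2\<close> makes it positive and at least
    \<open>(1 + \<delta>) t / l\<close> in spite of rounding.\<close>
  define m1 m m2 where "m1 t = nat \<lfloor>(1 - \<delta>) / l * t\<rfloor>" and "m t = nat \<lfloor>1 / l * t\<rfloor>"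
    and "m2 t = Suc (nat \<lfloor>(1 + \<delta>) / l * t\<rfloor>)" for t :: real
  define f where "f n = expectation (\<lambda>w. \<bar>collision_time \<zeta> w n / n - l\<bar>)" for n :: nat
  have f: "f \<longlonglongrightarrow> 0" unfolding f_def by (rule collision_time_tendsto[OF pos dev])
  have m1_lim: "filterlim m1 at_top at_top" unfolding m1_def[abs_def]
    using \<delta> l by (intro filterlim_nat_floor_linear) auto
  have "filterlim (\<lambda>t. nat \<lfloor>(1 + \<delta>) / l * t\<rfloor>) at_top at_top"
    using \<delta> l by (intro filterlim_nat_floor_linear) auto
  then have m2_lim: "filterlim m2 at_top at_top" unfolding m2_def[abs_def]
    by (rule filterlim_compose[OF filterlim_Suc])
  have small: "r / 8 * (l * \<delta> / 4) > 0" using r l \<delta> by simp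
  have ev1: "eventually (\<lambda>t. f (m1 t) < r / 8 * (l * \<delta> / 4)) at_top"
    by (rule order_tendstoD(2)[OF filterlim_compose[OF f m1_lim] small])
  have ev2: "eventually (\<lambda>t. f (m2 t) < r / 8 * (l * \<delta> / 4)) at_top"
    by (rule order_tendstoD(2)[OF filterlim_compose[OF f m2_lim] small])
  have ev3: "eventually (\<lambda>t. l + 3 * C \<le> \<eta> / 4 * sqrt t) at_top" using \<eta> by real_asymp
  have ev4: "eventually (\<lambda>t. 2 / t * A0 \<le> r / 16) at_top" using r by real_asymp
  show "eventually (\<lambda>t. dist (prob {w \<in> space W. \<bar>cont_gas \<zeta> w t - l * S (nat \<lfloor>1 / l * t\<rfloor>) w\<bar> > \<eta> * sqrt t}) 0 < r) at_top"
    using ev1 ev2 ev3 ev4 eventually_ge_at_top[of "4 * l"]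
  proof eventually_elim
    case (elim t)
    have t: "t > 0" using elim(5) l by simp
    define c where "c = \<gamma> * sqrt t"
    have c: "c > 0" using \<gamma> t by (simp add: c_def)
    have m1_le: "real (m1 t) \<le> (1 - \<delta>) / l * t" unfolding m1_def using \<delta> l t by (intro of_nat_floor) auto
    have m1_gt: "real (m1 t) > (1 - \<delta>) / l * t - 1" unfolding m1_def by linarith
    have m2_ge: "real (m2 t) \<ge> (1 + \<delta>) / l * t" unfolding m2_def by linarith
    have m2_le: "real (m2 t) \<le> (1 + \<delta>) / l * t + 1" unfolding m2_def using \<delta> l t
      by (simp add: of_nat_floor)
    have mm: "m1 t \<le> m t" "m t \<le> m2 t"
    proof -
      have "(1 - \<delta>) / l * t \<le> 1 / l * t" "1 / l * t \<le> (1 + \<delta>) / l * t"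
        using \<delta> l t by (intro mult_right_mono divide_right_mono; simp)+
      note this[THEN floor_mono, THEN nat_mono]
      then show "m1 t \<le> m t" "m t \<le> m2 t"
        unfolding m1_def m_def m2_def by (blast intro: le_SucI)+
    qed
    \<comment> \<open>\<open>\<delta> \<le> 1/2\<close> gives \<open>m1 \<ge> t / (2 l) - 1\<close>,
      and \<open>t \<ge> 4 l\<close> absorbs the rounding loss.\<close>
    have m1_big: "real (m1 t) \<ge> t / (4 * l)"
    proof -
      have "1 / 2 / l * t \<le> (1 - \<delta>) / l * t" using \<delta> l t by (intro mult_right_mono divide_right_mono) auto
      moreover have "1 \<le> t / (4 * l)" using elim(5) l by simp
      moreover have "1 / 2 / l * t = 2 * (t / (4 * l))" using l by (simp add: field_simps)
      ultimately show ?thesis using m1_gt by linarith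
    qed
    then have m1_pos: "real (m1 t) > 0" using t l by (smt (verit) divide_pos_pos)
    have m2_pos: "real (m2 t) > 0" by (simp add: m2_def)
    \<comment> \<open>The relative tolerance \<open>\<delta> / 4\<close> for the collision times is
      smaller than the relative half-width \<open>\<delta>\<close> of the window; this forces
      \<open>t\<close> into the window off \<open>B1\<close> and \<open>B2\<close>.\<close>
    define B1 where "B1 = {w \<in> space W. \<bar>collision_time \<zeta> w (m1 t) / m1 t - l\<bar> > l * \<delta> / 4}"
    define B2 where "B2 = {w \<in> space W. \<bar>collision_time \<zeta> w (m2 t) / m2 t - l\<bar> > l * \<delta> / 4}"
    define B3 where "B3 = {w \<in> space W. \<exists>n\<in>{m1 t..m2 t}. \<bar>S n w - S (m1 t) w\<bar> > 2 * c}"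
    define B4 where "B4 = {w \<in> space W. \<bar>S (m1 t) w\<bar> > \<rho> * sqrt t}"
    have meas[measurable]: "B1 \<in> sets W" "B2 \<in> sets W" "B3 \<in> sets W" "B4 \<in> sets W"
      unfolding B1_def B2_def B3_def B4_def by measurable
    have iT: "integrable W (\<lambda>w. collision_time \<zeta> w n / n - l)" for n
      by (rule adapted_integrable, rule adapted_comp[OF collision_time_adapted])
    have l\<delta>: "l * \<delta> / 4 > 0" using l \<delta> by simp
    have P1: "prob B1 \<le> r / 8"
    proof -
      have "prob B1 \<le> f (m1 t) / (l * \<delta> / 4)" unfolding B1_def f_def by (rule prob_abs_gt_le[OF iT l\<delta>])
      also have "\<dots> \<le> r / 8" using elim(1) l\<delta> by (simp only: pos_divide_le_eq less_imp_le)
      finally show ?thesis .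
    qed
    have P2: "prob B2 \<le> r / 8"
    proof -
      have "prob B2 \<le> f (m2 t) / (l * \<delta> / 4)" unfolding B2_def f_def by (rule prob_abs_gt_le[OF iT l\<delta>])
      also have "\<dots> \<le> r / 8" using elim(2) l\<delta> by (simp only: pos_divide_le_eq less_imp_le)
      finally show ?thesis .
    qed
    have P3: "prob B3 \<le> r / 8"
    proof -
      have "prob B3 \<le> real (m2 t - m1 t) * (1 / c\<^sup>2 + sqrt (K / m1 t) / c)"
        unfolding B3_def using m1_pos c by (intro walk_maximal_inequality) auto
      also have "\<dots> \<le> (2 * \<delta> / l * t + 2) * (1 / c\<^sup>2 + 2 * sqrt (l * K) / sqrt t / c)"
      proof (intro mult_mono add_left_mono divide_right_mono)
        have "real (m2 t - m1 t) = real (m2 t) - real (m1 t)" using mm by simp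
        also have "\<dots> \<le> ((1 + \<delta>) / l * t + 1) - ((1 - \<delta>) / l * t - 1)" using m1_gt m2_le by linarith
        also have "\<dots> = 2 * \<delta> / l * t + 2" using l by (simp add: field_simps)
        finally show "real (m2 t - m1 t) \<le> 2 * \<delta> / l * t + 2" .
        have "K / m1 t \<le> K / (t / (4 * l))"
          using m1_big t l K m1_pos by (intro divide_left_mono) auto
        also have "\<dots> = 2\<^sup>2 * (l * K) / t" using l by simp
        finally have "sqrt (K / m1 t) \<le> sqrt (2\<^sup>2 * (l * K) / t)" by simp
        also have "\<dots> = 2 * sqrt (l * K) / sqrt t" by (simp only: real_sqrt_divide real_sqrt_mult real_sqrt_abs abs_numeral)
        finally show "sqrt (K / m1 t) \<le> 2 * sqrt (l * K) / sqrt t" .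
      qed (use c \<delta> l t K in auto)
      also have "\<dots> = (2 * \<delta> / l + 2 / t) * A0"
      proof -
        have "1 / c\<^sup>2 + 2 * sqrt (l * K) / sqrt t / c = A0 / t"
          using \<gamma> t by (simp add: c_def A0_def power_mult_distrib add_divide_distrib)
        moreover have "2 * \<delta> / l * t + 2 = (2 * \<delta> / l + 2 / t) * t" using t by (simp add: field_simps)
        ultimately show ?thesis using t by simp
      qed
      also have "\<dots> = 2 * \<delta> / l * A0 + 2 / t * A0" by (rule distrib_right)
      also have "\<dots> \<le> r / 16 + r / 16" by (intro add_mono \<delta> elim)
      finally show ?thesis by simp
    qed
    have P4: "prob B4 \<le> r / 8"
    proof -
      have "prob B4 \<le> expectation (\<lambda>w. \<bar>S (m1 t) w\<bar>) / (\<rho> * sqrt t)"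
        unfolding B4_def using \<rho> t by (intro prob_abs_gt_le adapted_integrable[OF adapted_S]) auto
      also have "\<dots> \<le> sqrt (K * m1 t) / (\<rho> * sqrt t)"
        using \<rho> t by (intro divide_right_mono expectation_abs_walk_le) auto
      also have "\<dots> \<le> sqrt (K * (1 / l * t)) / (\<rho> * sqrt t)"
      proof (intro divide_right_mono real_sqrt_le_mono mult_left_mono)
        have "(1 - \<delta>) / l * t \<le> 1 / l * t" using \<delta> l t by (intro mult_right_mono divide_right_mono) auto
        then show "real (m1 t) \<le> 1 / l * t" using m1_le by linarith
      qed (use \<rho> t K in auto)
      also have "\<dots> = sqrt (K / l) / \<rho>"
      proof -
        have "sqrt (K * (1 / l * t)) = sqrt (K / l) * sqrt t" by (simp flip: real_sqrt_mult)
        then show ?thesis using t by simp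
      qed
      also have "\<dots> = r / 8" using K l r by (simp add: \<rho>_def)
      finally show ?thesis .
    qed
    have "AE w in W. w \<in> {w \<in> space W. \<bar>cont_gas \<zeta> w t - l * S (nat \<lfloor>1 / l * t\<rfloor>) w\<bar> > \<eta> * sqrt t} \<longrightarrow>
        w \<in> B1 \<union> B2 \<union> B3 \<union> B4"
      using AE_unit_steps
    proof eventually_elim
      fix w assume unit: "\<forall>k\<ge>1. reinforced_step w k \<in> {- 1, 1}"
      show "w \<in> {w \<in> space W. \<bar>cont_gas \<zeta> w t - l * S (nat \<lfloor>1 / l * t\<rfloor>) w\<bar> > \<eta> * sqrt t} \<longrightarrow> w \<in> B1 \<union> B2 \<union> B3 \<union> B4"
      proof (intro impI, rule ccontr)
        assume bad: "w \<in> {w \<in> space W. \<bar>cont_gas \<zeta> w t - l * S (nat \<lfloor>1 / l * t\<rfloor>) w\<bar> > \<eta> * sqrt t}"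
          and good: "w \<notin> B1 \<union> B2 \<union> B3 \<union> B4"
        have w: "w \<in> space W" using bad by simp
        have g1: "\<bar>collision_time \<zeta> w (m1 t) / m1 t - l\<bar> \<le> l * \<delta> / 4"
          and g2: "\<bar>collision_time \<zeta> w (m2 t) / m2 t - l\<bar> \<le> l * \<delta> / 4"
          and g3: "\<And>n. n \<in> {m1 t..m2 t} \<Longrightarrow> \<bar>S n w - S (m1 t) w\<bar> \<le> 2 * c"
          and g4: "\<bar>S (m1 t) w\<bar> \<le> \<rho> * sqrt t"
          using good w unfolding B1_def B2_def B3_def B4_def by (auto simp: not_less)
        have T1: "collision_time \<zeta> w (m1 t) \<le> t"
        proof -
          have "collision_time \<zeta> w (m1 t) / m1 t \<le> l * (1 + \<delta>)"
            using g1 l \<delta> by (simp add: abs_le_iff algebra_simps) (smt (verit) mult_pos_pos)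
          then have "collision_time \<zeta> w (m1 t) \<le> l * (1 + \<delta>) * m1 t" using m1_pos by (simp only: pos_divide_le_eq)
          also have "\<dots> \<le> l * (1 + \<delta>) * ((1 - \<delta>) / l * t)" using m1_le l \<delta> by (intro mult_left_mono) auto
          also have "\<dots> = (1 - \<delta>\<^sup>2) * t" using l by (simp add: power2_eq_square field_simps)
          also have "\<dots> \<le> 1 * t" using t by (intro mult_right_mono) auto
          finally show ?thesis by simp
        qed
        have T2: "t < collision_time \<zeta> w (m2 t)"
        proof -
          have "\<delta> * \<delta> \<le> \<delta> * (1 / 2)" using \<delta> by (intro mult_left_mono) auto
          then have "(1 - \<delta> / 4) * (1 + \<delta>) > 1" using \<delta> by (simp add: algebra_simps)
          then have "1 * t < ((1 - \<delta> / 4) * (1 + \<delta>)) * t" using t by (intro mult_strict_right_mono)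
          also have "\<dots> = l * (1 - \<delta> / 4) * ((1 + \<delta>) / l * t)" using l by simp
          also have "\<dots> \<le> l * (1 - \<delta> / 4) * m2 t" using m2_ge l \<delta> by (intro mult_left_mono) auto
          also have "\<dots> \<le> (collision_time \<zeta> w (m2 t) / m2 t) * m2 t"
          proof (rule mult_right_mono)
            have "l * (1 - \<delta> / 4) = l - l * \<delta> / 4" by (simp add: algebra_simps)
            then show "l * (1 - \<delta> / 4) \<le> collision_time \<zeta> w (m2 t) / m2 t" using g2 by linarith
          qed simp
          finally show ?thesis using m2_pos by simp
        qed
        \<comment> \<open>Off \<open>B3\<close> and \<open>B4\<close> the walk stays within
          \<open>\<rho> sqrt t + 2 c\<close> of 0 throughout the window; \<open>d\<close> is the
          resulting bound on the deviation.\<close>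
        define d where "d = e * ((\<rho> + 2 * \<gamma>) * sqrt t) + C"
        have "\<bar>cont_gas \<zeta> w t - l * S (m t) w\<bar> \<le> l * (4 * c) + l + 3 * d"
        proof (rule cont_gas_deviation_le[OF pos _ l T1 T2])
          show "reinforced_step w k \<in> {- 1, 1}" if "k \<ge> 1" for k using unit that by blast
          fix k assume k: "k \<in> {m1 t..m2 t}"
          \<comment> \<open>Both points are compared with the start \<open>m1 t\<close> of the
            window, hence \<open>4 c\<close> instead of \<open>2 c\<close>.\<close>
          show "\<bar>S k w - S (m t) w\<bar> \<le> 4 * c" using g3[OF k] g3[of "m t"] mm by auto
          have "\<bar>S k w\<bar> \<le> \<rho> * sqrt t + 2 * c" using g3[OF k] g4 by linarith
          also have "\<dots> = (\<rho> + 2 * \<gamma>) * sqrt t" by (simp add: c_def algebra_simps)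
          finally have "e * \<bar>S k w\<bar> \<le> e * ((\<rho> + 2 * \<gamma>) * sqrt t)" using e by (intro mult_left_mono) auto
          then show "\<bar>deviation \<zeta> l (walk w k)\<bar> \<le> d" using C(2)[of "walk w k"] unfolding d_def by linarith
        qed
        also have "l * (4 * c) = \<eta> / 2 * sqrt t" using l by (simp add: c_def \<gamma>_def)
        also have "3 * d = \<eta> / 4 * sqrt t + 3 * C"
        proof -
          have "\<rho> + 2 * \<gamma> \<noteq> 0" using \<rho> \<gamma> by simp
          then have "e * (\<rho> + 2 * \<gamma>) = \<eta> / 12" unfolding e_def by (simp del: distrib_left_numeral)
          then have "e * ((\<rho> + 2 * \<gamma>) * sqrt t) = \<eta> / 12 * sqrt t" by (simp only: mult.assoc[symmetric])
          then have "d = \<eta> / 12 * sqrt t + C" unfolding d_def by (rule arg_cong[of _ _ "\<lambda>x. x + C"])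
          then show ?thesis by (simp add: field_simps)
        qed
        finally have "\<bar>cont_gas \<zeta> w t - l * S (m t) w\<bar> \<le> \<eta> * sqrt t" using elim(3) by linarith
        then show False using bad by (simp add: m_def)
      qed
    qed
    then have "prob {w \<in> space W. \<bar>cont_gas \<zeta> w t - l * S (nat \<lfloor>1 / l * t\<rfloor>) w\<bar> > \<eta> * sqrt t} \<le> prob (B1 \<union> B2 \<union> B3 \<union> B4)"
      by (rule finite_measure_mono_AE) measurable
    also have "\<dots> \<le> prob (B1 \<union> B2 \<union> B3) + prob B4" by (intro measure_Un_le) measurable
    also have "prob (B1 \<union> B2 \<union> B3) \<le> prob (B1 \<union> B2) + prob B3" by (intro measure_Un_le) measurable
    also have "prob (B1 \<union> B2) \<le> prob B1 + prob B2" by (intro measure_Un_le) measurable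
    finally show ?case using P1 P2 P3 P4 r by (simp add: dist_real_def)
  qed
qed

text \<open>By time \<open>t\<close> the walk has made about \<open>t / l\<close> steps, so the
  variance is \<open>l^2 * \<kappa> * t / l = l * \<kappa> * t\<close>; this explains the single
  power of \<open>l\<close>. \<open>Z0\<close> is the central limit theorem along
  \<open>m t\<close>, \<open>Z\<close> has \<open>m t\<close> replaced by \<open>t / l\<close> in
  the normalization, and \<open>Y\<close> is the gas; \<open>slutsky\<close> is used for both
  passages.\<close>

lemma cont_gas_weak_limit:
  assumes pos: "\<And>r. \<zeta> r > 0" and l: "l > 0"
    and dev: "\<And>e. e > 0 \<Longrightarrow> \<exists>C\<ge>0. \<forall>x. \<bar>deviation \<zeta> l x\<bar> \<le> e * \<bar>of_int x\<bar> + C"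
  shows "weak_conv_along at_top (\<lambda>t. distr W borel (\<lambda>w. cont_gas \<zeta> w t / sqrt t)) (centered_gaussian (l * \<kappa>))"
proof -
  define m where "m t = nat \<lfloor>1 / l * t\<rfloor>" for t :: real
  have m_lim: "filterlim m at_top at_top"
    unfolding m_def[abs_def] using l by (intro filterlim_nat_floor_linear) simp
  define Z0 where "Z0 t w = S (m t) w / sqrt (\<kappa> * m t)" for t w
  define Z where "Z t w = l * S (m t) w / sqrt (l * \<kappa> * t)" for t w
  define Y where "Y t w = cont_gas \<zeta> w t / sqrt (l * \<kappa> * t)" for t w
  define q where "q t = sqrt (l * m t / t)" for t
  have conv0: "((\<lambda>t. cdf (distr W borel (Z0 t)) x) \<longlongrightarrow> cdf std_normal_distribution x) at_top" for x
    unfolding Z0_def[abs_def] by (rule filterlim_compose[OF walk_cdf_tendsto m_lim])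
  have q: "(q \<longlongrightarrow> 1) at_top"
  proof -
    have "((\<lambda>t. l * m t / t) \<longlongrightarrow> 1) at_top"
    proof (rule tendsto_sandwich)
      show "eventually (\<lambda>t. 1 - l / t \<le> l * m t / t) at_top"
        using eventually_gt_at_top[of 0]
      proof eventually_elim
        case (elim t)
        have "1 / l * t - 1 \<le> m t" unfolding m_def by linarith
        then have "l * (1 / l * t - 1) \<le> l * m t" using l by (intro mult_left_mono) auto
        also have "l * (1 / l * t - 1) = t - l" using l by (simp add: right_diff_distrib)
        finally have "(t - l) / t \<le> l * m t / t" using elim by (intro divide_right_mono) auto
        then show ?case using elim by (simp add: diff_divide_distrib)
      qed
      show "eventually (\<lambda>t. l * m t / t \<le> 1) at_top"
        using eventually_gt_at_top[of 0]
      proof eventually_elim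
        case (elim t)
        have "real (m t) \<le> 1 / l * t" unfolding m_def using elim l by (intro of_nat_floor) simp
        then have "l * m t \<le> l * (1 / l * t)" using l by (intro mult_left_mono) auto
        then show ?case using elim l by simp
      qed
      show "((\<lambda>t. 1 - l / t) \<longlongrightarrow> 1) at_top" by real_asymp
    qed simp
    then have "((\<lambda>t. sqrt (l * m t / t)) \<longlongrightarrow> sqrt 1) at_top" by (rule tendsto_real_sqrt)
    then show ?thesis by (simp add: q_def[abs_def])
  qed
  have convZ: "((\<lambda>t. cdf (distr W borel (Z t)) x) \<longlongrightarrow> cdf std_normal_distribution x) at_top" for x
  proof (rule slutsky[OF _ _ isCont_cdf_std_normal conv0])
    fix e :: real assume e: "e > 0"
    show "((\<lambda>t. prob {w \<in> space W. \<bar>Z t w - Z0 t w\<bar> > e}) \<longlongrightarrow> 0) at_top"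
    proof (rule Lim_null_comparison)
      have "((\<lambda>t. \<bar>q t - 1\<bar> * sqrt (K / \<kappa>) / e) \<longlongrightarrow> \<bar>1 - 1\<bar> * sqrt (K / \<kappa>) / e) at_top"
        using e by (intro tendsto_intros q) auto
      then show "((\<lambda>t. \<bar>q t - 1\<bar> * sqrt (K / \<kappa>) / e) \<longlongrightarrow> 0) at_top" by simp
      show "eventually (\<lambda>t. norm (prob {w \<in> space W. \<bar>Z t w - Z0 t w\<bar> > e}) \<le> \<bar>q t - 1\<bar> * sqrt (K / \<kappa>) / e) at_top"
        using eventually_gt_at_top[of 0] eventually_compose_filterlim[OF eventually_gt_at_top[of 0] m_lim]
      proof eventually_elim
        case (elim t)
        have mt: "real (m t) > 0" using elim by simp
        \<comment> \<open>The change of normalization multiplies by the deterministic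
          \<open>q t\<close>, which tends to 1, while \<open>E |Z0 t|\<close> stays below
          \<open>sqrt (K / \<kappa>)\<close>.\<close>
        have qz: "Z t w - Z0 t w = (q t - 1) * Z0 t w" for w
        proof -
          have "l / sqrt (l * \<kappa> * t) = (sqrt l * sqrt l) / (sqrt l * sqrt (\<kappa> * t))"
            using l by (simp add: real_sqrt_mult)
          also have "\<dots> = sqrt l / sqrt (\<kappa> * t)" by (rule mult_divide_mult_cancel_left) (use l in simp)
          also have "\<dots> = q t / sqrt (\<kappa> * m t)"
            using mt elim \<kappa>_pos by (simp add: q_def real_sqrt_mult real_sqrt_divide)
          finally have "l / sqrt (l * \<kappa> * t) = q t / sqrt (\<kappa> * m t)" .
          then have "Z t w = q t * Z0 t w"
            unfolding Z_def Z0_def by (metis times_divide_eq_left times_divide_eq_right mult.commute)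
          then show ?thesis by (simp add: algebra_simps)
        qed
        have iZ: "integrable W (\<lambda>w. (q t - 1) * Z0 t w)"
          unfolding Z0_def by (rule adapted_integrable, rule adapted_comp[OF adapted_S])
        have "prob {w \<in> space W. \<bar>Z t w - Z0 t w\<bar> > e} \<le> expectation (\<lambda>w. \<bar>(q t - 1) * Z0 t w\<bar>) / e"
          unfolding qz by (rule prob_abs_gt_le[OF iZ e])
        also have "expectation (\<lambda>w. \<bar>(q t - 1) * Z0 t w\<bar>) = \<bar>q t - 1\<bar> * (expectation (\<lambda>w. \<bar>S (m t) w\<bar>) / sqrt (\<kappa> * m t))"
          using \<kappa>_pos by (simp add: Z0_def abs_mult)
        also have "\<dots> \<le> \<bar>q t - 1\<bar> * (sqrt (K * m t) / sqrt (\<kappa> * m t))"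
          using \<kappa>_pos by (intro mult_left_mono divide_right_mono expectation_abs_walk_le) auto
        also have "sqrt (K * m t) / sqrt (\<kappa> * m t) = sqrt (K / \<kappa>)"
          using mt by (simp add: real_sqrt_mult real_sqrt_divide)
        finally show ?case using e by (simp add: divide_right_mono)
      qed
    qed
  qed (simp_all add: Z_def[abs_def] Z0_def[abs_def])
  have "((\<lambda>t. cdf (distr W borel (Y t)) x) \<longlongrightarrow> cdf std_normal_distribution x) at_top" for x
  proof (rule slutsky[OF _ _ isCont_cdf_std_normal convZ])
    fix e :: real assume e: "e > 0"
    have \<eta>: "e * sqrt (l * \<kappa>) > 0" using e l \<kappa>_pos by simp
    show "((\<lambda>t. prob {w \<in> space W. \<bar>Y t w - Z t w\<bar> > e}) \<longlongrightarrow> 0) at_top"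
    proof (rule Lim_transform_eventually[OF cont_gas_follows_walk[OF pos l dev \<eta>]])
      show "eventually (\<lambda>t. prob {w \<in> space W. \<bar>cont_gas \<zeta> w t - l * S (nat \<lfloor>1 / l * t\<rfloor>) w\<bar> > e * sqrt (l * \<kappa>) * sqrt t} =
          prob {w \<in> space W. \<bar>Y t w - Z t w\<bar> > e}) at_top"
        using eventually_gt_at_top[of 0]
      proof eventually_elim
        case (elim t)
        have pos': "sqrt (l * \<kappa> * t) > 0" using elim l \<kappa>_pos by simp
        have "\<bar>Y t w - Z t w\<bar> > e \<longleftrightarrow> \<bar>cont_gas \<zeta> w t - l * S (nat \<lfloor>1 / l * t\<rfloor>) w\<bar> > e * sqrt (l * \<kappa>) * sqrt t" for w
        proof -
          have "Y t w - Z t w = (cont_gas \<zeta> w t - l * S (nat \<lfloor>1 / l * t\<rfloor>) w) / sqrt (l * \<kappa> * t)"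
            by (simp add: Y_def Z_def m_def diff_divide_distrib)
          then have "\<bar>Y t w - Z t w\<bar> = \<bar>cont_gas \<zeta> w t - l * S (nat \<lfloor>1 / l * t\<rfloor>) w\<bar> / sqrt (l * \<kappa> * t)"
            using pos' by (simp only: abs_divide abs_of_pos)
          moreover have "e * sqrt (l * \<kappa>) * sqrt t = e * sqrt (l * \<kappa> * t)" by (simp add: real_sqrt_mult)
          ultimately show ?thesis using pos' by (simp only: pos_less_divide_eq)
        qed
        then show ?case by simp
      qed
    qed
  qed (simp_all add: Y_def[abs_def] Z_def[abs_def])
  then have "weak_conv_along at_top (\<lambda>t. distr W borel (\<lambda>w. sqrt (l * \<kappa>) * Y t w)) (centered_gaussian (l * \<kappa>))"
    using l \<kappa>_pos by (intro weak_conv_centered_gaussian) (simp_all add: Y_def[abs_def])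
  moreover have "sqrt (l * \<kappa>) * Y t w = cont_gas \<zeta> w t / sqrt t" for t w
    using l \<kappa>_pos by (simp add: Y_def real_sqrt_mult)
  ultimately show ?thesis by simp
qed

end

theorem theorem2p3:
  fixes P :: "(int \<Rightarrow> real) measure" and p :: real
  assumes "prob_space P"
    and "sets P = sets config_space"
    and "shift_invariant P"
    and "shift_ergodic P"
    and "weak_entanglement P"
    and "\<exists>q::real. q \<ge> 2 \<and> integrable P (\<lambda>\<zeta>. exp (q * \<zeta> 1))"
    and "0 \<le> p" and "p < 3 / 4"
  shows "\<exists>l::real. l > 0 \<and>
    (AE \<zeta> in P. (\<lambda>n::nat. scatterer \<zeta> (int n) / real n) \<longlonglongrightarrow> l) \<and>
    (AE \<zeta> in P.
       weak_conv_m (\<lambda>n. distr (walk_law p) borel (\<lambda>w. gas \<zeta> w n / sqrt (real n)))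
         (centered_gaussian (l\<^sup>2 / (3 - 4 * p))) \<and>
       weak_conv_along at_top (\<lambda>t::real. distr (walk_law p) borel (\<lambda>w. cont_gas \<zeta> w t / sqrt t))
         (centered_gaussian (l / (3 - 4 * p))))"
proof -
  interpret reinforced_walk p by unfold_locales fact+
  obtain q :: real where q: "q \<ge> 2" "integrable P (\<lambda>\<zeta>. exp (q * \<zeta> 1))" using assms(6) by blast
  have space: "space P = {\<zeta>. \<forall>r. \<zeta> r > 0}"
    using sets_eq_imp_space_eq[OF assms(2)] by (simp add: space_config_space)
  have "integrable P (\<lambda>\<zeta>. \<zeta> 1)"
  proof (rule Bochner_Integration.integrable_bound[OF q(2)])
    show "(\<lambda>\<zeta>. \<zeta> 1) \<in> borel_measurable P"
      using measurable_gap[of 1] by (simp cong: measurable_cong_sets add: assms(2))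
    show "AE \<zeta> in P. norm (\<zeta> 1) \<le> norm (exp (q * \<zeta> 1))"
    proof (rule AE_I2)
      fix \<zeta> assume "\<zeta> \<in> space P"
      then have pos: "\<zeta> 1 > 0" by (simp add: space)
      then have "1 * \<zeta> 1 \<le> q * \<zeta> 1" using q by (intro mult_right_mono) auto
      also have "\<dots> \<le> exp (q * \<zeta> 1)" using exp_ge_add_one_self[of "q * \<zeta> 1"] by linarith
      finally show "norm (\<zeta> 1) \<le> norm (exp (q * \<zeta> 1))" using pos by simp
    qed
  qed
  then obtain l where l: "l > 0" and lln: "AE \<zeta> in P. (\<forall>r. \<zeta> r > 0) \<and>
    (\<lambda>n. scatterer \<zeta> (int n) / real n) \<longlonglongrightarrow> l \<and>
    (\<lambda>n. scatterer \<zeta> (- int n) / real n) \<longlonglongrightarrow> - l"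
    using scatterer_law_of_large_numbers[OF assms(1-4)] by blast
  have var: "l\<^sup>2 * \<kappa> = l\<^sup>2 / (3 - 4 * p)" "l * \<kappa> = l / (3 - 4 * p)"
    by (simp_all add: \<kappa>_def a_def)
  have "AE \<zeta> in P. (\<lambda>n. scatterer \<zeta> (int n) / real n) \<longlonglongrightarrow> l"
    using lln by eventually_elim blast
  moreover have "AE \<zeta> in P.
       weak_conv_m (\<lambda>n. distr W borel (\<lambda>w. gas \<zeta> w n / sqrt (real n))) (centered_gaussian (l\<^sup>2 / (3 - 4 * p))) \<and>
       weak_conv_along at_top (\<lambda>t::real. distr W borel (\<lambda>w. cont_gas \<zeta> w t / sqrt t)) (centered_gaussian (l / (3 - 4 * p)))"
    using lln
  \<comment> \<open>The exceptional set is that of the law of large numbers. It depends neither on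
    \<open>n\<close> nor on \<open>t\<close>, as the quenched statement requires.\<close>
  proof eventually_elim
    case (elim \<zeta>)
    have dev: "\<exists>C\<ge>0. \<forall>x. \<bar>deviation \<zeta> l x\<bar> \<le> e * \<bar>of_int x\<bar> + C" if "e > 0" for e
      unfolding deviation_def using elim that by (intro scatterer_sublinear_deviation) auto
    show ?case
      using gas_weak_limit[OF l dev] cont_gas_weak_limit[OF _ l dev] elim
      unfolding var weak_conv_along_sequentially by blast
  qed
  ultimately show ?thesis using l by blast
qed

end
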